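(* Let $H\in(0,\frac12)$, $\tilde\theta>0$, $\rho>1+\frac{1}{H\tilde\theta}$, $\tilde\sigma>0$, $\alpha_{-1},\alpha_0,\alpha_1,\alpha_2>0$ and $x>0$, and let $B^H=(B^H_t)_{0\le t\le1}$ be a scalar fractional Brownian motion with Hurst parameter $H$, with associated Wiener process $W$ (so that $B^H_t=\int_0^tK_H(t,s)\,dW_s$). Then the positive unique strong solution $x_t$ to $$x_t=x+\int_0^t\tilde f(s,x_s)\,ds-\tilde\sigma B^H_t,\qquad 0\le t\le1,$$ where for $0<s\le1$ and $0<y<\infty$ $$\tilde f(s,y)=-\alpha_{-1}\tilde\theta\, y^{2\tilde\theta+1}+\alpha_0y^{\tilde\theta+1}-\alpha_1\frac{y}{\tilde\theta}+\alpha_2 s^{2H-1}\frac{1}{\tilde\theta^{\rho}}\,y^{-\tilde\theta\rho+\tilde\theta+1}-\tilde\sigma Hs^{2H-1}(\tilde\theta+1)y^{-1},$$ is Malliavin differentiable in the direction of $B^H$ and in the direction of $W$ for all $0\le t\le1$.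
   Context: A scalar fractional Brownian motion with Hurst parameter $H$ is a centred continuous Gaussian process on $[0,1]$ with covariance $R_H(t,s)=\mathbb{E}[B^H_tB^H_s]=\frac12(t^{2H}+s^{2H}-|t-s|^{2H})$, defined on a complete probability space $(\Omega,\mathcal F,\mathbb P)$. A strong positive solution is a continuous process, adapted to the ($\mathbb P$-completed) filtration generated by $B^H$, with $x_t>0$ for all $t\in[0,1]$ almost surely, such that the equation holds for all $t\in[0,1]$ almost surely; unique means that any two such solutions coincide for all $t\in[0,1]$ almost surely. Let $\mathcal H$ be the Hilbert space obtained by completing the step functions on $[0,1]$ with respect to the inner product $\langle 1_{[0,t]},1_{[0,s]}\rangle_{\mathcal H}=R_H(t,s)$; the map $1_{[0,t]}\mapsto B^H_t$ extends to an isometry $\varphi\mapsto B^H(\varphi)$ from $\mathcal H$ onto a Gaussian subspace of $L^2(\Omega)$. For $0<s<t\le 1$ set $$K_H(t,s)=c_H\Big[\Big(\frac ts\Big)^{H-\frac12}(t-s)^{H-\frac12}+\Big(\frac12-H\Big)s^{\frac12-H}\int_s^tu^{H-\frac32}(u-s)^{H-\frac12}\,du\Big],$$ with $c_H=\sqrt{\frac{2H}{(1-2H)\beta(1-2H,H+\frac12)}}$, $\beta$ the Beta function. The map $(K_H^*1_{[0,t]})(s)=K_H(t,s)1_{[0,t]}(s)$ extends to an isometry $K_H^*:\mathcal H\to L^2([0,1])$, and $W_t:=B^H((K_H^* )^{-1}(1_{[0,t]}))$ is a Wiener process with $B^H_t=\int_0^tK_H(t,s)\,dW_s$. Malliavin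 differentiable in the direction of $W$ (resp. $B^H$) means belonging to the domain $\mathbb D^{1,2}$ in $L^2(\Omega)$ of the closed Malliavin derivative operator $D$ (resp. $D^H$) associated with the isonormal Gaussian process generated by $W$ on $L^2([0,1])$ (resp. by $B^H$ on $\mathcal H$), i.e. the closure with respect to the norm $(\mathbb E[F^2]+\mathbb E[\|DF\|^2])^{1/2}$ of the derivative defined on smooth cylindrical random variables, the norm of the derivative being taken in $L^2([0,1])$ (resp. $\mathcal H$). *)

theory Defs
  imports "HOL-Probability.Probability"
begin

section \<open>The Hilbert space $L^2([0,1])$\<close>

abbreviation leb01 :: "real measure" where
  "leb01 \<equiv> restrict_space lborel {0..1}"

definition sq_int01 :: "(real \<Rightarrow> real) set" where
  "sq_int01 = {f \<in> borel_measurable leb01. integrable leb01 (\<lambda>s. (f s)\<^sup>2)}"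

definition L2_rel :: "(real \<Rightarrow> real) \<Rightarrow> (real \<Rightarrow> real) \<Rightarrow> bool" where
  "L2_rel f g \<longleftrightarrow> f \<in> sq_int01 \<and> g \<in> sq_int01 \<and> (AE s in leb01. f s = g s)"

lemma finite_measure_leb01: "finite_measure leb01"
  by (rule finite_measureI) (simp add: emeasure_restrict_space space_restrict_space)

lemma sq_int01_measurable: "f \<in> sq_int01 \<Longrightarrow> f \<in> borel_measurable leb01"
  by (simp add: sq_int01_def)

lemma sq_int01_sq: "f \<in> sq_int01 \<Longrightarrow> integrable leb01 (\<lambda>s. (f s)\<^sup>2)"
  by (simp add: sq_int01_def)

lemma sq_int01_mult:
  assumes "f \<in> sq_int01" "g \<in> sq_int01"
  shows "integrable leb01 (\<lambda>s. f s * g s)"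
proof (rule Bochner_Integration.integrable_bound)
  show "integrable leb01 (\<lambda>s. (f s)\<^sup>2 + (g s)\<^sup>2)"
    using assms by (intro Bochner_Integration.integrable_add sq_int01_sq)
  show "(\<lambda>s. f s * g s) \<in> borel_measurable leb01"
    using assms by (intro borel_measurable_times sq_int01_measurable)
  have "\<bar>a * b\<bar> \<le> a\<^sup>2 + b\<^sup>2" for a b :: real
  proof -
    have "0 \<le> (\<bar>a\<bar> - \<bar>b\<bar>)\<^sup>2" by simp
    then have "2 * (\<bar>a\<bar> * \<bar>b\<bar>) \<le> a\<^sup>2 + b\<^sup>2" by (simp add: power2_diff)
    moreover have "0 \<le> \<bar>a\<bar> * \<bar>b\<bar>" by simp
    ultimately show ?thesis unfolding abs_mult by linarith
  qed
  then show "AE s in leb01. norm (f s * g s) \<le> norm ((f s)\<^sup>2 + (g s)\<^sup>2)" by simp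
qed

lemma sq_int01_zero: "(\<lambda>_. 0) \<in> sq_int01"
  by (simp add: sq_int01_def)

lemma sq_int01_scale: "f \<in> sq_int01 \<Longrightarrow> (\<lambda>s. c * f s) \<in> sq_int01"
  by (auto simp: sq_int01_def power_mult_distrib)

lemma sq_int01_add:
  assumes "f \<in> sq_int01" "g \<in> sq_int01"
  shows "(\<lambda>s. f s + g s) \<in> sq_int01"
proof -
  have "integrable leb01 (\<lambda>s. (f s)\<^sup>2 + (g s)\<^sup>2 + 2 * (f s * g s))"
    using assms by (intro Bochner_Integration.integrable_add integrable_mult_right sq_int01_sq sq_int01_mult)
  then show ?thesis
    using assms by (auto simp: sq_int01_def power2_sum algebra_simps)
qed

lemma sq_int01_integrable: "f \<in> sq_int01 \<Longrightarrow> integrable leb01 f"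
  by (rule finite_measure.square_integrable_imp_integrable[OF finite_measure_leb01])
     (auto simp: sq_int01_def)

quotient_type L2 = "real \<Rightarrow> real" / partial: L2_rel
proof (rule part_equivpI)
  show "\<exists>f. L2_rel f f" using sq_int01_zero by (auto simp: L2_rel_def)
  show "symp L2_rel" by (auto simp: symp_def L2_rel_def)
  show "transp L2_rel" by (auto simp: transp_def L2_rel_def)
qed

instantiation L2 :: real_vector
begin

lift_definition zero_L2 :: L2 is "\<lambda>_. 0"
  by (simp add: L2_rel_def sq_int01_zero)

lift_definition plus_L2 :: "L2 \<Rightarrow> L2 \<Rightarrow> L2" is "\<lambda>f g s. f s + g s"
  by (auto simp: L2_rel_def intro: sq_int01_add)

lift_definition scaleR_L2 :: "real \<Rightarrow> L2 \<Rightarrow> L2" is "\<lambda>c f s. c * f s"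
  by (auto simp: L2_rel_def intro: sq_int01_scale)

definition uminus_L2 :: "L2 \<Rightarrow> L2" where "uminus_L2 f = (-1) *\<^sub>R f"

definition minus_L2 :: "L2 \<Rightarrow> L2 \<Rightarrow> L2" where "minus_L2 f g = f + (-1) *\<^sub>R g"

instance
proof
  fix f g h :: L2 and a b :: real
  show "f + g + h = f + (g + h)"
    by transfer (auto simp: L2_rel_def algebra_simps intro!: sq_int01_add)
  show "f + g = g + f"
    by transfer (auto simp: L2_rel_def algebra_simps intro!: sq_int01_add)
  show "0 + f = f"
    by transfer (auto simp: L2_rel_def)
  show "- f + f = 0"
    unfolding uminus_L2_def
    by transfer (auto simp: L2_rel_def sq_int01_zero)
  show "f - g = f + - g"
    by (simp add: uminus_L2_def minus_L2_def)
  show "a *\<^sub>R (f + g) = a *\<^sub>R f + a *\<^sub>R g"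
    by transfer (auto simp: L2_rel_def algebra_simps intro!: sq_int01_add sq_int01_scale
      dest: sq_int01_scale[of _ a])
  show "(a + b) *\<^sub>R f = a *\<^sub>R f + b *\<^sub>R f"
    by transfer (auto simp: L2_rel_def distrib_right intro!: sq_int01_add sq_int01_scale
      dest: sq_int01_scale[of _ "a + b"] simp del: distrib_right_numeral)
  show "a *\<^sub>R b *\<^sub>R f = (a * b) *\<^sub>R f"
    by transfer (auto simp: L2_rel_def mult.assoc intro!: sq_int01_scale)
  show "1 *\<^sub>R f = f"
    by transfer (auto simp: L2_rel_def)
qed

end

instantiation L2 :: real_inner
begin

lift_definition inner_L2 :: "L2 \<Rightarrow> L2 \<Rightarrow> real" is "\<lambda>f g. \<integral>s. f s * g s \<partial>leb01"
  by (rule integral_cong_AE)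
     (auto simp: L2_rel_def intro: borel_measurable_integrable sq_int01_mult)

definition norm_L2 :: "L2 \<Rightarrow> real" where "norm_L2 f = sqrt (inner f f)"

definition sgn_L2 :: "L2 \<Rightarrow> L2" where "sgn_L2 f = f /\<^sub>R norm f"

definition dist_L2 :: "L2 \<Rightarrow> L2 \<Rightarrow> real" where "dist_L2 f g = norm (f - g)"

definition uniformity_L2 :: "(L2 \<times> L2) filter" where
  "uniformity_L2 = (INF e\<in>{0 <..}. principal {(x, y). dist x y < e})"

definition open_L2 :: "L2 set \<Rightarrow> bool" where
  "open_L2 U \<longleftrightarrow> (\<forall>x\<in>U. eventually (\<lambda>(x', y). x' = x \<longrightarrow> y \<in> U) uniformity)"

instance
proof
  fix f g h :: L2 and r :: real and U :: "L2 set"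
  show "dist f g = norm (f - g)" by (rule dist_L2_def)
  show "uniformity = (INF e\<in>{0 <..}. principal {(x, y :: L2). dist x y < e})"
    by (rule uniformity_L2_def)
  show "open U \<longleftrightarrow> (\<forall>x\<in>U. eventually (\<lambda>(x', y). x' = x \<longrightarrow> y \<in> U) uniformity)"
    by (rule open_L2_def)
  show "sgn f = f /\<^sub>R norm f" by (rule sgn_L2_def)
  show "norm f = sqrt (inner f f)" by (rule norm_L2_def)
  show "inner f g = inner g f"
    by transfer (simp add: mult.commute)
  show "inner (f + g) h = inner f h + inner g h"
    by transfer (auto simp: L2_rel_def distrib_right sq_int01_mult)
  show "inner (r *\<^sub>R f) g = r * inner f g"
    by transfer (auto simp: mult.assoc)
  show "0 \<le> inner f f"
    by transfer simp
  show "inner f f = 0 \<longleftrightarrow> f = 0"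
  proof transfer
    fix f assume "L2_rel f f"
    then have f: "f \<in> sq_int01" by (simp add: L2_rel_def)
    have "(\<integral>s. f s * f s \<partial>leb01) = 0 \<longleftrightarrow> (AE s in leb01. f s * f s = 0)"
      using sq_int01_mult[OF f f] by (intro integral_nonneg_eq_0_iff_AE) auto
    then show "(\<integral>s. f s * f s \<partial>leb01) = 0 \<longleftrightarrow> L2_rel f (\<lambda>_. 0)"
      using f by (simp add: L2_rel_def sq_int01_zero)
  qed
qed

end

text \<open>The class of a square-integrable function. The value \<open>0\<close> outside \<^term>\<open>sq_int01\<close> is
  a dummy.\<close>

definition to_L2 :: "(real \<Rightarrow> real) \<Rightarrow> L2" where
  "to_L2 f = abs_L2 (if f \<in> sq_int01 then f else (\<lambda>_. 0))"

lemma to_L2_surj: "\<exists>f\<in>sq_int01. h = to_L2 f"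
proof -
  have "L2_rel (rep_L2 h) (rep_L2 h)"
    using Quotient3_L2 by (rule Quotient3_rep_reflp)
  then have "rep_L2 h \<in> sq_int01" by (simp add: L2_rel_def)
  moreover have "abs_L2 (rep_L2 h) = h"
    using Quotient3_L2 by (rule Quotient3_abs_rep)
  ultimately show ?thesis
    by (intro bexI[of _ "rep_L2 h"]) (auto simp: to_L2_def)
qed

lemma norm_to_L2_diff:
  assumes "f \<in> sq_int01" "g \<in> sq_int01"
  shows "(norm (to_L2 f - to_L2 g))\<^sup>2 = (\<integral>s. (f s - g s)\<^sup>2 \<partial>leb01)"
proof -
  have r: "L2_rel f f" "L2_rel g g" using assms by (auto simp: L2_rel_def)
  have r': "L2_rel (\<lambda>s. - g s) (\<lambda>s. - g s)"
    using sq_int01_scale[OF assms(2), of "-1"] by (auto simp: L2_rel_def)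
  have r'': "L2_rel (\<lambda>s. f s + - g s) (\<lambda>s. f s + - g s)"
    using r r' unfolding L2_rel_def by (intro conjI sq_int01_add) auto
  have "to_L2 f - to_L2 g = abs_L2 f + (-1) *\<^sub>R abs_L2 g"
    using assms unfolding to_L2_def minus_L2_def by (simp only: if_True)
  also have "(-1) *\<^sub>R abs_L2 g = abs_L2 (\<lambda>s. (-1) * g s)"
    by (rule scaleR_L2.abs_eq[OF r(2)])
  also have "abs_L2 f + \<dots> = abs_L2 (\<lambda>s. f s + (-1) * g s)"
    by (rule plus_L2.abs_eq) (use r r' in simp_all)
  finally have "to_L2 f - to_L2 g = abs_L2 (\<lambda>s. f s + - g s)" by simp
  then have "(norm (to_L2 f - to_L2 g))\<^sup>2
      = inner (abs_L2 (\<lambda>s. f s + - g s)) (abs_L2 (\<lambda>s. f s + - g s))"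
    by (simp only: power2_norm_eq_inner)
  also have "\<dots> = (\<integral>s. (f s + - g s) * (f s + - g s) \<partial>leb01)"
    by (rule inner_L2.abs_eq[OF r'' r''])
  finally show ?thesis by (simp add: power2_eq_square)
qed

instance L2 :: complete_space
proof
  fix X :: "nat \<Rightarrow> L2"
  assume X: "Cauchy X"
  obtain f where f: "\<And>n. f n \<in> sq_int01" and Xf: "\<And>n. X n = to_L2 (f n)"
  proof -
    have "\<forall>n. \<exists>f. f \<in> sq_int01 \<and> X n = to_L2 f" using to_L2_surj by blast
    then obtain f where "\<forall>n. f n \<in> sq_int01 \<and> X n = to_L2 (f n)" by metis
    then show thesis using that by blast
  qed
  interpret finite_measure leb01 by (rule finite_measure_leb01)
  have [measurable]: "f n \<in> borel_measurable leb01" for n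
    using f by (rule sq_int01_measurable)
  have d2: "(dist (X m) (X n))\<^sup>2 = (\<integral>s. (f m s - f n s)\<^sup>2 \<partial>leb01)" for m n
    unfolding dist_norm Xf by (intro norm_to_L2_diff f)
  have fd: "(\<lambda>s. f m s - f n s) \<in> sq_int01" for m n
    using sq_int01_add[OF f[of m] sq_int01_scale[OF f[of n], of "-1"]] by simp
  have L1: "(\<integral>s. norm (f m s - f n s) \<partial>leb01) \<le> dist (X m) (X n)" for m n
  proof -
    have m1: "measure leb01 {0..1} = 1"
      by (simp add: measure_def emeasure_restrict_space space_restrict_space)
    define g where "g s = \<bar>f m s - f n s\<bar>" for s
    define c where "c = (\<integral>s. g s \<partial>leb01)"
    have i1: "integrable leb01 g"
      unfolding g_def using sq_int01_integrable[OF fd, of m n] by simp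
    have i2: "integrable leb01 (\<lambda>s. (g s)\<^sup>2)"
      unfolding g_def using sq_int01_sq[OF fd, of m n] by simp
    have "0 \<le> (\<integral>s. (g s - c)\<^sup>2 \<partial>leb01)" by simp
    also have "\<dots> = (\<integral>s. ((g s)\<^sup>2 + c\<^sup>2) - (2 * c) * g s \<partial>leb01)"
      by (rule Bochner_Integration.integral_cong) (auto simp: power2_diff)
    also have "\<dots> = (\<integral>s. (g s)\<^sup>2 + c\<^sup>2 \<partial>leb01) - (\<integral>s. (2 * c) * g s \<partial>leb01)"
      by (intro Bochner_Integration.integral_diff Bochner_Integration.integrable_add
          integrable_mult_right i1 i2) simp
    also have "(\<integral>s. (g s)\<^sup>2 + c\<^sup>2 \<partial>leb01) = (\<integral>s. (g s)\<^sup>2 \<partial>leb01) + c\<^sup>2"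
      by (subst Bochner_Integration.integral_add) (auto simp: i2 m1)
    also have "(\<integral>s. (2 * c) * g s \<partial>leb01) = 2 * c * c"
      by (simp add: c_def)
    finally have "c\<^sup>2 \<le> (\<integral>s. (g s)\<^sup>2 \<partial>leb01)" by (simp add: power2_eq_square)
    also have "\<dots> = (dist (X m) (X n))\<^sup>2" by (simp add: g_def d2)
    finally have "c \<le> dist (X m) (X n)" by (rule power2_le_imp_le) simp
    then show ?thesis by (simp add: c_def g_def)
  qed
  have "\<exists>N. \<forall>i\<ge>N. \<forall>j\<ge>N. (\<integral>s. norm (f i s - f j s) \<partial>leb01) < e" if "e > 0" for e
  proof -
    obtain N where N: "\<And>i j. i \<ge> N \<Longrightarrow> j \<ge> N \<Longrightarrow> dist (X i) (X j) < e"
      using metric_CauchyD[OF X \<open>e > 0\<close>] by auto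
    then show ?thesis by (intro exI[of _ N] allI impI le_less_trans[OF L1]) auto
  qed
  then obtain r where r: "strict_mono r" and AEC: "AE s in leb01. Cauchy (\<lambda>i. f (r i) s)"
    by (rule cauchy_L1_AE_cauchy_subseq[OF sq_int01_integrable[OF f]]) blast
  define g where "g s = lim (\<lambda>i. f (r i) s)" for s
  have g_meas[measurable]: "g \<in> borel_measurable leb01"
    unfolding g_def by (rule borel_measurable_lim_metric) simp
  have conv: "AE s in leb01. (\<lambda>i. f (r i) s) \<longlonglongrightarrow> g s"
    using AEC by eventually_elim (simp only: g_def Cauchy_convergent_iff convergent_LIMSEQ_iff)
  have est: "(\<integral>\<^sup>+s. ennreal ((f n s - g s)\<^sup>2) \<partial>leb01) \<le> ennreal (e\<^sup>2)"
    if e: "e > 0" and n: "\<And>j. j \<ge> n \<Longrightarrow> dist (X n) (X j) < e" for n e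
  proof -
    have "(\<integral>\<^sup>+s. ennreal ((f n s - g s)\<^sup>2) \<partial>leb01)
        = (\<integral>\<^sup>+s. liminf (\<lambda>i. ennreal ((f n s - f (r i) s)\<^sup>2)) \<partial>leb01)"
    proof (rule nn_integral_cong_AE, use conv in eventually_elim)
      fix s assume "(\<lambda>i. f (r i) s) \<longlonglongrightarrow> g s"
      then have "(\<lambda>i. ennreal ((f n s - f (r i) s)\<^sup>2)) \<longlonglongrightarrow> ennreal ((f n s - g s)\<^sup>2)"
        by (intro tendsto_ennrealI tendsto_intros)
      then show "ennreal ((f n s - g s)\<^sup>2) = liminf (\<lambda>i. ennreal ((f n s - f (r i) s)\<^sup>2))"
        by (rule lim_imp_Liminf[OF trivial_limit_sequentially, symmetric])
    qed
    also have "\<dots> \<le> liminf (\<lambda>i. \<integral>\<^sup>+s. ennreal ((f n s - f (r i) s)\<^sup>2) \<partial>leb01)"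
      by (rule nn_integral_liminf) measurable
    also have "\<dots> \<le> limsup (\<lambda>i. \<integral>\<^sup>+s. ennreal ((f n s - f (r i) s)\<^sup>2) \<partial>leb01)"
      by (rule Liminf_le_Limsup) simp
    also have "\<dots> \<le> ennreal (e\<^sup>2)"
    proof (rule Limsup_bounded)
      show "\<forall>\<^sub>F i in sequentially.
          (\<integral>\<^sup>+s. ennreal ((f n s - f (r i) s)\<^sup>2) \<partial>leb01) \<le> ennreal (e\<^sup>2)"
      proof (rule eventually_sequentiallyI)
        fix i assume "n \<le> i"
        then have "n \<le> r i" using seq_suble[OF r, of i] by simp
        then have "(dist (X n) (X (r i)))\<^sup>2 \<le> e\<^sup>2"
          using n by (intro power_mono) (auto intro: less_imp_le)
        then show "(\<integral>\<^sup>+s. ennreal ((f n s - f (r i) s)\<^sup>2) \<partial>leb01) \<le> ennreal (e\<^sup>2)"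
          using sq_int01_sq[OF fd] by (simp add: d2 nn_integral_eq_integral)
      qed
    qed
    finally show ?thesis .
  qed
  obtain N1 where N1: "\<And>i j. i \<ge> N1 \<Longrightarrow> j \<ge> N1 \<Longrightarrow> dist (X i) (X j) < 1"
    using metric_CauchyD[OF X, of 1] by auto
  have "(\<lambda>s. f N1 s - g s) \<in> sq_int01"
  proof -
    have "(\<integral>\<^sup>+s. ennreal ((f N1 s - g s)\<^sup>2) \<partial>leb01) \<le> ennreal (1\<^sup>2)"
      by (rule est) (use N1 in auto)
    then have "(\<integral>\<^sup>+s. ennreal ((f N1 s - g s)\<^sup>2) \<partial>leb01) < \<infinity>"
      by (auto simp: order_le_less_trans)
    then show ?thesis by (auto simp: sq_int01_def intro!: integrableI_bounded)
  qed
  from sq_int01_add[OF f[of N1] sq_int01_scale[OF this, of "-1"]]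
  have g: "g \<in> sq_int01" by simp
  have "X \<longlonglongrightarrow> to_L2 g"
  proof (rule metric_LIMSEQ_I)
    fix e :: real assume e: "0 < e"
    then obtain N where N: "\<And>i j. i \<ge> N \<Longrightarrow> j \<ge> N \<Longrightarrow> dist (X i) (X j) < e / 2"
      using metric_CauchyD[OF X, of "e / 2"] by auto
    have "dist (X n) (to_L2 g) < e" if "n \<ge> N" for n
    proof -
      have "(\<integral>\<^sup>+s. ennreal ((f n s - g s)\<^sup>2) \<partial>leb01) \<le> ennreal ((e / 2)\<^sup>2)"
        by (rule est) (use e N that in auto)
      moreover have "integrable leb01 (\<lambda>s. (f n s - g s)\<^sup>2)"
        using sq_int01_sq[OF sq_int01_add[OF f[of n] sq_int01_scale[OF g, of "-1"]]] by simp
      ultimately have "(\<integral>s. (f n s - g s)\<^sup>2 \<partial>leb01) \<le> (e / 2)\<^sup>2"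
        by (simp add: nn_integral_eq_integral)
      then have "(dist (X n) (to_L2 g))\<^sup>2 \<le> (e / 2)\<^sup>2"
        unfolding dist_norm Xf using norm_to_L2_diff[OF f g] by simp
      then have "dist (X n) (to_L2 g) \<le> e / 2"
        using e by (simp add: power2_le_iff_abs_le)
      then show ?thesis using e by simp
    qed
    then show "\<exists>N. \<forall>n\<ge>N. dist (X n) (to_L2 g) < e" by blast
  qed
  then show "convergent X" by (rule convergentI)
qed


section \<open>Fractional Brownian motion\<close>

definition fbm_cov :: "real \<Rightarrow> real \<Rightarrow> real \<Rightarrow> real" where
  "fbm_cov H t s = (t powr (2*H) + s powr (2*H) - \<bar>t - s\<bar> powr (2*H)) / 2"

text \<open>Constants count as (degenerate) Gaussian variables; without them no process containing
  \<open>B\<^sub>0 = 0\<close> would be Gaussian.\<close>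

definition gaussian_rv :: "'a measure \<Rightarrow> ('a \<Rightarrow> real) \<Rightarrow> bool" where
  "gaussian_rv M Y \<longleftrightarrow> Y \<in> borel_measurable M \<and>
     ((\<exists>c. AE \<omega> in M. Y \<omega> = c) \<or>
      (\<exists>\<mu> s. s > 0 \<and> distributed M lborel Y (\<lambda>y. ennreal (normal_density \<mu> s y))))"

definition gaussian_process :: "'a measure \<Rightarrow> real set \<Rightarrow> (real \<Rightarrow> 'a \<Rightarrow> real) \<Rightarrow> bool" where
  "gaussian_process M T B \<longleftrightarrow>
     (\<forall>S c. finite S \<longrightarrow> S \<subseteq> T \<longrightarrow> gaussian_rv M (\<lambda>\<omega>. \<Sum>t\<in>S. c t * B t \<omega>))"

definition continuous_process :: "'a measure \<Rightarrow> (real \<Rightarrow> 'a \<Rightarrow> real) \<Rightarrow> bool" where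
  "continuous_process M X \<longleftrightarrow> (AE \<omega> in M. continuous_on {0..1} (\<lambda>t. X t \<omega>))"

definition fractional_BM :: "'a measure \<Rightarrow> real \<Rightarrow> (real \<Rightarrow> 'a \<Rightarrow> real) \<Rightarrow> bool" where
  "fractional_BM M H B \<longleftrightarrow>
     gaussian_process M {0..1} B \<and>
     continuous_process M B \<and>
     (\<forall>t\<in>{0..1}. (\<integral>\<omega>. B t \<omega> \<partial>M) = 0) \<and>
     (\<forall>t\<in>{0..1}. \<forall>s\<in>{0..1}. (\<integral>\<omega>. B t \<omega> * B s \<omega> \<partial>M) = fbm_cov H t s)"

text \<open>The null sets of \<open>M\<close> are adjoined at every time; for complete \<open>M\<close> this is the completed
  filtration.\<close>

definition completed_filtration :: "'a measure \<Rightarrow> (real \<Rightarrow> 'a \<Rightarrow> real) \<Rightarrow> real \<Rightarrow> 'a measure" where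
  "completed_filtration M B t =
     sigma (space M) ({B s -` A \<inter> space M | s A. s \<in> {0..t} \<and> A \<in> sets borel} \<union> null_sets M)"


section \<open>The Hilbert space of the fractional Brownian motion and the Wiener process\<close>

text \<open>The type \<open>'h\<close> together with \<open>e\<close> is a realization of the completion of the step functions;
  \<open>e t\<close> is the image of the indicator of \<open>{0..t}\<close>. These indicators, \<open>t \<in> {0..1}\<close>, form a basis
  of the space of step functions, so \<open>e\<close> determines the embedding, and a realization is unique
  up to a unique isometric isomorphism.\<close>

definition fbm_hilbert_space ::
    "real \<Rightarrow> (real \<Rightarrow> 'h::{real_inner,complete_space}) \<Rightarrow> bool" where
  "fbm_hilbert_space H e \<longleftrightarrow>
     (\<forall>t\<in>{0..1}. \<forall>s\<in>{0..1}. e t \<bullet> e s = fbm_cov H t s) \<and>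
     closure (span (e ` {0..1})) = UNIV"

text \<open>\<open>X\<close> is the linear isometry into $L^2(\Omega)$ with \<open>X (e t) = B t\<close>. All conditions are
  almost sure, so \<open>X h\<close> is any version of the corresponding class.\<close>

definition isometric_extension ::
    "'a measure \<Rightarrow> (real \<Rightarrow> 'h::real_inner) \<Rightarrow> (real \<Rightarrow> 'a \<Rightarrow> real) \<Rightarrow> ('h \<Rightarrow> 'a \<Rightarrow> real) \<Rightarrow> bool" where
  "isometric_extension M e B X \<longleftrightarrow>
     (\<forall>h. X h \<in> borel_measurable M \<and> integrable M (\<lambda>\<omega>. (X h \<omega>)\<^sup>2)) \<and>
     (\<forall>a b h k. AE \<omega> in M. X (a *\<^sub>R h + b *\<^sub>R k) \<omega> = a * X h \<omega> + b * X k \<omega>) \<and>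
     (\<forall>h k. (\<integral>\<omega>. X h \<omega> * X k \<omega> \<partial>M) = h \<bullet> k) \<and>
     (\<forall>t\<in>{0..1}. AE \<omega> in M. X (e t) \<omega> = B t \<omega>)"

definition c_H :: "real \<Rightarrow> real" where
  "c_H H = sqrt (2*H / ((1 - 2*H) * Beta (1 - 2*H) (H + 1/2)))"

definition K_H :: "real \<Rightarrow> real \<Rightarrow> real \<Rightarrow> real" where
  "K_H H t s = c_H H *
     ((t/s) powr (H - 1/2) * (t - s) powr (H - 1/2)
      + (1/2 - H) * s powr (1/2 - H) *
        (LBINT u:{s..t}. u powr (H - 3/2) * (u - s) powr (H - 1/2)))"

definition K_star ::
    "real \<Rightarrow> (real \<Rightarrow> 'h::{real_inner,complete_space}) \<Rightarrow> ('h \<Rightarrow> L2) \<Rightarrow> bool" where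
  "K_star H e K \<longleftrightarrow>
     linear K \<and> (\<forall>h k. K h \<bullet> K k = h \<bullet> k) \<and>
     (\<forall>t\<in>{0..1}. K (e t) = to_L2 (\<lambda>s. K_H H t s * indicator {0..t} s))"

definition L2_ind :: "real \<Rightarrow> L2" where
  "L2_ind t = to_L2 (indicator {0..t})"

text \<open>\<open>W t\<close> is a version of \<open>BH \<phi>\<close>, where \<open>\<phi>\<close> is the preimage of the indicator of \<open>{0..t}\<close>
  under the isometry \<open>K\<close> (unique, as \<open>K\<close> is injective).\<close>

definition associated_Wiener ::
    "'a measure \<Rightarrow> ('h::{real_inner,complete_space} \<Rightarrow> 'a \<Rightarrow> real) \<Rightarrow> ('h \<Rightarrow> L2)
       \<Rightarrow> (real \<Rightarrow> 'a \<Rightarrow> real) \<Rightarrow> bool" where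
  "associated_Wiener M BH K W \<longleftrightarrow>
     (\<forall>t\<in>{0..1}. W t \<in> borel_measurable M \<and>
        (\<exists>\<phi>. K \<phi> = L2_ind t \<and> (AE \<omega> in M. W t \<omega> = BH \<phi> \<omega>)))"


section \<open>Malliavin differentiability\<close>

text \<open>A function on \<open>\<real>\<^sup>n\<close> is represented by a function of a sequence that depends on the first
  \<open>n\<close> entries only; continuity is then continuity in these entries.\<close>

definition partial_d :: "nat \<Rightarrow> ((nat \<Rightarrow> real) \<Rightarrow> real) \<Rightarrow> (nat \<Rightarrow> real) \<Rightarrow> real" where
  "partial_d i f v = deriv (\<lambda>y. f (v(i := y))) (v i)"

text \<open>$C_p^\infty(\mathbb{R}^n)$: smooth functions all of whose partial derivatives, of any order,
  have polynomial growth. The list \<open>is\<close> is a multi-index of iterated differentiation.\<close>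

definition smooth_poly_growth :: "nat \<Rightarrow> ((nat \<Rightarrow> real) \<Rightarrow> real) \<Rightarrow> bool" where
  "smooth_poly_growth n f \<longleftrightarrow>
     (\<forall>v w. (\<forall>i<n. v i = w i) \<longrightarrow> f v = f w) \<and>
     (\<forall>is. set is \<subseteq> {..<n} \<longrightarrow>
        continuous_on UNIV (foldr partial_d is f) \<and>
        (\<forall>v. \<forall>i<n. (\<lambda>y. foldr partial_d is f (v(i := y))) differentiable (at (v i))) \<and>
        (\<exists>C m. \<forall>v. \<bar>foldr partial_d is f v\<bar> \<le> C * (1 + (\<Sum>i<n. \<bar>v i\<bar>)) ^ m))"

text \<open>\<open>F\<close> is a smooth cylindrical random variable over the isonormal process \<open>X\<close>, with
  derivative \<open>D\<close>.\<close>

definition cylindrical_deriv ::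
    "'a measure \<Rightarrow> ('h::{real_inner,complete_space} \<Rightarrow> 'a \<Rightarrow> real)
       \<Rightarrow> ('a \<Rightarrow> real) \<Rightarrow> ('a \<Rightarrow> 'h) \<Rightarrow> bool" where
  "cylindrical_deriv M X F D \<longleftrightarrow>
     (\<exists>n f h. smooth_poly_growth n f \<and>
        (\<forall>\<omega>\<in>space M. F \<omega> = f (\<lambda>i. X (h i) \<omega>)) \<and>
        (\<forall>\<omega>\<in>space M. D \<omega> = (\<Sum>i<n. partial_d i f (\<lambda>j. X (h j) \<omega>) *\<^sub>R h i)))"

text \<open>The graph of the closed operator: the closure, in $L^2(\Omega) \times L^2(\Omega; H)$, of the
  graph of the derivative on smooth cylindrical random variables.\<close>

definition malliavin_deriv ::
    "'a measure \<Rightarrow> ('h::{real_inner,complete_space} \<Rightarrow> 'a \<Rightarrow> real)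
       \<Rightarrow> ('a \<Rightarrow> real) \<Rightarrow> ('a \<Rightarrow> 'h) \<Rightarrow> bool" where
  "malliavin_deriv M X F D \<longleftrightarrow>
     F \<in> borel_measurable M \<and> integrable M (\<lambda>\<omega>. (F \<omega>)\<^sup>2) \<and>
     D \<in> borel_measurable M \<and> integrable M (\<lambda>\<omega>. (norm (D \<omega>))\<^sup>2) \<and>
     (\<exists>Fn Dn. (\<forall>k. cylindrical_deriv M X (Fn k) (Dn k)) \<and>
        (\<lambda>k. \<integral>\<^sup>+\<omega>. ennreal ((Fn k \<omega> - F \<omega>)\<^sup>2 + (norm (Dn k \<omega> - D \<omega>))\<^sup>2) \<partial>M) \<longlonglongrightarrow> 0)"

definition malliavin_domain ::
    "'a measure \<Rightarrow> ('h::{real_inner,complete_space} \<Rightarrow> 'a \<Rightarrow> real) \<Rightarrow> ('a \<Rightarrow> real) set" where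
  "malliavin_domain M X = {F. \<exists>D. malliavin_deriv M X F D}"


section \<open>The equation\<close>

definition drift ::
    "real \<Rightarrow> real \<Rightarrow> real \<Rightarrow> real \<Rightarrow> real \<Rightarrow> real \<Rightarrow> real \<Rightarrow> real \<Rightarrow> real \<Rightarrow> real \<Rightarrow> real" where
  "drift H \<theta> \<rho> \<sigma> am1 a0 a1 a2 s y =
     - am1 * \<theta> * y powr (2*\<theta> + 1) + a0 * y powr (\<theta> + 1) - a1 * (y / \<theta>)
     + a2 * s powr (2*H - 1) * (1 / \<theta> powr \<rho>) * y powr (- \<theta>*\<rho> + \<theta> + 1)
     - \<sigma> * H * s powr (2*H - 1) * (\<theta> + 1) * (1 / y)"

definition strong_positive_solution ::
    "'a measure \<Rightarrow> (real \<Rightarrow> 'a \<Rightarrow> real) \<Rightarrow> (real \<Rightarrow> real \<Rightarrow> real) \<Rightarrow> real \<Rightarrow> real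
       \<Rightarrow> (real \<Rightarrow> 'a \<Rightarrow> real) \<Rightarrow> bool" where
  "strong_positive_solution M B b \<sigma> x0 x \<longleftrightarrow>
     continuous_process M x \<and>
     (\<forall>t\<in>{0..1}. x t \<in> borel_measurable (completed_filtration M B t)) \<and>
     (AE \<omega> in M. \<forall>t\<in>{0..1}. x t \<omega> > 0) \<and>
     (AE \<omega> in M. \<forall>t\<in>{0..1}.
        set_integrable lborel {0..t} (\<lambda>s. b s (x s \<omega>)) \<and>
        x t \<omega> = x0 + (LBINT s:{0..t}. b s (x s \<omega>)) - \<sigma> * B t \<omega>)"

end

(* The drift splits as u(y) + s^(2H-1) v(y) with u' and v' bounded above, so it is one-sided
   Lipschitz with the integrable weight 1 + s^(2H-1). After a smooth truncation of the state variable,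
   an explicit Euler scheme is a smooth function of finitely many values of B whose one-step derivatives
   lie in [0, 1 + l_k] with bounded sum of the l_k. On every path it converges to any positive solution,
   which gives uniqueness and adaptedness at once. Existence is pathwise: Picard iteration for the
   hard-truncated drift, which is inactive because y^(-p) with p + 1 > 1/H beats the Hoelder
   oscillation of the noise near zero. By summation by parts, the gradient of the scheme with respect to
   the values of B is bounded in l^1 by a constant, so the Malliavin derivatives of the scheme are
   uniformly bounded; L^2 convergence together with bounded derivatives puts the limit in the domain.
   For W one uses that the two isonormal processes agree: WL (K h) = BH h almost surely. *)
theory Submission
  imports Defs
begin

section \<open>Elementary functions of finitely many variables\<close>

text \<open>No equation for the derivative of the solution is derived. The obstacle to a uniform
  gradient bound is that \<open>e s\<close> and \<open>e t\<close> are at distance |t - s|^H, so on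
  a mesh of width 1/n the increments of \<open>e\<close> have norms summing to n^(1-H), which
  diverges. Summation by parts trades increments for values, which have norm at most 1, but it
  requires one-step derivatives that are nonnegative as well as at most 1 + l_k. The drift has a
  derivative unbounded below, so nonnegativity holds only after truncation, on a mesh chosen after
  the truncation level; the upper bound is one-sided and ignores the truncation.

  The truncation must leave the scheme with iterated partial derivatives of polynomial growth, hence
  arctan and a square root. Existence needs only Lipschitz continuity, hence a hard clamp there. The
  weight s^(2H-1) is singular at 0, so sizes are measured in the clock t + t^(2H)/(2H).

  With p = theta rho - theta - 1, the hypothesis on rho says exactly H (p + 1) > 1, which leaves
  room for a Hoelder exponent between 1/(p + 1) and H.\<close>

text \<open>A class closed under partial derivatives whose members have polynomial growth, hence
  contained in the admissible cylindrical functions.\<close>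

inductive elem_fun :: "nat \<Rightarrow> ((nat \<Rightarrow> real) \<Rightarrow> real) \<Rightarrow> bool" for n where
  elem_const: "elem_fun n (\<lambda>v. c)"
| elem_coord: "i < n \<Longrightarrow> elem_fun n (\<lambda>v. v i)"
| elem_add: "elem_fun n f \<Longrightarrow> elem_fun n g \<Longrightarrow> elem_fun n (\<lambda>v. f v + g v)"
| elem_mult: "elem_fun n f \<Longrightarrow> elem_fun n g \<Longrightarrow> elem_fun n (\<lambda>v. f v * g v)"
| elem_arctan: "elem_fun n f \<Longrightarrow> elem_fun n (\<lambda>v. arctan (f v))"
| elem_powr: "elem_fun n f \<Longrightarrow> 0 < c \<Longrightarrow> (\<And>v. c \<le> f v) \<Longrightarrow> elem_fun n (\<lambda>v. f v powr a)"

lemma elem_uminus: "elem_fun n f \<Longrightarrow> elem_fun n (\<lambda>v. - f v)"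
  using elem_mult[OF elem_const[of n "-1"]] by simp

lemma elem_diff: "elem_fun n f \<Longrightarrow> elem_fun n g \<Longrightarrow> elem_fun n (\<lambda>v. f v - g v)"
  using elem_add[OF _ elem_uminus] by fastforce

lemma elem_fun_mono: "elem_fun m f \<Longrightarrow> m \<le> n \<Longrightarrow> elem_fun n f"
  by (induction rule: elem_fun.induct) (auto intro: elem_fun.intros)

lemma elem_fun_cong: "elem_fun n f \<Longrightarrow> (\<And>i. i < n \<Longrightarrow> v i = w i) \<Longrightarrow> f v = f w"
  by (induction rule: elem_fun.induct) auto

lemma elem_fun_continuous: "elem_fun n f \<Longrightarrow> continuous_on UNIV f"
proof (induction rule: elem_fun.induct)
  case (elem_powr f c a)
  have "f v \<noteq> 0" for v using elem_powr(2) elem_powr(3)[of v] by linarith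
  then show ?case using elem_powr.IH by (intro continuous_intros) auto
qed (auto intro!: continuous_intros)

text \<open>A witness inside the class is constructed by the differentiation rules. Lowering the
  exponent of a power keeps its base, hence also the positive lower bound that
  \<open>elem_powr\<close> demands.\<close>

lemma elem_fun_deriv_exists:
  "elem_fun n f \<Longrightarrow>
    \<exists>f'. elem_fun n f' \<and> (\<forall>v. ((\<lambda>y. f (v(i := y))) has_real_derivative f' v) (at (v i)))"
proof (induction rule: elem_fun.induct)
  case (elem_const c)
  show ?case by (intro exI[of _ "\<lambda>_. 0"]) (auto intro: elem_fun.elem_const)
next
  case (elem_coord j)
  show ?case
    by (intro exI[of _ "\<lambda>_. if j = i then 1 else 0"]) (auto intro: elem_fun.elem_const)
next
  case (elem_add f g)
  then obtain f' g' where *: "elem_fun n f'" "elem_fun n g'"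
    "\<And>v. ((\<lambda>y. f (v(i := y))) has_real_derivative f' v) (at (v i))"
    "\<And>v. ((\<lambda>y. g (v(i := y))) has_real_derivative g' v) (at (v i))" by blast
  show ?case
    by (intro exI[of _ "\<lambda>v. f' v + g' v"] conjI allI elem_fun.elem_add DERIV_add *)
next
  case (elem_mult f g)
  then obtain f' g' where *: "elem_fun n f'" "elem_fun n g'"
    "\<And>v. ((\<lambda>y. f (v(i := y))) has_real_derivative f' v) (at (v i))"
    "\<And>v. ((\<lambda>y. g (v(i := y))) has_real_derivative g' v) (at (v i))" by blast
  have "((\<lambda>y. f (v(i := y)) * g (v(i := y))) has_real_derivative (f v * g' v + f' v * g v)) (at (v i))" for v
    using DERIV_mult[OF *(3,4), of v v] by (simp add: algebra_simps)
  moreover have "elem_fun n (\<lambda>v. f v * g' v + f' v * g v)"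
    by (intro elem_fun.elem_add elem_fun.elem_mult * elem_mult)
  ultimately show ?case by blast
next
  case (elem_arctan f)
  then obtain f' where *: "elem_fun n f'"
    "\<And>v. ((\<lambda>y. f (v(i := y))) has_real_derivative f' v) (at (v i))" by blast
  \<comment> \<open>The derivative of arctan is written as a power whose base is at least 1, so that
    it is again an instance of \<open>elem_powr\<close>.\<close>
  have "((\<lambda>y. arctan (f (v(i := y)))) has_real_derivative ((1 + f v * f v) powr (-1) * f' v)) (at (v i))" for v
  proof -
    have "(1 + f v * f v) powr (-1) = inverse (1 + (f v)\<^sup>2)"
      by (simp add: powr_minus power2_eq_square add_nonneg_nonneg)
    then show ?thesis using DERIV_chain2[OF DERIV_arctan *(2)[of v]] by simp
  qed
  moreover have "elem_fun n (\<lambda>v. (1 + f v * f v) powr (-1) * f' v)"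
    by (intro elem_fun.elem_mult elem_fun.elem_powr[of _ _ 1] elem_fun.elem_add
        elem_fun.elem_const elem_arctan *) auto
  ultimately show ?case by blast
next
  case (elem_powr f c a)
  then obtain f' where *: "elem_fun n f'"
    "\<And>v. ((\<lambda>y. f (v(i := y))) has_real_derivative f' v) (at (v i))" by blast
  have "((\<lambda>y. f (v(i := y)) powr a) has_real_derivative (a * f v powr (a - 1) * f' v)) (at (v i))" for v
  proof -
    have "f v > 0" using elem_powr(2) elem_powr(3)[of v] by linarith
    then show ?thesis
      by (auto intro!: derivative_eq_intros *(2) simp: powr_diff)
  qed
  moreover have "elem_fun n (\<lambda>v. a * f v powr (a - 1) * f' v)"
    by (intro elem_fun.elem_mult elem_fun.elem_powr[of _ _ c] elem_fun.elem_const elem_powr *)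
  ultimately show ?case by blast
qed

lemma elem_fun_partial_d:
  assumes "elem_fun n f"
  shows "elem_fun n (partial_d i f)"
    and "((\<lambda>y. f (v(i := y))) has_real_derivative partial_d i f v) (at (v i))"
proof -
  obtain f' where f': "elem_fun n f'"
    "\<And>v. ((\<lambda>y. f (v(i := y))) has_real_derivative f' v) (at (v i))"
    using elem_fun_deriv_exists[OF assms] by blast
  have "partial_d i f = f'"
    unfolding partial_d_def using DERIV_imp_deriv[OF f'(2)] by auto
  with f' show "elem_fun n (partial_d i f)"
    and "((\<lambda>y. f (v(i := y))) has_real_derivative partial_d i f v) (at (v i))" by auto
qed

text \<open>The power rule is the only delicate case. A nonpositive exponent gives a bounded
  function because the base stays above \<open>c\<close>; a positive one is dominated by the integer
  power \<open>nat\<close> of its ceiling, after the base has been replaced by a majorant that is at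
  least 1.\<close>

lemma elem_fun_growth:
  "elem_fun n f \<Longrightarrow> \<exists>C m. \<forall>v. \<bar>f v\<bar> \<le> C * (1 + (\<Sum>i<n. \<bar>v i\<bar>)) ^ m"
proof (induction rule: elem_fun.induct)
  case (elem_const c)
  show ?case by (intro exI[of _ "\<bar>c\<bar>"] exI[of _ 0]) auto
next
  case (elem_coord i)
  have "\<bar>v i\<bar> \<le> (\<Sum>i<n. \<bar>v i\<bar>)" for v :: "nat \<Rightarrow> real"
    using elem_coord by (intro member_le_sum) auto
  then have "\<bar>v i\<bar> \<le> 1 * (1 + (\<Sum>i<n. \<bar>v i\<bar>)) ^ 1" for v :: "nat \<Rightarrow> real"
    by (simp add: add_increasing)
  then show ?case by blast
next
  case (elem_add f g)
  then obtain C1 m1 C2 m2 where *: "\<And>v. \<bar>f v\<bar> \<le> C1 * (1 + (\<Sum>i<n. \<bar>v i\<bar>)) ^ m1"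
    "\<And>v. \<bar>g v\<bar> \<le> C2 * (1 + (\<Sum>i<n. \<bar>v i\<bar>)) ^ m2" by blast
  have "\<bar>f v + g v\<bar> \<le> (\<bar>C1\<bar> + \<bar>C2\<bar>) * (1 + (\<Sum>i<n. \<bar>v i\<bar>)) ^ (m1 + m2)" for v
  proof -
    let ?S = "1 + (\<Sum>i<n. \<bar>v i\<bar>)"
    have S: "?S \<ge> 1" by (simp add: sum_nonneg)
    have "\<bar>f v\<bar> \<le> \<bar>C1\<bar> * ?S ^ (m1 + m2)"
      by (rule order_trans[OF *(1)], rule mult_mono) (use S in \<open>auto intro: power_increasing\<close>)
    moreover have "\<bar>g v\<bar> \<le> \<bar>C2\<bar> * ?S ^ (m1 + m2)"
      by (rule order_trans[OF *(2)], rule mult_mono) (use S in \<open>auto intro: power_increasing\<close>)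
    ultimately show ?thesis by (simp add: distrib_right)
  qed
  then show ?case by blast
next
  case (elem_mult f g)
  then obtain C1 m1 C2 m2 where *: "\<And>v. \<bar>f v\<bar> \<le> C1 * (1 + (\<Sum>i<n. \<bar>v i\<bar>)) ^ m1"
    "\<And>v. \<bar>g v\<bar> \<le> C2 * (1 + (\<Sum>i<n. \<bar>v i\<bar>)) ^ m2" by blast
  have "\<bar>f v * g v\<bar> \<le> (C1 * C2) * (1 + (\<Sum>i<n. \<bar>v i\<bar>)) ^ (m1 + m2)" for v
  proof -
    have "\<bar>f v * g v\<bar> \<le> (C1 * (1 + (\<Sum>i<n. \<bar>v i\<bar>)) ^ m1) * (C2 * (1 + (\<Sum>i<n. \<bar>v i\<bar>)) ^ m2)"
      unfolding abs_mult by (intro mult_mono *) (auto intro: order_trans[OF abs_ge_zero *(1)])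
    then show ?thesis by (simp add: power_add mult_ac)
  qed
  then show ?case by blast
next
  case (elem_arctan f)
  have "\<bar>arctan (f v)\<bar> \<le> (pi / 2) * (1 + (\<Sum>i<n. \<bar>v i\<bar>)) ^ 0" for v
    using arctan_bounded[of "f v"] by auto
  then show ?case by blast
next
  case (elem_powr f c a)
  then obtain C m where *: "\<And>v. \<bar>f v\<bar> \<le> C * (1 + (\<Sum>i<n. \<bar>v i\<bar>)) ^ m" by blast
  have pos: "f v > 0" for v using elem_powr(2) elem_powr(3)[of v] by linarith
  show ?case
  proof (cases "a \<le> 0")
    case True
    have "f v powr a \<le> c powr a" for v
      by (rule powr_mono2') (use True elem_powr in auto)
    then have "\<bar>f v powr a\<bar> \<le> (c powr a) * (1 + (\<Sum>i<n. \<bar>v i\<bar>)) ^ 0" for v by simp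
    then show ?thesis by blast
  next
    case False
    define j where "j = nat \<lceil>a\<rceil>"
    have j: "a \<le> real j" unfolding j_def by linarith
    have "\<bar>f v powr a\<bar> \<le> ((1 + \<bar>C\<bar>) ^ j) * (1 + (\<Sum>i<n. \<bar>v i\<bar>)) ^ (m * j)" for v
    proof -
      let ?S = "1 + (\<Sum>i<n. \<bar>v i\<bar>)"
      let ?Q = "(1 + \<bar>C\<bar>) * ?S ^ m"
      have S: "?S \<ge> 1" by (simp add: sum_nonneg)
      have Q1: "1 * 1 \<le> ?Q" by (intro mult_mono one_le_power S) auto
      have "f v \<le> ?Q"
      proof -
        have "f v \<le> C * ?S ^ m" using *[of v] by auto
        also have "\<dots> \<le> ?Q" using S by (intro mult_right_mono) auto
        finally show ?thesis .
      qed
      then have "f v powr a \<le> ?Q powr a"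
        using pos[of v] False by (intro powr_mono2) auto
      also have "\<dots> \<le> ?Q powr (real j)" by (rule powr_mono) (use Q1 j in auto)
      also have "\<dots> = ?Q ^ j" by (rule powr_realpow) (use Q1 in linarith)
      also have "\<dots> = ((1 + \<bar>C\<bar>) ^ j) * ?S ^ (m * j)" by (simp add: power_mult_distrib power_mult)
      finally show ?thesis by simp
    qed
    then show ?thesis by blast
  qed
qed

text \<open>Every iterated partial derivative is again elementary, so the conditions over all
  multi-indices reduce to continuity, differentiability and growth of a single member of the
  class.\<close>

lemma elem_fun_smooth:
  assumes "elem_fun n f"
  shows "smooth_poly_growth n f"
proof -
  have *: "elem_fun n (foldr partial_d is f)" for "is"
    by (induction "is") (auto intro: assms elem_fun_partial_d(1))
  show ?thesis
    unfolding smooth_poly_growth_def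
  proof (intro conjI allI impI)
    fix v w :: "nat \<Rightarrow> real" assume "\<forall>i<n. v i = w i"
    then show "f v = f w" by (intro elem_fun_cong[OF assms]) auto
  next
    fix "is" v i
    show "(\<lambda>y. foldr partial_d is f (v(i := y))) differentiable (at (v i))"
      using elem_fun_partial_d(2)[OF *] unfolding differentiable_def has_field_derivative_def by blast
  qed (auto intro: elem_fun_continuous elem_fun_growth *)
qed

section \<open>The truncated Euler scheme\<close>

text \<open>Made for the weight \<open>s powr (2 * H - 1)\<close>, which is unbounded near 0: the
  derivative is required only in the open interval, and nonnegativity turns the gauge integral into
  an absolutely convergent one.\<close>

lemma set_integral_FTC_interior_nonneg:
  fixes F f :: "real \<Rightarrow> real"
  assumes ab: "a \<le> b" and contF: "continuous_on {a..b} F"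
    and der: "\<And>x. a < x \<Longrightarrow> x < b \<Longrightarrow> (F has_real_derivative f x) (at x)"
    and meas: "f \<in> borel_measurable borel" and nonneg: "\<And>x. a \<le> x \<Longrightarrow> x \<le> b \<Longrightarrow> 0 \<le> f x"
  shows "set_integrable lborel {a..b} f" and "(LBINT x:{a..b}. f x) = F b - F a"
proof -
  have "(f has_integral (F b - F a)) {a..b}"
    by (rule fundamental_theorem_of_calculus_interior[OF ab contF])
      (simp add: der has_real_derivative_iff_has_vector_derivative[symmetric])
  then have hi: "((\<lambda>x. indicator {a..b} x * f x) has_integral (F b - F a)) UNIV"
  proof -
    have eq: "(\<lambda>x. indicator {a..b} x * f x) = (\<lambda>x. if x \<in> {a..b} then f x else 0)"
      by (auto simp: indicator_def)
    show "((\<lambda>x. indicator {a..b} x * f x) has_integral (F b - F a)) UNIV" if "(f has_integral (F b - F a)) {a..b}"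
      unfolding eq using that by (subst has_integral_restrict_UNIV)
  qed
  have m: "(\<lambda>x. indicator {a..b} x * f x) \<in> borel_measurable borel" using meas by measurable
  have nn: "integral\<^sup>N lborel (\<lambda>x. indicator {a..b} x * f x) = F b - F a"
    by (rule nn_integral_has_integral_lborel[OF m _ hi]) (auto simp: indicator_def nonneg)
  then have i: "integrable lborel (\<lambda>x. indicator {a..b} x * f x)"
    by (intro integrableI_nonneg) (use m nonneg in \<open>auto simp: indicator_def\<close>)
  then show "set_integrable lborel {a..b} f" by (simp add: set_integrable_def)
  have "((\<lambda>x. indicator {a..b} x * f x) has_integral (\<integral>x. indicator {a..b} x * f x \<partial>lborel)) UNIV"
    by (rule has_integral_integral_lborel[OF i])
  then show "(LBINT x:{a..b}. f x) = F b - F a"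
    using has_integral_unique[OF hi] by (simp add: set_lebesgue_integral_def)
qed

lemma set_integral_Icc_diff:
  fixes f :: "real \<Rightarrow> real"
  assumes "set_integrable lborel {a..c} f" "a \<le> b" "b \<le> c"
  shows "set_integrable lborel {b<..c} f"
    and "(LBINT x:{a..c}. f x) - (LBINT x:{a..b}. f x) = (LBINT x:{b<..c}. f x)"
proof -
  show i: "set_integrable lborel {b<..c} f"
    by (rule set_integrable_subset[OF assms(1)]) (use assms in auto)
  have "{a..c} = {a..b} \<union> {b<..c}" using assms by auto
  moreover have "set_integrable lborel {a..b} f"
    by (rule set_integrable_subset[OF assms(1)]) (use assms in auto)
  ultimately show "(LBINT x:{a..c}. f x) - (LBINT x:{a..b}. f x) = (LBINT x:{b<..c}. f x)"
    using i set_integral_Un[of "{a..b}" "{b<..c}" lborel f] by fastforce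
qed

text \<open>Summation by parts: \<open>e k + s d k\<close> evolves by a combination of itself and \<open>s d k\<close> with
  coefficients \<open>q k\<close> and \<open>1 - q k\<close>, so no sum of increments of \<open>d\<close> appears in the bound.\<close>

lemma recursion_bound:
  fixes e d :: "nat \<Rightarrow> 'b::real_normed_vector"
  assumes step: "\<And>k. k < n \<Longrightarrow> e (Suc k) = q k *\<^sub>R e k - s *\<^sub>R (d (Suc k) - d k)"
    and q: "\<And>k. k < n \<Longrightarrow> 0 \<le> q k" "\<And>k. k < n \<Longrightarrow> q k \<le> 1 + l k"
    and l: "\<And>k. k < n \<Longrightarrow> 0 \<le> l k"
    and d: "\<And>k. k \<le> n \<Longrightarrow> norm (d k) \<le> D" and s: "0 \<le> s" and e0: "e 0 = 0"
  shows "norm (e n) \<le> s * D * (1 + exp (2 * (\<Sum>k<n. l k)))"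
proof -
  have D: "0 \<le> D" using d[of 0] norm_ge_zero order_trans by blast
  have "norm (e k + s *\<^sub>R d k) \<le> s * D * exp (2 * (\<Sum>j<k. l j))" if "k \<le> n" for k
    using that
  proof (induction k)
    case 0
    then show ?case using d[of 0] s e0 by (simp add: mult_left_mono)
  next
    case (Suc k)
    then have k: "k < n" by simp
    define X where "X = s * D * exp (2 * (\<Sum>j<k. l j))"
    have IH: "norm (e k + s *\<^sub>R d k) \<le> X" using Suc by (simp add: X_def)
    have X: "s * D \<le> X"
    proof -
      have "0 \<le> (\<Sum>j<k. l j)" using k by (intro sum_nonneg l) auto
      then have "s * D * 1 \<le> X" unfolding X_def using s D by (intro mult_left_mono) auto
      then show ?thesis by simp
    qed
    have nd: "norm (s *\<^sub>R d k) \<le> s * D" using d[of k] k s by (simp add: mult_left_mono)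
    have "e (Suc k) + s *\<^sub>R d (Suc k) = q k *\<^sub>R (e k + s *\<^sub>R d k) + (1 - q k) *\<^sub>R (s *\<^sub>R d k)"
      unfolding step[OF k] by (simp add: algebra_simps)
    then have "norm (e (Suc k) + s *\<^sub>R d (Suc k)) \<le>
        norm (q k *\<^sub>R (e k + s *\<^sub>R d k)) + norm ((1 - q k) *\<^sub>R (s *\<^sub>R d k))"
      by (simp only: norm_triangle_ineq)
    also have "\<dots> = q k * norm (e k + s *\<^sub>R d k) + \<bar>1 - q k\<bar> * norm (s *\<^sub>R d k)"
      using q(1)[OF k] by (simp only: norm_scaleR abs_of_nonneg)
    also have "\<dots> \<le> q k * X + \<bar>1 - q k\<bar> * X"
      using IH nd X q(1)[OF k] by (intro add_mono mult_left_mono) auto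
    also have "\<dots> = X * (q k + \<bar>1 - q k\<bar>)" by (simp add: algebra_simps)
    also have "\<dots> \<le> X * exp (2 * l k)"
    proof (rule mult_left_mono)
      \<comment> \<open>The left side is 1 when \<open>q k\<close> is at most 1 and
        \<open>2 * q k - 1\<close> otherwise; this is the origin of the factor 2 in the
        exponent.\<close>
      have "q k + \<bar>1 - q k\<bar> \<le> 1 + 2 * l k" using q[OF k] l[OF k] by linarith
      also have "\<dots> \<le> exp (2 * l k)" by (rule exp_ge_add_one_self)
      finally show "q k + \<bar>1 - q k\<bar> \<le> exp (2 * l k)" .
      show "0 \<le> X" using X s D mult_nonneg_nonneg order_trans by blast
    qed
    also have "\<dots> = s * D * exp (2 * (\<Sum>j<Suc k. l j))"
      by (simp add: X_def exp_add distrib_left)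
    finally show ?case .
  qed
  from this[of n] have "norm (e n + s *\<^sub>R d n) \<le> s * D * exp (2 * (\<Sum>j<n. l j))" by simp
  moreover have "norm (s *\<^sub>R d n) \<le> s * D" using d[of n] s by (simp add: mult_left_mono)
  moreover have "norm (e n) \<le> norm (e n + s *\<^sub>R d n) + norm (s *\<^sub>R d n)"
    using norm_triangle_ineq4[of "e n + s *\<^sub>R d n" "s *\<^sub>R d n"] by simp
  ultimately show ?thesis by (simp add: distrib_left)
qed

text \<open>A truncation of the identity on \<open>(0, \<infinity>)\<close> with values in a compact subset of \<open>(0, \<infinity>)\<close>, built
  from arctan and a square root so that it preserves elementary functions.\<close>

definition clip :: "real \<Rightarrow> real \<Rightarrow> real" where
  "clip N y = (N * arctan (y / N) + sqrt ((N * arctan (y / N))\<^sup>2 + (1 / N)\<^sup>2)) / 2"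

text \<open>The square root is the power 1/2 of a quantity bounded below by
  \<open>(1 / N)\<^sup>2\<close>, so \<open>elem_powr\<close> applies.\<close>

lemma elem_fun_clip:
  assumes "elem_fun n f" "N > 0"
  shows "elem_fun n (\<lambda>v. clip N (f v))"
proof -
  have A: "elem_fun n (\<lambda>v. N * arctan ((1 / N) * f v))" (is "elem_fun n ?A")
    by (intro elem_mult elem_const elem_arctan assms)
  have S: "elem_fun n (\<lambda>v. (?A v * ?A v + (1 / N)\<^sup>2) powr (1/2))"
    by (intro elem_powr[where c = "(1 / N)\<^sup>2"] elem_add elem_mult elem_const elem_arctan assms(1))
      (use assms(2) in auto)
  have "elem_fun n (\<lambda>v. (1/2) * (?A v + (?A v * ?A v + (1 / N)\<^sup>2) powr (1/2)))"
    by (intro elem_mult elem_add elem_const A S)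
  moreover have "(1/2) * (?A v + (?A v * ?A v + (1 / N)\<^sup>2) powr (1/2)) = clip N (f v)" for v
    by (simp add: clip_def powr_half_sqrt power2_eq_square)
  ultimately show ?thesis by simp
qed

lemma clip_bounds:
  assumes "N > 0"
  obtains a b where "0 < a" "\<And>y. a \<le> clip N y" "\<And>y. clip N y \<le> b"
proof -
  define R where "R = N * (pi / 2)"
  define \<epsilon> where "\<epsilon> = 1 / N"
  have R: "R > 0" and e: "\<epsilon> > 0" using assms by (auto simp: R_def \<epsilon>_def)
  have *: "\<epsilon>\<^sup>2 / (2 * (2 * R + \<epsilon>)) \<le> clip N y \<and> clip N y \<le> R + \<epsilon>" for y
  proof -
    define A where "A = N * arctan (y / N)"
    define S where "S = sqrt (A\<^sup>2 + \<epsilon>\<^sup>2)"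
    have AR: "\<bar>A\<bar> \<le> R"
      using arctan_lbound[of "y / N"] arctan_ubound[of "y / N"] assms
      by (auto simp: A_def R_def abs_mult intro!: mult_left_mono)
    have SA: "S \<le> \<bar>A\<bar> + \<epsilon>" unfolding S_def using e
      by (intro real_le_lsqrt) (auto simp: power2_sum)
    have c: "clip N y = (A + S) / 2" by (simp add: clip_def A_def S_def \<epsilon>_def)
    have "S > \<bar>A\<bar>" unfolding S_def using e by (intro real_less_rsqrt) auto
    \<comment> \<open>Conjugate identity. Since \<open>S - A\<close> is at most
      \<open>2 * R + \<epsilon>\<close>, it yields a positive lower bound for \<open>A + S\<close>,
      which is twice the truncated value.\<close>
    have "(A + S) * (S - A) = \<epsilon>\<^sup>2"
      by (simp add: S_def algebra_simps power2_eq_square[symmetric] add_nonneg_nonneg)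
    then have "\<epsilon>\<^sup>2 = (A + S) * (S - A)" ..
    also have "\<dots> \<le> (A + S) * (2 * R + \<epsilon>)"
      using \<open>S > \<bar>A\<bar>\<close> AR SA by (intro mult_left_mono) auto
    finally have "\<epsilon>\<^sup>2 / (2 * (2 * R + \<epsilon>)) \<le> clip N y"
      unfolding c using R e by (simp add: field_simps)
    moreover have "clip N y \<le> R + \<epsilon>" unfolding c using AR SA e abs_ge_self[of A] by argo
    ultimately show ?thesis by blast
  qed
  show ?thesis
    by (rule that[of "\<epsilon>\<^sup>2 / (2 * (2 * R + \<epsilon>))" "R + \<epsilon>"]) (use * R e in auto)
qed

text \<open>The slope in [0, 1] is what makes the truncation harmless: multiplying a derivative by
  it moves the derivative towards 0, so neither a lower bound -1 nor a nonnegative upper bound is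
  lost.\<close>

lemma clip_deriv:
  assumes "N > 0"
  obtains c where "(clip N has_real_derivative c) (at y)" "0 \<le> c" "c \<le> 1"
proof -
  define A where "A = N * arctan (y / N)"
  define S where "S = sqrt (A\<^sup>2 + (1 / N)\<^sup>2)"
  have pos: "A\<^sup>2 + (1 / N)\<^sup>2 > 0" using assms by (intro add_nonneg_pos) auto
  have S: "S > \<bar>A\<bar>" unfolding S_def using assms by (intro real_less_rsqrt) auto
  define r where "r = 1 / (1 + (y / N)\<^sup>2)"
  have r: "0 < r" "r \<le> 1" unfolding r_def by (auto simp: add_pos_nonneg)
  have dA: "((\<lambda>y. N * arctan (y / N)) has_real_derivative r) (at y)"
  proof -
    have "((\<lambda>y. N * arctan (y / N)) has_real_derivative N * (inverse (1 + (y / N)\<^sup>2) * (1 / N))) (at y)"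
      using assms by (auto intro!: derivative_eq_intros)
    then show ?thesis by (rule DERIV_cong) (use assms in \<open>simp add: r_def divide_inverse\<close>)
  qed
  have dSq: "((\<lambda>y. (N * arctan (y / N))\<^sup>2 + (1 / N)\<^sup>2) has_real_derivative 2 * A * r) (at y)"
    by (rule DERIV_cong[OF DERIV_add[OF DERIV_power[OF dA] DERIV_const]]) (simp add: A_def)
  have pos': "0 < (N * arctan (y / N))\<^sup>2 + (1 / N)\<^sup>2" using pos by (simp add: A_def)
  have "(clip N has_real_derivative (r + (inverse (sqrt ((N * arctan (y / N))\<^sup>2 + (1 / N)\<^sup>2)) / 2) * (2 * A * r)) / 2) (at y)"
    unfolding clip_def[abs_def]
    by (rule DERIV_cdivide[OF DERIV_add[OF dA DERIV_chain2[OF DERIV_real_sqrt[OF pos'] dSq]]])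
  then have "(clip N has_real_derivative r * (1 + A / S) / 2) (at y)"
    by (rule DERIV_cong) (use S in \<open>simp only: A_def[symmetric] S_def[symmetric], simp add: field_simps\<close>)
  moreover have "\<bar>A / S\<bar> \<le> 1" using S by simp
  then have "0 \<le> 1 + A / S" "1 + A / S \<le> 2" unfolding abs_le_iff by argo+
  then have "0 \<le> r * (1 + A / S) / 2" "r * (1 + A / S) \<le> 1 * 2"
    using r mult_mono[of r 1 "1 + A / S" 2] by auto
  ultimately show ?thesis using that by auto
qed

text \<open>For z >= 0, arctan z lies between z - z^3 and z, and the square root adds at most
  \<open>1 / N\<close>. Only the uniformity on [0, b] matters later.\<close>

lemma clip_close:
  assumes "1 \<le> N" "0 \<le> y" "y \<le> b"
  shows "\<bar>clip N y - y\<bar> \<le> (b ^ 3 + 1) / N"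
proof -
  define z where "z = y / N"
  have z: "0 \<le> z" using assms by (simp add: z_def)
  have up: "arctan z \<le> z"
  proof -
    have "(\<lambda>x. x - arctan x) 0 \<le> (\<lambda>x. x - arctan x) z"
    proof (rule DERIV_nonneg_imp_nondecreasing[OF z])
      fix x :: real
      have "((\<lambda>x. x - arctan x) has_real_derivative 1 - inverse (1 + x\<^sup>2)) (at x)"
        by (auto intro!: derivative_eq_intros)
      moreover have "inverse (1 + x\<^sup>2) \<le> 1" by (simp add: inverse_le_1_iff)
      ultimately show "\<exists>d. ((\<lambda>x. x - arctan x) has_real_derivative d) (at x) \<and> 0 \<le> d"
        by (intro exI[of _ "1 - inverse (1 + x\<^sup>2)"]) auto
    qed
    then show ?thesis by simp
  qed
  have lo: "z - z ^ 3 \<le> arctan z"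
  proof -
    have "(\<lambda>x. arctan x - x + x ^ 3) 0 \<le> (\<lambda>x. arctan x - x + x ^ 3) z"
    proof (rule DERIV_nonneg_imp_nondecreasing[OF z])
      fix x :: real
      have "((\<lambda>x. arctan x - x + x ^ 3) has_real_derivative inverse (1 + x\<^sup>2) - 1 + 3 * x\<^sup>2) (at x)"
        by (auto intro!: derivative_eq_intros)
      moreover have "0 \<le> inverse (1 + x\<^sup>2) - 1 + 3 * x\<^sup>2"
      proof -
        have "1 + x\<^sup>2 > 0" by (simp add: add_pos_nonneg)
        moreover have "0 \<le> 1 - (1 - 3 * x\<^sup>2) * (1 + x\<^sup>2)"
          by (simp add: algebra_simps)
        ultimately show ?thesis by (simp add: field_simps)
      qed
      ultimately show "\<exists>d. ((\<lambda>x. arctan x - x + x ^ 3) has_real_derivative d) (at x) \<and> 0 \<le> d"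
        by blast
    qed
    then show ?thesis by simp
  qed
  define A where "A = N * arctan z"
  define S where "S = sqrt (A\<^sup>2 + (1 / N)\<^sup>2)"
  have N: "N > 0" using assms by simp
  have A: "0 \<le> A" "A \<le> y" "y - A \<le> b ^ 3 / N"
  proof -
    show "0 \<le> A" unfolding A_def using z N by simp
    have "N * arctan z \<le> N * z" using up N by (intro mult_left_mono) auto
    then show "A \<le> y" using N by (simp add: A_def z_def)
    have "N * (z - z ^ 3) \<le> A" unfolding A_def using lo N by (intro mult_left_mono) auto
    moreover have "N * (z - z ^ 3) = y - y ^ 3 / N\<^sup>2"
      using N by (simp add: z_def field_simps power2_eq_square power3_eq_cube)
    moreover have "y ^ 3 / N\<^sup>2 \<le> b ^ 3 / N"
    proof (rule frac_le)
      show "y ^ 3 \<le> b ^ 3" using assms by (intro power_mono) auto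
      show "N \<le> N\<^sup>2" using assms by (simp add: power2_eq_square)
      show "0 \<le> b ^ 3" using assms by simp
    qed (rule N)
    ultimately show "y - A \<le> b ^ 3 / N" by linarith
  qed
  have "A \<le> S" unfolding S_def by (rule real_le_rsqrt) simp
  moreover have "S \<le> A + 1 / N" unfolding S_def using A N
    by (intro real_le_lsqrt) (auto simp: power2_sum)
  moreover have "clip N y = (A + S) / 2" by (simp add: clip_def A_def S_def z_def)
  moreover have "(b ^ 3 + 1) / N = b ^ 3 / N + 1 / N" by (simp add: add_divide_distrib)
  moreover have "1 / N > 0" using N by simp
  ultimately show ?thesis using A unfolding abs_le_iff by argo
qed

text \<open>The entry \<open>v k\<close> stands for the value of the noise at the k-th grid point,
  and one step is an arbitrary map \<open>g k\<close>. Keeping values instead of increments as the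
  variables is what lets the gradient be expanded in vectors of norm at most 1.\<close>

fun scheme :: "(nat \<Rightarrow> real \<Rightarrow> real) \<Rightarrow> real \<Rightarrow> real \<Rightarrow> nat \<Rightarrow> (nat \<Rightarrow> real) \<Rightarrow> real" where
  "scheme g \<sigma> x0 0 v = x0"
| "scheme g \<sigma> x0 (Suc k) v = g k (scheme g \<sigma> x0 k v) - \<sigma> * (v (Suc k) - v k)"

lemma MVT_quotient:
  fixes g :: "real \<Rightarrow> real"
  assumes "\<And>y. (g has_real_derivative g' y) (at y)"
  obtains z where "g a - g b = g' z * (a - b)"
proof (cases a b rule: linorder_cases)
  case less
  then obtain z where "g b - g a = (b - a) * g' z" using MVT2[of a b g g'] assms by blast
  then show ?thesis using that[of z] by (simp add: algebra_simps)
next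
  case greater
  then obtain z where "g a - g b = (a - b) * g' z" using MVT2[of b a g g'] assms by blast
  then show ?thesis using that[of z] by (simp add: algebra_simps)
qed (use that in simp)

text \<open>By the mean value theorem the difference of two runs satisfies the hypotheses of
  \<open>recursion_bound\<close> with \<open>d = v - w\<close>, so the scheme is Lipschitz in the
  supremum norm of the noise. Comparison with zero noise later dominates all schemes by one
  square-integrable variable.\<close>

lemma scheme_lipschitz:
  assumes g: "\<And>k y. k < n \<Longrightarrow> (g k has_real_derivative g' k y) (at y)"
    and q: "\<And>k y. k < n \<Longrightarrow> 0 \<le> g' k y" "\<And>k y. k < n \<Longrightarrow> g' k y \<le> 1 + l k"
    and l: "\<And>k. k < n \<Longrightarrow> 0 \<le> l k" and \<sigma>: "0 \<le> \<sigma>"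
    and D: "\<And>k. k \<le> n \<Longrightarrow> \<bar>v k - w k\<bar> \<le> D"
  shows "\<bar>scheme g \<sigma> x0 n v - scheme g \<sigma> x0 n w\<bar> \<le> \<sigma> * D * (1 + exp (2 * (\<Sum>k<n. l k)))"
proof -
  define e where "e k = scheme g \<sigma> x0 k v - scheme g \<sigma> x0 k w" for k
  have "\<exists>z. k < n \<longrightarrow> g k (scheme g \<sigma> x0 k v) - g k (scheme g \<sigma> x0 k w) = g' k z * e k" for k
  proof (cases "k < n")
    case True
    show ?thesis unfolding e_def using MVT_quotient[OF g[OF True]] by blast
  qed simp
  then obtain z where z: "\<And>k. k < n \<Longrightarrow> g k (scheme g \<sigma> x0 k v) - g k (scheme g \<sigma> x0 k w) = g' k (z k) * e k"
    by metis
  have "norm (e n) \<le> \<sigma> * D * (1 + exp (2 * (\<Sum>k<n. l k)))"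
  proof (rule recursion_bound[where q = "\<lambda>k. g' k (z k)" and d = "\<lambda>k. v k - w k"])
    show "e (Suc k) = g' k (z k) *\<^sub>R e k - \<sigma> *\<^sub>R (v (Suc k) - w (Suc k) - (v k - w k))"
      if "k < n" for k
      using z[OF that] by (simp add: e_def algebra_simps)
  qed (use q l D \<sigma> in \<open>auto simp: e_def\<close>)
  then show ?thesis by (simp add: e_def)
qed

section \<open>The equation along a fixed path and the abstract singular drift\<close>

definition path_solution ::
    "(real \<Rightarrow> real \<Rightarrow> real) \<Rightarrow> real \<Rightarrow> real \<Rightarrow> (real \<Rightarrow> real) \<Rightarrow> (real \<Rightarrow> real) \<Rightarrow> bool" where
  "path_solution b \<sigma> x0 \<beta> x \<longleftrightarrow>
     continuous_on {0..1} x \<and> (\<forall>t\<in>{0..1}. x t > 0) \<and>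
     (\<forall>t\<in>{0..1}. set_integrable lborel {0..t} (\<lambda>s. b s (x s)) \<and>
        x t = x0 + (LBINT s:{0..t}. b s (x s)) - \<sigma> * \<beta> t)"

text \<open>The one-sided bounds on \<open>u'\<close> and \<open>v'\<close> give stability of the
  scheme and uniqueness; \<open>upper\<close> prevents explosion, and \<open>lower\<close> is the
  repulsion from 0 that competes with the noise. \<open>elem_u\<close> and \<open>elem_v\<close>
  keep the truncated scheme elementary.\<close>

locale singular_drift =
  fixes u v u' v' :: "real \<Rightarrow> real" and H C p c y0 :: real
  assumes H: "0 < H" "H < 1/2"
    and du: "\<And>y. 0 < y \<Longrightarrow> (u has_real_derivative u' y) (at y)"
    and dv: "\<And>y. 0 < y \<Longrightarrow> (v has_real_derivative v' y) (at y)"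
    and cont_u': "continuous_on {0<..} u'" and cont_v': "continuous_on {0<..} v'"
    and u'_le: "\<And>y. 0 < y \<Longrightarrow> u' y \<le> C" and v'_le: "\<And>y. 0 < y \<Longrightarrow> v' y \<le> C"
    and C: "0 < C"
    and upper: "\<And>y. 1 \<le> y \<Longrightarrow> u y \<le> C" "\<And>y. 1 \<le> y \<Longrightarrow> v y \<le> C"
    and lower: "\<And>s y. 0 < y \<Longrightarrow> y \<le> y0 \<Longrightarrow> 0 < s \<Longrightarrow> s \<le> 1 \<Longrightarrow>
      c * y powr (- p) \<le> u y + s powr (2 * H - 1) * v y"
    and pcy: "0 < c" "0 < y0" "0 < p"
    and elem_u: "\<And>n f a. elem_fun n f \<Longrightarrow> 0 < a \<Longrightarrow> (\<And>w. a \<le> f w) \<Longrightarrow> elem_fun n (\<lambda>w. u (f w))"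
    and elem_v: "\<And>n f a. elem_fun n f \<Longrightarrow> 0 < a \<Longrightarrow> (\<And>w. a \<le> f w) \<Longrightarrow> elem_fun n (\<lambda>w. v (f w))"
begin

definition b :: "real \<Rightarrow> real \<Rightarrow> real" where
  "b s y = u y + s powr (2 * H - 1) * v y"

text \<open>Primitive of the singular weight; in this locale the letter has nothing to do with the
  Wiener process.\<close>

definition W :: "real \<Rightarrow> real" where
  "W t = t powr (2 * H) / (2 * H)"

text \<open>The clock in which the drift is one-sided Lipschitz with constant \<open>C\<close>. Its
  increments over a partition telescope, so all sums of step errors and of growth rates are bounded
  by multiples of \<open>V 1\<close>.\<close>

definition V :: "real \<Rightarrow> real" where
  "V t = t + W t"

lemma W_0 [simp]: "W 0 = 0" and V_0 [simp]: "V 0 = 0"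
  using H by (auto simp: W_def V_def)

lemma W_mono: "0 \<le> s \<Longrightarrow> s \<le> t \<Longrightarrow> W s \<le> W t"
  using H unfolding W_def by (intro divide_right_mono powr_mono2) auto

lemma V_mono: "0 \<le> s \<Longrightarrow> s \<le> t \<Longrightarrow> V s \<le> V t"
  using W_mono[of s t] by (simp add: V_def)

lemma V_nonneg: "0 \<le> t \<Longrightarrow> 0 \<le> V t"
  using V_mono[of 0 t] by simp

lemma continuous_on_W: "continuous_on {0..} W"
  unfolding W_def using H by (intro continuous_intros continuous_on_powr') auto

lemma continuous_on_V: "continuous_on {0..} V"
  unfolding V_def by (intro continuous_intros continuous_on_W)

lemma W_deriv: "0 < t \<Longrightarrow> (W has_real_derivative t powr (2 * H - 1)) (at t)"
  unfolding W_def using H by (auto intro!: derivative_eq_intros simp: powr_diff)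

lemma weight_integral:
  assumes "0 \<le> a" "a \<le> t"
  shows "set_integrable lborel {a<..t} (\<lambda>s. s powr (2 * H - 1))"
    and "(LBINT s:{a<..t}. s powr (2 * H - 1)) = W t - W a"
proof -
  have c: "continuous_on {0..r} W" for r
    by (rule continuous_on_subset[OF continuous_on_W]) auto
  have *: "set_integrable lborel {0..r} (\<lambda>s. s powr (2 * H - 1))"
    "(LBINT s:{0..r}. s powr (2 * H - 1)) = W r - W 0" if "0 \<le> r" for r
    using set_integral_FTC_interior_nonneg[OF that c W_deriv] by simp_all
  show "set_integrable lborel {a<..t} (\<lambda>s. s powr (2 * H - 1))"
    "(LBINT s:{a<..t}. s powr (2 * H - 1)) = W t - W a"
    using set_integral_Icc_diff[OF *(1), of t a] *(2)[of t] *(2)[of a] assms by auto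
qed

lemma const_integral:
  assumes "0 \<le> a" "a \<le> t"
  shows "set_integrable lborel {a<..t} (\<lambda>s. r + s powr (2 * H - 1) * r')"
    and "(LBINT s:{a<..t}. r + s powr (2 * H - 1) * r') = (t - a) * r + (W t - W a) * r'"
proof -
  have 1: "set_integrable lborel {a<..t} (\<lambda>s. r)"
    using assms by (simp add: set_integrable_def)
  have 2: "set_integrable lborel {a<..t} (\<lambda>s. s powr (2 * H - 1) * r')"
    by (rule set_integrable_mult_left) (rule weight_integral[OF assms])
  show "set_integrable lborel {a<..t} (\<lambda>s. r + s powr (2 * H - 1) * r')"
    by (rule set_integral_add(1)[OF 1 2])
  show "(LBINT s:{a<..t}. r + s powr (2 * H - 1) * r') = (t - a) * r + (W t - W a) * r'"
    unfolding set_integral_add(2)[OF 1 2]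
    using weight_integral(2)[OF assms] assms by (simp add: set_integral_const mult.commute)
qed

lemma continuous_on_u: "continuous_on {0<..} u" and continuous_on_v: "continuous_on {0<..} v"
  by (auto intro!: continuous_at_imp_continuous_on DERIV_isCont du dv)

text \<open>The weight is integrated exactly over each cell, through increments of \<open>W\<close>,
  because sampling \<open>s powr (2 * H - 1)\<close> would be useless at the left end of the first
  cell. Only the truncated state is frozen.\<close>

definition step :: "real \<Rightarrow> nat \<Rightarrow> nat \<Rightarrow> nat \<Rightarrow> real \<Rightarrow> real" where
  "step t N n k y = y + (t * Suc k / n - t * k / n) * u (clip N y)
     + (W (t * Suc k / n) - W (t * k / n)) * v (clip N y)"

lemma elem_fun_step:
  assumes "elem_fun m f" "N > 0"
  shows "elem_fun m (\<lambda>w. step t N n k (f w))"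
proof -
  obtain a b where ab: "0 < a" "\<And>y. a \<le> clip N y" "\<And>y. clip N y \<le> b"
    by (rule clip_bounds[of "real N"]) (use assms in auto)
  note c = elem_fun_clip[OF assms(1), of N]
  show ?thesis unfolding step_def
    by (intro elem_add elem_mult elem_const assms(1) elem_u[where a = a] elem_v[where a = a] c ab)
      (use assms in auto)
qed

section \<open>Choice of the mesh, stability and convergence of the scheme\<close>

lemma mesh_bound:
  fixes t :: real
  assumes "0 \<le> t" "t \<le> 1" "0 < \<epsilon>"
  shows "\<exists>n0>0. \<forall>n\<ge>n0. \<forall>k<n. V (t * Suc k / n) - V (t * k / n) < \<epsilon>"
proof -
  have "uniformly_continuous_on {0..1} V"
    by (rule compact_uniformly_continuous[OF continuous_on_subset[OF continuous_on_V]]) auto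
  then obtain d where d: "d > 0" "\<And>x y. x \<in> {0..1} \<Longrightarrow> y \<in> {0..1} \<Longrightarrow> dist y x < d \<Longrightarrow> dist (V y) (V x) < \<epsilon>"
    using assms(3) unfolding uniformly_continuous_on_def by metis
  obtain n0 where n0: "1 / d < real n0" using reals_Archimedean2 by blast
  have "V (t * Suc k / n) - V (t * k / n) < \<epsilon>" if "n \<ge> n0" "k < n" for n k
  proof -
    have "1 / d < real n" using n0 that by simp
    then have nd: "1 / real n < d" using d that by (simp add: field_simps)
    have n: "n > 0" using that by simp
    have r: "t * Suc k / n \<in> {0..1}" "t * k / n \<in> {0..1}"
      using assms that n mult_mono[of t 1 "real (Suc k)" "real n"] mult_mono[of t 1 "real k" "real n"]
      by (auto simp: divide_le_eq)
    have "t * Suc k / n - t * k / n = t / n" by (simp add: algebra_simps add_divide_distrib)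
    moreover have "t / n \<le> 1 / n" using assms by (intro divide_right_mono) auto
    ultimately have "dist (t * Suc k / n) (t * k / n) < d"
      using nd assms by (simp add: dist_real_def)
    from d(2)[OF r(2,1) this] show ?thesis by (simp add: dist_real_def)
  qed
  moreover have "n0 > 0" using n0 d by (metis divide_pos_pos gr0I less_asym of_nat_0 zero_less_one)
  ultimately show ?thesis by blast
qed

text \<open>On the compact range of \<open>clip N\<close> both derivatives are at least
  \<open>- M\<close>. A mesh with increments of \<open>V\<close> below \<open>1 / M\<close>
  therefore makes the one-step derivative nonnegative. The upper bound comes from
  \<open>u'_le\<close> and \<open>v'_le\<close> alone and so does not deteriorate as
  \<open>N\<close> grows.\<close>

lemma step_deriv:
  fixes t :: real
  assumes t: "0 \<le> t" "t \<le> 1" and N: "0 < N"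
  shows "\<exists>n\<ge>N. \<forall>k<n. \<forall>y. \<exists>q. (step t N n k has_real_derivative q) (at y) \<and> 0 \<le> q \<and>
    q \<le> 1 + C * (V (t * Suc k / n) - V (t * k / n))"
proof -
  obtain a b where ab: "0 < a" "\<And>y. a \<le> clip N y" "\<And>y. clip N y \<le> b"
    by (rule clip_bounds[of "real N"]) (use N in auto)
  have "bounded (u' ` {a..b})" "bounded (v' ` {a..b})"
    by (auto intro!: compact_imp_bounded compact_continuous_image continuous_on_subset[OF cont_u']
        continuous_on_subset[OF cont_v']) (use ab in auto)
  then obtain M1 M2 where "\<forall>x\<in>u' ` {a..b}. norm x \<le> M1" "\<forall>x\<in>v' ` {a..b}. norm x \<le> M2"
    unfolding bounded_iff by blast
  then have M: "\<And>y. y \<in> {a..b} \<Longrightarrow> \<bar>u' y\<bar> \<le> M1" "\<And>y. y \<in> {a..b} \<Longrightarrow> \<bar>v' y\<bar> \<le> M2"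
    by auto
  define M where "M = \<bar>M1\<bar> + \<bar>M2\<bar> + 1"
  have M': "- M \<le> u' y" "- M \<le> v' y" if "y \<in> {a..b}" for y
    using M(1)[OF that] M(2)[OF that] by (auto simp: M_def)
  have "M > 0" by (simp add: M_def add_nonneg_pos)
  obtain n0 where n0: "n0 > 0" "\<And>n k. n \<ge> n0 \<Longrightarrow> k < n \<Longrightarrow> V (t * Suc k / n) - V (t * k / n) < 1 / M"
    using mesh_bound[OF t, of "1 / M"] \<open>M > 0\<close> by auto
  define n where "n = max N n0"
  have "\<exists>q. (step t N n k has_real_derivative q) (at y) \<and> 0 \<le> q \<and>
      q \<le> 1 + C * (V (t * Suc k / n) - V (t * k / n))" if k: "k < n" for k y
  proof -
    define h where "h = t * Suc k / n - t * k / n"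
    define w where "w = W (t * Suc k / n) - W (t * k / n)"
    have le: "0 \<le> t * k / n" "t * k / n \<le> t * Suc k / n"
      using t by (auto intro!: divide_right_mono mult_left_mono)
    have hw: "0 \<le> h" "0 \<le> w" "h + w = V (t * Suc k / n) - V (t * k / n)" "h + w < 1 / M"
      using le W_mono[OF le] n0(2)[of n k] k by (auto simp: h_def w_def V_def n_def)
    obtain c where c: "(clip N has_real_derivative c) (at y)" "0 \<le> c" "c \<le> 1"
      by (rule clip_deriv[of "real N" y]) (use N in auto)
    define z where "z = clip N y"
    have z: "z \<in> {a..b}" "z > 0" using ab(2)[of y] ab(3)[of y] ab(1) by (auto simp: z_def)
    define B where "B = h * u' z + w * v' z"
    have "((\<lambda>y. y + h * u (clip N y) + w * v (clip N y)) has_real_derivative 1 + h * (u' z * c) + w * (v' z * c)) (at y)"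
      using DERIV_chain2[OF du[OF z(2), unfolded z_def] c(1)] DERIV_chain2[OF dv[OF z(2), unfolded z_def] c(1)]
      unfolding z_def by (intro DERIV_add DERIV_ident DERIV_cmult)
    then have "(step t N n k has_real_derivative 1 + B * c) (at y)"
      unfolding step_def[abs_def] h_def[symmetric] w_def[symmetric] B_def
      by (rule DERIV_cong) (simp add: algebra_simps)
    moreover have "B \<ge> - 1"
    proof -
      have "h * (- M) + w * (- M) \<le> B" unfolding B_def
        by (intro add_mono mult_left_mono M' z hw)
      moreover have "(h + w) * M \<le> 1" using hw(4) \<open>M > 0\<close> by (simp add: field_simps)
      ultimately show ?thesis by (simp add: algebra_simps)
    qed
    moreover have "B \<le> C * (h + w)"
    proof -
      have "B \<le> h * C + w * C" unfolding B_def
        by (intro add_mono mult_left_mono u'_le v'_le z hw)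
      then show ?thesis by (simp add: algebra_simps)
    qed
    moreover have "- 1 \<le> B * c \<and> B * c \<le> C * (h + w)"
    proof (cases "B \<ge> 0")
      case True
      then have "B * c \<le> B * 1" "0 \<le> B * c" using c by (auto intro: mult_left_mono simp del: mult_1_right)
      then show ?thesis using \<open>B \<le> C * (h + w)\<close> by auto
    next
      case False
      then have "B * 1 \<le> B * c" "B * c \<le> 0"
        using c by (auto intro: mult_left_mono_neg mult_nonpos_nonneg)
      moreover have "0 \<le> C * (h + w)" using C hw by auto
      ultimately show ?thesis using \<open>B \<ge> - 1\<close> by auto
    qed
    ultimately show ?thesis unfolding hw(3)[symmetric] by (intro exI[of _ "1 + B * c"]) auto
  qed
  then show ?thesis by (intro exI[of _ n]) (auto simp: n_def)
qed

text \<open>Discrete Gronwall argument in the clock \<open>V\<close>: the solution fulfils the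
  scheme up to a residual of size \<open>\<epsilon>\<close> times the increment of \<open>V\<close>,
  and each step expands errors by at most \<open>1 + C * dV\<close>. The hypothesis
  \<open>close\<close> collects both the truncation error and the oscillation of the solution on a
  cell.\<close>

lemma scheme_error:
  fixes t :: real
  assumes t: "0 \<le> t" "t \<le> 1" and n: "0 < n"
    and q: "\<And>k y. k < n \<Longrightarrow> \<exists>q. (step t N n k has_real_derivative q) (at y) \<and> 0 \<le> q \<and>
      q \<le> 1 + C * (V (t * Suc k / n) - V (t * k / n))"
    and x: "path_solution b \<sigma> x0 \<beta> x" and \<beta>0: "\<beta> 0 = 0" and \<epsilon>: "0 \<le> \<epsilon>"
    and close: "\<And>k s. k < n \<Longrightarrow> t * k / n \<le> s \<Longrightarrow> s \<le> t * Suc k / n \<Longrightarrow>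
      \<bar>u (x s) - u (clip N (x (t * k / n)))\<bar> \<le> \<epsilon> \<and> \<bar>v (x s) - v (clip N (x (t * k / n)))\<bar> \<le> \<epsilon>"
  shows "\<bar>scheme (step t N n) \<sigma> x0 n (\<lambda>k. \<beta> (t * k / n)) - x t\<bar> \<le> exp (C * V 1) * (\<epsilon> * V 1)"
proof -
  define T where "T k = t * real k / n" for k
  define s where "s k = scheme (step t N n) \<sigma> x0 k (\<lambda>k. \<beta> (T k))" for k
  have T01: "0 \<le> T k" "T k \<le> 1" if "k \<le> n" for k
    using that t n mult_mono[of t 1 "real k" "real n"] by (auto simp: T_def divide_le_eq)
  have Tm: "T k \<le> T (Suc k)" for k
    using t by (auto simp: T_def intro!: divide_right_mono mult_left_mono)
  have "\<bar>s k - x (T k)\<bar> \<le> exp (C * V (T k)) * (\<epsilon> * V (T k))" if "k \<le> n" for k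
    using that
  proof (induction k)
    case 0
    have "x 0 = x0 + (LBINT s:{0..0}. b s (x s)) - \<sigma> * \<beta> 0"
      using x by (auto simp: path_solution_def)
    moreover have "(LBINT s:{0..0}. b s (x s)) = 0"
      unfolding set_lebesgue_integral_def
      by (rule integral_eq_zero_AE, rule AE_mp[OF AE_lborel_singleton[of 0]]) (auto simp: indicator_def)
    ultimately have "x 0 = x0" using \<beta>0 by simp
    then show ?case by (simp add: T_def s_def)
  next
    case (Suc k)
    then have k: "k < n" by simp
    let ?a = "T k" and ?b = "T (Suc k)"
    define dV where "dV = V ?b - V ?a"
    have dV: "0 \<le> dV" using V_mono[of ?a ?b] T01[of k] Tm[of k] k by (simp add: dV_def)
    define z where "z = clip N (x ?a)"
    have ab: "0 \<le> ?a" "?a \<le> ?b" "?b \<le> 1" using T01[of k] T01[of "Suc k"] Tm k by auto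
    have sol: "set_integrable lborel {0..r} (\<lambda>s. b s (x s))"
      "x r = x0 + (LBINT s:{0..r}. b s (x s)) - \<sigma> * \<beta> r" if "r \<in> {0..1}" for r
      using x that by (auto simp: path_solution_def)
    have i: "set_integrable lborel {?a<..?b} (\<lambda>s. b s (x s))"
      and d: "(LBINT s:{0..?b}. b s (x s)) - (LBINT s:{0..?a}. b s (x s)) = (LBINT s:{?a<..?b}. b s (x s))"
      using set_integral_Icc_diff[OF sol(1)[of ?b], of ?a] ab by auto
    \<comment> \<open>Residual of the exact solution in one step; the noise increment drops out of
      it exactly.\<close>
    define r where "r = x ?b - (step t N n k (x ?a) - \<sigma> * (\<beta> ?b - \<beta> ?a))"
    note ci = const_integral[OF ab(1,2), of "u z" "v z"]
    have "r = (LBINT s:{?a<..?b}. b s (x s)) - ((?b - ?a) * u z + (W ?b - W ?a) * v z)"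
      unfolding r_def step_def T_def[symmetric] z_def[symmetric] d[symmetric]
      using sol(2)[of ?a] sol(2)[of ?b] ab by (simp add: algebra_simps)
    also have "\<dots> = (LBINT s:{?a<..?b}. b s (x s) - (u z + s powr (2 * H - 1) * v z))"
      unfolding ci(2)[symmetric] by (rule set_integral_diff(2)[OF i ci(1), symmetric])
    finally have r: "r = (LBINT s:{?a<..?b}. b s (x s) - (u z + s powr (2 * H - 1) * v z))" .
    have di: "set_integrable lborel {?a<..?b} (\<lambda>s. b s (x s) - (u z + s powr (2 * H - 1) * v z))"
      by (rule set_integral_diff(1)[OF i ci(1)])
    have "\<bar>r\<bar> \<le> (LBINT s:{?a<..?b}. norm (b s (x s) - (u z + s powr (2 * H - 1) * v z)))"
      unfolding r using set_integral_norm_bound[OF di] by simp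
    also have "\<dots> \<le> (LBINT s:{?a<..?b}. \<epsilon> + s powr (2 * H - 1) * \<epsilon>)"
    proof (rule set_integral_mono)
      show "set_integrable lborel {?a<..?b} (\<lambda>s. norm (b s (x s) - (u z + s powr (2 * H - 1) * v z)))"
        by (rule set_integrable_norm[OF di])
      show "set_integrable lborel {?a<..?b} (\<lambda>s. \<epsilon> + s powr (2 * H - 1) * \<epsilon>)"
        by (rule const_integral[OF ab(1,2)])
      fix s assume s: "s \<in> {?a<..?b}"
      then have c: "\<bar>u (x s) - u z\<bar> \<le> \<epsilon>" "\<bar>v (x s) - v z\<bar> \<le> \<epsilon>"
        using close[OF k, of s] by (auto simp: T_def z_def)
      have "b s (x s) - (u z + s powr (2 * H - 1) * v z) = (u (x s) - u z) + s powr (2 * H - 1) * (v (x s) - v z)"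
        by (simp add: b_def algebra_simps)
      also have "norm \<dots> \<le> \<bar>u (x s) - u z\<bar> + s powr (2 * H - 1) * \<bar>v (x s) - v z\<bar>"
        by (rule order_trans[OF norm_triangle_ineq]) (simp add: abs_mult)
      also have "\<dots> \<le> \<epsilon> + s powr (2 * H - 1) * \<epsilon>"
        using c by (intro add_mono mult_left_mono) auto
      finally show "norm (b s (x s) - (u z + s powr (2 * H - 1) * v z)) \<le> \<epsilon> + s powr (2 * H - 1) * \<epsilon>" .
    qed
    also have "\<dots> = \<epsilon> * dV"
      unfolding const_integral(2)[OF ab(1,2)] by (simp add: dV_def V_def algebra_simps)
    finally have rb: "\<bar>r\<bar> \<le> \<epsilon> * dV" .
    have "\<forall>y. \<exists>q. (step t N n k has_real_derivative q) (at y) \<and> 0 \<le> q \<and> q \<le> 1 + C * dV"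
      using q[OF k] by (simp add: dV_def T_def)
    then obtain g' where g': "\<And>y. (step t N n k has_real_derivative g' y) (at y)"
      "\<And>y. 0 \<le> g' y" "\<And>y. g' y \<le> 1 + C * dV" by metis
    obtain z' where z': "step t N n k (s k) - step t N n k (x ?a) = g' z' * (s k - x ?a)"
      by (rule MVT_quotient[OF g'(1)])
    have "s (Suc k) - x ?b = g' z' * (s k - x ?a) - r"
      unfolding z'[symmetric] r_def by (simp add: s_def algebra_simps)
    then have "\<bar>s (Suc k) - x ?b\<bar> \<le> g' z' * \<bar>s k - x ?a\<bar> + \<bar>r\<bar>"
      using abs_triangle_ineq4[of "g' z' * (s k - x ?a)" r] g'(2)[of z'] by (simp add: abs_mult)
    also have "\<dots> \<le> (1 + C * dV) * (exp (C * V ?a) * (\<epsilon> * V ?a)) + \<epsilon> * dV"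
      using Suc k g'(2,3)[of z'] rb by (intro add_mono mult_mono) auto
    also have "\<dots> \<le> exp (C * dV) * (exp (C * V ?a) * (\<epsilon> * V ?a)) + exp (C * V ?b) * (\<epsilon> * dV)"
    proof (intro add_mono mult_right_mono)
      show "1 + C * dV \<le> exp (C * dV)" by (rule exp_ge_add_one_self)
      have "1 * (\<epsilon> * dV) \<le> exp (C * V ?b) * (\<epsilon> * dV)"
        using C V_nonneg[of ?b] ab \<epsilon> dV by (intro mult_right_mono) auto
      then show "\<epsilon> * dV \<le> exp (C * V ?b) * (\<epsilon> * dV)" by simp
    qed (use \<epsilon> V_nonneg[OF ab(1)] in auto)
    also have "exp (C * dV) * (exp (C * V ?a) * (\<epsilon> * V ?a)) = exp (C * V ?b) * (\<epsilon> * V ?a)"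
      unfolding mult.assoc[symmetric] exp_add[symmetric] by (simp add: dV_def algebra_simps)
    also have "\<dots> + exp (C * V ?b) * (\<epsilon> * dV) = exp (C * V ?b) * (\<epsilon> * V ?b)"
      by (simp add: dV_def algebra_simps)
    finally show ?case .
  qed
  from this[of n] have "\<bar>s n - x t\<bar> \<le> exp (C * V t) * (\<epsilon> * V t)"
    using n by (simp add: T_def)
  also have "\<dots> \<le> exp (C * V 1) * (\<epsilon> * V 1)"
    using V_mono[of t 1] V_nonneg[of t] t C \<epsilon> by (intro mult_mono) (auto intro: mult_left_mono)
  finally show ?thesis by (simp add: s_def T_def)
qed

text \<open>Packages a diagonal sequence: truncation level \<open>Suc N\<close> with a mesh of
  \<open>nn N\<close> cells chosen for that level. The steps depend on \<open>t\<close> and the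
  drift only, so one sequence serves every path and every solution along it; uniqueness, adaptedness
  and the Malliavin statement all draw on this.\<close>

lemma scheme_exists:
  fixes t :: real
  assumes t: "0 \<le> t" "t \<le> 1"
  obtains g :: "nat \<Rightarrow> nat \<Rightarrow> real \<Rightarrow> real" and g' :: "nat \<Rightarrow> nat \<Rightarrow> real \<Rightarrow> real"
    and l :: "nat \<Rightarrow> nat \<Rightarrow> real" and nn :: "nat \<Rightarrow> nat" and \<Lambda> :: real
  where "\<And>N. 0 < nn N"
    and "\<And>N k m f. elem_fun m f \<Longrightarrow> elem_fun m (\<lambda>w. g N k (f w))"
    and "\<And>N k y. k < nn N \<Longrightarrow> (g N k has_real_derivative g' N k y) (at y)"
    and "\<And>N k y. k < nn N \<Longrightarrow> 0 \<le> g' N k y" and "\<And>N k y. k < nn N \<Longrightarrow> g' N k y \<le> 1 + l N k"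
    and "\<And>N k. k < nn N \<Longrightarrow> 0 \<le> l N k" and "\<And>N. (\<Sum>k<nn N. l N k) \<le> \<Lambda>"
    and "\<And>\<sigma> x0 \<beta> x. path_solution b \<sigma> x0 \<beta> x \<Longrightarrow> \<beta> 0 = 0 \<Longrightarrow>
      (\<lambda>N. scheme (g N) \<sigma> x0 (nn N) (\<lambda>k. \<beta> (t * k / nn N))) \<longlonglongrightarrow> x t"
proof -
  have "\<forall>N. \<exists>n\<ge>Suc N. \<forall>k<n. \<forall>y. \<exists>q. (step t (Suc N) n k has_real_derivative q) (at y) \<and> 0 \<le> q \<and>
    q \<le> 1 + C * (V (t * Suc k / n) - V (t * k / n))"
    using step_deriv[OF t] by blast
  then obtain nn where nn: "\<And>N. Suc N \<le> nn N"
    and q: "\<And>N k y. k < nn N \<Longrightarrow> \<exists>q. (step t (Suc N) (nn N) k has_real_derivative q) (at y) \<and> 0 \<le> q \<and>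
      q \<le> 1 + C * (V (t * Suc k / nn N) - V (t * k / nn N))" by metis
  define l where "l N k = C * (V (t * Suc k / nn N) - V (t * k / nn N))" for N k
  define g' where "g' N k y = (SOME q. (step t (Suc N) (nn N) k has_real_derivative q) (at y) \<and>
      0 \<le> q \<and> q \<le> 1 + l N k)" for N k y
  have "(step t (Suc N) (nn N) k has_real_derivative g' N k y) (at y) \<and> 0 \<le> g' N k y \<and> g' N k y \<le> 1 + l N k"
    if "k < nn N" for N k y
    unfolding g'_def by (rule someI_ex) (use q[OF that] in \<open>simp add: l_def\<close>)
  then have g': "\<And>N k y. k < nn N \<Longrightarrow> (step t (Suc N) (nn N) k has_real_derivative g' N k y) (at y)"
    "\<And>N k y. k < nn N \<Longrightarrow> 0 \<le> g' N k y" "\<And>N k y. k < nn N \<Longrightarrow> g' N k y \<le> 1 + l N k" by auto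
  have nn0: "0 < nn N" for N using nn[of N] by simp
  show ?thesis
  \<comment> \<open>The rates \<open>l\<close> sum telescopically to \<open>C * V t\<close>, hence
    the bound \<open>C * V 1\<close>, which is independent of \<open>N\<close>.\<close>
  proof (rule that[where g = "\<lambda>N. step t (Suc N) (nn N)" and g' = g' and l = l and nn = nn and \<Lambda> = "C * V 1"])
    show "0 \<le> l N k" if "k < nn N" for N k
    proof -
      have "t * k / nn N \<le> t * Suc k / nn N"
        using t by (intro divide_right_mono mult_left_mono) auto
      then show ?thesis
        unfolding l_def using V_mono[of "t * k / nn N" "t * Suc k / nn N"] t C by simp
    qed
    show "(\<Sum>k<nn N. l N k) \<le> C * V 1" for N
    proof -
      have "(\<Sum>k<nn N. l N k) = C * (\<Sum>k<nn N. V (t * Suc k / nn N) - V (t * k / nn N))"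
        by (simp add: l_def sum_distrib_left)
      also have "(\<Sum>k<nn N. V (t * Suc k / nn N) - V (t * k / nn N)) = V (t * nn N / nn N) - V (t * 0 / nn N)"
        using sum_lessThan_telescope[of "\<lambda>k. V (t * k / nn N)" "nn N"] by simp
      also have "\<dots> = V t" using nn0[of N] by simp
      finally show ?thesis using V_mono[of t 1] t C by (simp add: mult_left_mono)
    qed
    fix \<sigma> x0 \<beta> x assume x: "path_solution b \<sigma> x0 \<beta> x" and \<beta>0: "\<beta> 0 = 0"
    have xc: "continuous_on {0..1} x" and xpos: "\<And>s. s \<in> {0..1} \<Longrightarrow> x s > 0"
      using x by (auto simp: path_solution_def)
    obtain sm where sm: "sm \<in> {0..1}" "\<And>s. s \<in> {0..1} \<Longrightarrow> x sm \<le> x s"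
      using continuous_attains_inf[OF compact_Icc _ xc] by auto
    obtain sM where sM: "sM \<in> {0..1}" "\<And>s. s \<in> {0..1} \<Longrightarrow> x s \<le> x sM"
      using continuous_attains_sup[OF compact_Icc _ xc] by auto
    define m M where "m = x sm" and "M = x sM"
    have m: "m > 0" using xpos sm by (simp add: m_def)
    have xmM: "m \<le> x s" "x s \<le> M" if "s \<in> {0..1}" for s using sm sM that by (auto simp: m_def M_def)
    \<comment> \<open>The margins \<open>m / 2\<close> and 1 leave room for truncated values near
      the path, so one modulus of continuity for \<open>u\<close> and \<open>v\<close> covers both
      kinds of argument.\<close>
    define I where "I = {m / 2..M + 1}"
    have "uniformly_continuous_on I u" "uniformly_continuous_on I v" unfolding I_def
      by (auto intro!: compact_uniformly_continuous continuous_on_subset[OF continuous_on_u]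
          continuous_on_subset[OF continuous_on_v]) (use m in auto)
    note uc = this[unfolded uniformly_continuous_on_def]
    have ucx: "uniformly_continuous_on {0..1} x"
      by (rule compact_uniformly_continuous[OF xc]) simp
    have ev: "\<exists>K. \<forall>N\<ge>K. \<bar>scheme (step t (Suc N) (nn N)) \<sigma> x0 (nn N) (\<lambda>k. \<beta> (t * k / nn N)) - x t\<bar>
        \<le> exp (C * V 1) * (\<epsilon> * V 1)" if \<epsilon>: "\<epsilon> > 0" for \<epsilon>
    proof -
      obtain d1 where d1: "d1 > 0" "\<And>y y'. y \<in> I \<Longrightarrow> y' \<in> I \<Longrightarrow> dist y' y < d1 \<Longrightarrow> dist (u y') (u y) < \<epsilon>"
        using uc(1) \<epsilon> by metis
      obtain d2 where d2: "d2 > 0" "\<And>y y'. y \<in> I \<Longrightarrow> y' \<in> I \<Longrightarrow> dist y' y < d2 \<Longrightarrow> dist (v y') (v y) < \<epsilon>"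
        using uc(2) \<epsilon> by metis
      define d where "d = min (min d1 d2) (min (m / 2) 1)"
      have d: "d > 0" "d \<le> d1" "d \<le> d2" "d \<le> m / 2" "d \<le> 1" using d1 d2 m by (auto simp: d_def)
      obtain d3 where d3: "d3 > 0" "\<And>s s'. s \<in> {0..1} \<Longrightarrow> s' \<in> {0..1} \<Longrightarrow> dist s' s < d3 \<Longrightarrow> dist (x s') (x s) < d / 2"
        using ucx[unfolded uniformly_continuous_on_def] d by (metis half_gt_zero)
      obtain K :: nat where K: "max (1 / d3) (2 * (M ^ 3 + 1) / d) < real K" using reals_Archimedean2 by blast
      have "\<bar>scheme (step t (Suc N) (nn N)) \<sigma> x0 (nn N) (\<lambda>k. \<beta> (t * k / nn N)) - x t\<bar>
        \<le> exp (C * V 1) * (\<epsilon> * V 1)" if N: "K \<le> N" for N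
      proof (rule scheme_error[OF t nn0 q x \<beta>0])
        fix k s assume k: "k < nn N" and s: "t * k / nn N \<le> s" "s \<le> t * Suc k / nn N"
        define a where "a = t * k / nn N"
        have "t * Suc k / nn N \<le> 1"
          using t k nn0[of N] mult_mono[of t 1 "real (Suc k)" "real (nn N)"] by (auto simp: divide_le_eq)
        then have as: "a \<in> {0..1}" "s \<in> {0..1}" using s t by (auto simp: a_def) (smt (verit) divide_nonneg_nonneg mult_nonneg_nonneg of_nat_0_le_iff)+
        have "1 / d3 < real (nn N)" using K N nn[of N] by simp
        then have "1 / real (nn N) < d3" using d3 nn0[of N] by (simp add: field_simps)
        moreover have "t * Suc k / nn N - a = t / nn N" by (simp add: a_def algebra_simps add_divide_distrib)
        moreover have "t / nn N \<le> 1 / nn N" using t by (intro divide_right_mono) auto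
        ultimately have "dist s a < d3" using s by (simp add: dist_real_def a_def)
        from d3(2)[OF as this] have xs: "\<bar>x s - x a\<bar> < d / 2" by (simp add: dist_real_def)
        have "\<bar>clip (Suc N) (x a) - x a\<bar> \<le> (M ^ 3 + 1) / Suc N"
          by (rule clip_close) (use xmM[OF as(1)] m in auto)
        also have "\<dots> < d / 2"
        proof -
          have "2 * (M ^ 3 + 1) / d < real (Suc N)" using K N by simp
          then show ?thesis using d by (simp add: field_simps)
        qed
        finally have xc: "\<bar>clip (Suc N) (x a) - x a\<bar> < d / 2" .
        have I1: "x s \<in> I" using xmM[OF as(2)] m by (auto simp: I_def)
        have I2: "clip (Suc N) (x a) \<in> I" using xmM[OF as(1)] m xc d
          unfolding I_def abs_less_iff atLeastAtMost_iff by argo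
        have "dist (x s) (clip (Suc N) (x a)) < d"
          using xs xc unfolding dist_real_def abs_less_iff by argo
        then show "\<bar>u (x s) - u (clip (Suc N) (x (t * k / nn N)))\<bar> \<le> \<epsilon> \<and>
            \<bar>v (x s) - v (clip (Suc N) (x (t * k / nn N)))\<bar> \<le> \<epsilon>"
          using d1(2)[OF I2 I1] d2(2)[OF I2 I1] d by (simp add: a_def dist_real_def)
      qed (use \<epsilon> in auto)
      then show ?thesis by blast
    qed
    show "(\<lambda>N. scheme (step t (Suc N) (nn N)) \<sigma> x0 (nn N) (\<lambda>k. \<beta> (t * k / nn N))) \<longlonglongrightarrow> x t"
    proof (rule LIMSEQ_I)
      fix r :: real assume r: "r > 0"
      define \<epsilon> where "\<epsilon> = r / (2 * exp (C * V 1) * (V 1 + 1))"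
      have V1: "0 \<le> V 1" by (rule V_nonneg) simp
      have \<epsilon>: "\<epsilon> > 0" unfolding \<epsilon>_def using r V1 by auto
      have "exp (C * V 1) * (\<epsilon> * V 1) \<le> exp (C * V 1) * (\<epsilon> * (V 1 + 1))"
        using \<epsilon> by (intro mult_left_mono) auto
      also have "\<dots> = r / 2"
      proof -
        have "e * (r / (2 * e * q) * q) = r / 2" if "e \<noteq> 0" "q \<noteq> 0" for e q :: real
          using that by simp
        from this[of "exp (C * V 1)" "V 1 + 1"] show ?thesis using V1 by (simp only: \<epsilon>_def) simp
      qed
      also have "\<dots> < r" using r by simp
      finally have "exp (C * V 1) * (\<epsilon> * V 1) < r" .
      moreover obtain K where "\<forall>N\<ge>K. \<bar>scheme (step t (Suc N) (nn N)) \<sigma> x0 (nn N) (\<lambda>k. \<beta> (t * k / nn N)) - x t\<bar>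
        \<le> exp (C * V 1) * (\<epsilon> * V 1)" using ev[OF \<epsilon>] by blast
      ultimately show "\<exists>K. \<forall>N\<ge>K. norm (scheme (step t (Suc N) (nn N)) \<sigma> x0 (nn N) (\<lambda>k. \<beta> (t * k / nn N)) - x t) < r"
        unfolding real_norm_def by (blast intro: le_less_trans)
    qed
  qed (use nn0 g' elem_fun_step in auto)
qed

end

section \<open>Pathwise existence\<close>

lemma continuous_on_Icc_bounded:
  fixes f :: "real \<Rightarrow> real"
  assumes "continuous_on {a..b} f"
  shows "\<exists>K. \<forall>s\<in>{a..b}. \<bar>f s\<bar> \<le> K"
proof -
  obtain K where "\<forall>x\<in>f ` {a..b}. norm x \<le> K"
    using compact_imp_bounded[OF compact_continuous_image[OF assms compact_Icc]]
    unfolding bounded_iff by blast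
  then show ?thesis by auto
qed

text \<open>Serves both barrier arguments: with the path itself for the upper barrier and with its
  negative for the lower one.\<close>

lemma last_exit:
  fixes x :: "real \<Rightarrow> real"
  assumes x: "continuous_on {0..t} x" and x0: "x 0 \<le> r" and t: "0 \<le> t"
  obtains \<tau> where "\<tau> \<in> {0..t}" "x \<tau> \<le> r" "\<And>s. \<tau> < s \<Longrightarrow> s \<le> t \<Longrightarrow> r < x s"
proof -
  define S where "S = {0..t} \<inter> x -` {..r}"
  have "closed S" unfolding S_def
    by (rule continuous_closed_preimage[OF x]) auto
  moreover have "bounded S" by (rule bounded_subset[of "{0..t}"]) (auto simp: S_def)
  moreover have "S \<noteq> {}" using x0 t by (auto simp: S_def)
  ultimately obtain \<tau> where \<tau>: "\<tau> \<in> S" "\<And>s. s \<in> S \<Longrightarrow> s \<le> \<tau>"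
    using compact_attains_sup[of S] by (auto simp: compact_eq_bounded_closed)
  have "r < x s" if "\<tau> < s" "s \<le> t" for s
  proof (rule ccontr)
    assume "\<not> r < x s"
    then have "s \<in> S" using that \<tau>(1) by (auto simp: S_def)
    then show False using \<tau>(2) that by fastforce
  qed
  then show ?thesis using that[of \<tau>] \<tau>(1) by (auto simp: S_def)
qed

section \<open>Lipschitz equations with singular weight, and barriers for the clamped
  equation\<close>

context singular_drift
begin

lemma weighted_integrable:
  assumes g: "continuous_on {0..t} g1" "continuous_on {0..t} g2" and t: "0 \<le> t"
  shows "set_integrable lborel {0..t} (\<lambda>s. g1 s + s powr (2 * H - 1) * g2 s)"
proof -
  have 1: "set_integrable lborel {0..t} g1" by (rule borel_integrable_atLeastAtMost'[OF g(1)])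
  obtain K where K: "\<And>s. s \<in> {0..t} \<Longrightarrow> \<bar>g2 s\<bar> \<le> K"
    using continuous_on_Icc_bounded[OF g(2)] by blast
  have "continuous_on {0..t} W" by (rule continuous_on_subset[OF continuous_on_W]) auto
  then have "set_integrable lborel {0..t} (\<lambda>s. s powr (2 * H - 1))"
    using set_integral_FTC_interior_nonneg(1)[OF t _ W_deriv] by simp
  then have w: "set_integrable lborel {0..t} (\<lambda>s. s powr (2 * H - 1) * K)" by simp
  have m: "(\<lambda>s. indicator {0..t} s *\<^sub>R g2 s) \<in> borel_measurable borel"
    by (rule borel_measurable_continuous_on_indicator[OF _ g(2)]) simp
  have m2: "(\<lambda>s. indicator {0..t} s *\<^sub>R (s powr (2 * H - 1) * g2 s)) \<in> borel_measurable borel"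
  proof -
    have "(\<lambda>s. s powr (2 * H - 1) * (indicator {0..t} s *\<^sub>R g2 s)) \<in> borel_measurable borel"
      using m by measurable
    then show ?thesis by (simp add: mult_ac)
  qed
  have "set_integrable lborel {0..t} (\<lambda>s. s powr (2 * H - 1) * g2 s)"
    unfolding set_integrable_def
  proof (rule Bochner_Integration.integrable_bound)
    show "integrable lborel (\<lambda>s. indicator {0..t} s *\<^sub>R (s powr (2 * H - 1) * K))"
      using w by (simp add: set_integrable_def)
    show "(\<lambda>s. indicator {0..t} s *\<^sub>R (s powr (2 * H - 1) * g2 s)) \<in> borel_measurable lborel"
      using m2 by simp
    have "norm (indicator {0..t} s *\<^sub>R (s powr (2 * H - 1) * g2 s))
        \<le> norm (indicator {0..t} s *\<^sub>R (s powr (2 * H - 1) * K))" for s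
      using K[of s] by (auto simp: indicator_def abs_mult intro!: mult_left_mono)
    then show "AE s in lborel. norm (indicator {0..t} s *\<^sub>R (s powr (2 * H - 1) * g2 s))
        \<le> norm (indicator {0..t} s *\<^sub>R (s powr (2 * H - 1) * K))" by simp
  qed
  then show ?thesis by (rule set_integral_add(1)[OF 1])
qed

text \<open>The integrand is the derivative of \<open>exp (2 * L * V s)\<close>; this is the
  computation behind the weighted norm used for the fixed point.\<close>

lemma exp_V_integral:
  assumes t: "0 \<le> t" and L: "0 \<le> L"
  shows "set_integrable lborel {0..t} (\<lambda>s. (1 + s powr (2 * H - 1)) * (2 * L * exp (2 * L * V s)))"
    and "(LBINT s:{0..t}. (1 + s powr (2 * H - 1)) * (2 * L * exp (2 * L * V s))) = exp (2 * L * V t) - 1"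
proof -
  have c: "continuous_on {0..t} (\<lambda>s. exp (2 * L * V s))"
    by (intro continuous_intros continuous_on_subset[OF continuous_on_V]) auto
  have d: "((\<lambda>s. exp (2 * L * V s)) has_real_derivative (1 + s powr (2 * H - 1)) * (2 * L * exp (2 * L * V s))) (at s)"
    if "0 < s" for s
    unfolding V_def by (auto intro!: derivative_eq_intros W_deriv that simp: algebra_simps)
  have m: "(\<lambda>s. (1 + s powr (2 * H - 1)) * (2 * L * exp (2 * L * V s))) \<in> borel_measurable borel"
    unfolding V_def W_def by measurable
  show "set_integrable lborel {0..t} (\<lambda>s. (1 + s powr (2 * H - 1)) * (2 * L * exp (2 * L * V s)))"
    "(LBINT s:{0..t}. (1 + s powr (2 * H - 1)) * (2 * L * exp (2 * L * V s))) = exp (2 * L * V t) - 1"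
    using set_integral_FTC_interior_nonneg[OF t c d m] L by auto
qed

text \<open>Dividing by \<open>E s = exp (2 * L * V s)\<close> makes the integral operator a
  contraction with factor 1/2 on all of [0, 1] at once, so no subdivision of the interval is needed
  and the singularity of the weight is absorbed in \<open>V\<close>.\<close>

lemma Picard:
  fixes U1 U2 \<xi> :: "real \<Rightarrow> real"
  assumes L: "0 < L" and U: "\<And>y y'. \<bar>U1 y - U1 y'\<bar> \<le> L * \<bar>y - y'\<bar>" "\<And>y y'. \<bar>U2 y - U2 y'\<bar> \<le> L * \<bar>y - y'\<bar>"
    and \<xi>: "continuous_on {0..1} \<xi>"
  shows "\<exists>x. continuous_on {0..1} x \<and>
    (\<forall>t\<in>{0..1}. set_integrable lborel {0..t} (\<lambda>s. U1 (x s) + s powr (2 * H - 1) * U2 (x s))) \<and>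
    (\<forall>t\<in>{0..1}. x t = \<xi> t + (LBINT s:{0..t}. U1 (x s) + s powr (2 * H - 1) * U2 (x s)))"
proof -
  have cU: "continuous_on UNIV U1" "continuous_on UNIV U2"
    using U L by (auto intro!: lipschitz_on_continuous_on[of L] lipschitz_onI simp: dist_real_def)
  define E where "E s = exp (2 * L * V s)" for s
  define \<phi> where "\<phi> y s = U1 (E s * y s) + s powr (2 * H - 1) * U2 (E s * y s)" for y :: "real \<Rightarrow> real" and s
  define I where "I y t = (LBINT s:{0..t}. \<phi> y s)" for y t
  \<comment> \<open>Functions on [0, 1] are extended to the line by constants, so that the fixed
    point can be sought among bounded continuous functions on the line, a complete space.\<close>
  define cl where "cl t = min 1 (max 0 t)" for t :: real
  have cl: "cl t \<in> {0..1}" "t \<in> {0..1} \<Longrightarrow> cl t = t" for t by (auto simp: cl_def)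
  define T where "T y t = (\<xi> (cl t) + I y (cl t)) / E (cl t)" for y t
  have cE: "continuous_on {0..t} E" for t unfolding E_def
    by (intro continuous_intros continuous_on_subset[OF continuous_on_V]) auto
  have E0: "E s > 0" for s by (simp add: E_def)
  have \<phi>i: "set_integrable lborel {0..t} (\<phi> y)" if "continuous_on {0..1} y" "t \<in> {0..1}" for y t
  proof -
    have "continuous_on {0..t} y" by (rule continuous_on_subset[OF that(1)]) (use that in auto)
    then have "continuous_on {0..t} (\<lambda>s. U1 (E s * y s))" "continuous_on {0..t} (\<lambda>s. U2 (E s * y s))"
      by (auto intro!: continuous_on_compose2[OF cU(1)] continuous_on_compose2[OF cU(2)] continuous_intros cE)
    then show ?thesis unfolding \<phi>_def by (rule weighted_integrable) (use that in auto)
  qed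
  have cI: "continuous_on {0..1} (I y)" if "continuous_on {0..1} y" for y
  proof -
    have c: "continuous_on {0..1} (\<lambda>t. integral {0..t} (\<phi> y))"
      by (rule indefinite_integral_continuous_1) (rule set_borel_integral_eq_integral(1)[OF \<phi>i[OF that]], simp)
    have e: "I y t = integral {0..t} (\<phi> y)" if "t \<in> {0..1}" for t
      unfolding I_def by (rule set_borel_integral_eq_integral(2)[OF \<phi>i[OF \<open>continuous_on {0..1} y\<close> that]])
    show ?thesis by (rule continuous_on_eq[OF c]) (rule e[symmetric])
  qed
  have Tb: "T y \<in> bcontfun" if "continuous_on {0..1} y" for y
  proof -
    let ?f = "\<lambda>t. (\<xi> t + I y t) / E t"
    have cf: "continuous_on {0..1} ?f"
      using E0 by (intro continuous_intros \<xi> cI that cE) (simp add: less_imp_neq[symmetric])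
    have "continuous_on UNIV cl" unfolding cl_def by (intro continuous_intros)
    then have "continuous_on UNIV (\<lambda>t. ?f (cl t))"
      by (rule continuous_on_compose2[OF cf]) (use cl in auto)
    moreover obtain K where "\<And>t. t \<in> {0..1} \<Longrightarrow> \<bar>?f t\<bar> \<le> K"
      using continuous_on_Icc_bounded[OF cf] by blast
    ultimately show ?thesis unfolding T_def[abs_def] using cl by (intro bcontfun_normI[of _ K]) auto
  qed
  have TT: "apply_bcontfun (Bcontfun (T (apply_bcontfun y))) = T (apply_bcontfun y)" for y
    by (rule Bcontfun_inverse[OF Tb]) simp
  have "\<exists>!y. Bcontfun (T (apply_bcontfun y)) = y"
  proof (rule banach_fix_type[where c = "1/2"])
    show "\<forall>y y'. dist (Bcontfun (T (apply_bcontfun y))) (Bcontfun (T (apply_bcontfun y'))) \<le> 1 / 2 * dist y y'"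
    proof (intro allI dist_bound)
      fix y y' :: "real \<Rightarrow>\<^sub>C real" and t
      define \<tau> where "\<tau> = cl t"
      have \<tau>: "\<tau> \<in> {0..1}" using cl by (simp add: \<tau>_def)
      define d where "d = dist y y'"
      have d: "\<bar>y s - y' s\<bar> \<le> d" for s using dist_bounded[of y s y'] by (simp add: d_def dist_real_def)
      have d0: "d \<ge> 0" by (simp add: d_def)
      have i: "set_integrable lborel {0..\<tau>} (\<phi> y)" "set_integrable lborel {0..\<tau>} (\<phi> y')"
        using \<phi>i[OF _ \<tau>] by auto
      note di = set_integral_diff[OF i]
      have ei: "set_integrable lborel {0..\<tau>} (\<lambda>s. d / 2 * ((1 + s powr (2 * H - 1)) * (2 * L * exp (2 * L * V s))))"
        by (intro set_integrable_mult_right exp_V_integral(1)) (use \<tau> L in auto)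
      have "\<bar>I y \<tau> - I y' \<tau>\<bar> \<le> (LBINT s:{0..\<tau>}. norm (\<phi> y s - \<phi> y' s))"
        unfolding I_def di(2)[symmetric] using set_integral_norm_bound[OF di(1)] by simp
      also have "\<dots> \<le> (LBINT s:{0..\<tau>}. d / 2 * ((1 + s powr (2 * H - 1)) * (2 * L * exp (2 * L * V s))))"
      proof (rule set_integral_mono[OF set_integrable_norm[OF di(1)] ei])
        fix s
        have "\<bar>E s * y s - E s * y' s\<bar> \<le> E s * d"
          using d[of s] E0[of s] by (simp add: right_diff_distrib[symmetric] abs_mult)
        then have b: "L * \<bar>E s * y s - E s * y' s\<bar> \<le> L * (E s * d)" using L by (intro mult_left_mono) auto
        have "\<phi> y s - \<phi> y' s = (U1 (E s * y s) - U1 (E s * y' s)) + s powr (2 * H - 1) * (U2 (E s * y s) - U2 (E s * y' s))"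
          by (simp add: \<phi>_def algebra_simps)
        also have "norm \<dots> \<le> \<bar>U1 (E s * y s) - U1 (E s * y' s)\<bar> + s powr (2 * H - 1) * \<bar>U2 (E s * y s) - U2 (E s * y' s)\<bar>"
          by (rule order_trans[OF norm_triangle_ineq]) (simp add: abs_mult)
        also have "\<dots> \<le> L * (E s * d) + s powr (2 * H - 1) * (L * (E s * d))"
          by (intro add_mono mult_left_mono order_trans[OF U(1) b] order_trans[OF U(2) b]) auto
        also have "\<dots> = d / 2 * ((1 + s powr (2 * H - 1)) * (2 * L * exp (2 * L * V s)))"
          by (simp add: E_def algebra_simps)
        finally show "norm (\<phi> y s - \<phi> y' s) \<le> d / 2 * ((1 + s powr (2 * H - 1)) * (2 * L * exp (2 * L * V s)))" .
      qed
      also have "\<dots> = d / 2 * (E \<tau> - 1)"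
        unfolding set_integral_mult_right using \<tau> L
        by (subst exp_V_integral(2)) (auto simp: E_def)
      also have "\<dots> \<le> d / 2 * E \<tau>" using d0 by (intro mult_left_mono) auto
      finally have "\<bar>I y \<tau> - I y' \<tau>\<bar> / E \<tau> \<le> d / 2" using E0[of \<tau>] by (simp add: divide_le_eq)
      moreover have "T y t - T y' t = (I y \<tau> - I y' \<tau>) / E \<tau>"
        by (simp add: T_def \<tau>_def diff_divide_distrib[symmetric])
      ultimately show "dist (apply_bcontfun (Bcontfun (T (apply_bcontfun y))) t)
          (apply_bcontfun (Bcontfun (T (apply_bcontfun y'))) t) \<le> 1 / 2 * dist y y'"
        using E0[of \<tau>] unfolding TT by (simp add: dist_real_def d_def abs_divide)
    qed
  qed auto
  then obtain y where "Bcontfun (T (apply_bcontfun y)) = y" by blast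
  then have y: "T (apply_bcontfun y) = apply_bcontfun y" using TT[of y] by simp
  define x where "x s = E s * y s" for s
  have \<phi>x: "\<phi> y s = U1 (x s) + s powr (2 * H - 1) * U2 (x s)" for s by (simp add: \<phi>_def x_def)
  show ?thesis
  proof (intro exI[of _ x] conjI ballI)
    show "continuous_on {0..1} x" unfolding x_def by (intro continuous_intros cE) auto
    fix t :: real assume t: "t \<in> {0..1}"
    show "set_integrable lborel {0..t} (\<lambda>s. U1 (x s) + s powr (2 * H - 1) * U2 (x s))"
      using \<phi>i[of y, OF _ t] unfolding \<phi>x[symmetric] by auto
    have "x t = E t * T y t" by (simp add: x_def y)
    also have "\<dots> = \<xi> t + I y t" using cl(2)[OF t] E0[of t] by (simp add: T_def)
    finally show "x t = \<xi> t + (LBINT s:{0..t}. U1 (x s) + s powr (2 * H - 1) * U2 (x s))"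
      unfolding I_def \<phi>x .
  qed
qed

lemma clipped_lipschitz:
  assumes f: "\<And>y. 0 < y \<Longrightarrow> (f has_real_derivative f' y) (at y)" and f': "continuous_on {0<..} f'"
    and m: "0 < m" "m \<le> M"
  shows "\<exists>L>0. \<forall>y y' :: real. \<bar>f (max m (min M y)) - f (max m (min M y'))\<bar> \<le> L * \<bar>y - y'\<bar>"
proof -
  have "continuous_on {m..M} f'" by (rule continuous_on_subset[OF f']) (use m in auto)
  then obtain K where K: "\<And>y. y \<in> {m..M} \<Longrightarrow> \<bar>f' y\<bar> \<le> K"
    using continuous_on_Icc_bounded by blast
  have lt: "\<bar>f b - f a\<bar> \<le> (\<bar>K\<bar> + 1) * \<bar>b - a\<bar>" if ab: "a \<in> {m..M}" "b \<in> {m..M}" "a < b" for a b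
  proof -
    obtain z where z: "a < z" "z < b" "f b - f a = (b - a) * f' z"
      using MVT2[OF ab(3), of f f'] f m ab by auto
    have "\<bar>f' z\<bar> \<le> \<bar>K\<bar> + 1" using K[of z] z ab by auto
    then show ?thesis unfolding z(3) abs_mult using mult_right_mono[of "\<bar>f' z\<bar>" "\<bar>K\<bar> + 1" "\<bar>b - a\<bar>"]
      by (simp add: mult.commute)
  qed
  show ?thesis
  proof (intro exI[of _ "\<bar>K\<bar> + 1"] conjI allI)
    fix y y' :: real
    let ?c = "\<lambda>y. max m (min M y)"
    have c: "?c y \<in> {m..M}" for y using m by auto
    have "\<bar>f (?c y) - f (?c y')\<bar> \<le> (\<bar>K\<bar> + 1) * \<bar>?c y - ?c y'\<bar>"
      using lt[OF c c, of y y'] lt[OF c c, of y' y]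
      by (cases "?c y" "?c y'" rule: linorder_cases) (auto simp: abs_minus_commute)
    also have "\<dots> \<le> (\<bar>K\<bar> + 1) * \<bar>y - y'\<bar>" by (intro mult_left_mono) auto
    finally show "\<bar>f (?c y) - f (?c y')\<bar> \<le> (\<bar>K\<bar> + 1) * \<bar>y - y'\<bar>" .
  qed simp
qed

text \<open>A fall from \<open>2 * \<epsilon>\<close> to \<open>\<epsilon>\<close> during a time
  \<open>\<Delta>\<close> must be caused by noise of size at most
  \<open>A * \<Delta> powr \<gamma>\<close>, against a drift of size at least
  \<open>c' * \<epsilon> powr (- p)\<close>. Eliminating \<open>\<Delta>\<close> bounds
  \<epsilon>^(-\<kappa>) with \<kappa> = \<gamma> (p + 1) - 1 > 0, which is impossible for small
  \<open>\<epsilon>\<close>. Thus the clamp is never reached from inside.\<close>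

lemma path_solution_exists:
  assumes \<gamma>: "0 < \<gamma>" "\<gamma> < 1" "1 < \<gamma> * (p + 1)" and \<sigma>: "0 < \<sigma>" and x0: "0 < x0"
    and \<beta>: "continuous_on {0..1} \<beta>" "\<beta> 0 = 0"
    and G: "\<And>s t. s \<in> {0..1} \<Longrightarrow> t \<in> {0..1} \<Longrightarrow> \<bar>\<beta> t - \<beta> s\<bar> \<le> G * \<bar>t - s\<bar> powr \<gamma>"
  obtains x where "path_solution b \<sigma> x0 \<beta> x"
proof -
  have "0 \<le> G" using G[of 0 1] by (simp add: order_trans[OF abs_ge_zero])
  \<comment> \<open>The summand 1 keeps \<open>A\<close> positive even when \<open>G\<close> is 0,
    as happens for the zero path to which this lemma is also applied.\<close>
  define A where "A = \<sigma> * (G + 1)"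
  have A: "0 < A" using \<sigma> \<open>0 \<le> G\<close> by (simp add: A_def)
  have \<sigma>\<beta>: "\<bar>\<sigma> * \<beta> t - \<sigma> * \<beta> s\<bar> \<le> A * (t - s) powr \<gamma>" if "0 \<le> s" "s \<le> t" "t \<le> 1" for s t
  proof -
    have "\<bar>\<sigma> * \<beta> t - \<sigma> * \<beta> s\<bar> = \<sigma> * \<bar>\<beta> t - \<beta> s\<bar>" using \<sigma> by (simp add: right_diff_distrib[symmetric] abs_mult)
    also have "\<dots> \<le> \<sigma> * ((G + 1) * \<bar>t - s\<bar> powr \<gamma>)"
      using \<sigma> that by (intro mult_left_mono order_trans[OF G] mult_right_mono) auto
    finally show ?thesis using that by (simp add: A_def)
  qed
  \<comment> \<open>After the last time at or below \<open>1 + x0\<close> the drift contributes at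
    most \<open>C * V 1\<close> and the noise at most \<open>A\<close>.\<close>
  define R where "R = 1 + x0 + C * V 1 + A"
  have R: "0 < R" unfolding R_def using x0 C V_nonneg[of 1] A by (simp add: add_pos_nonneg)
  define \<kappa> where "\<kappa> = \<gamma> * (p + 1) - 1"
  \<comment> \<open>The factor turns \<open>c * (2 * \<epsilon>) powr (- p)\<close>, the weakest
    repulsion below the level \<open>2 * \<epsilon>\<close>, into a multiple of
    \<open>\<epsilon> powr (- p)\<close>.\<close>
  define c' where "c' = c * 2 powr (- p)"
  have c': "0 < c'" using pcy by (simp add: c'_def)
  \<comment> \<open>The halves of \<open>y0\<close> and \<open>x0\<close> put
    \<open>2 * \<epsilon>\<close> inside the range of \<open>lower\<close> and below the starting
    point; the last term gives A \<epsilon>^\<kappa> <= c'^\<gamma> / 2.\<close>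
  define \<epsilon> where "\<epsilon> = min (min (y0 / 2) (x0 / 2)) (min 1 ((c' powr \<gamma> / (2 * A)) powr (1 / \<kappa>)))"
  have \<kappa>: "0 < \<kappa>" using \<gamma> by (simp add: \<kappa>_def)
  have \<epsilon>: "0 < \<epsilon>" "2 * \<epsilon> \<le> y0" "2 * \<epsilon> \<le> x0" "\<epsilon> \<le> 1" using pcy x0 c' A by (auto simp: \<epsilon>_def)
  have A\<epsilon>: "A * \<epsilon> powr \<kappa> < c' powr \<gamma>"
  proof -
    have "\<epsilon> powr \<kappa> \<le> ((c' powr \<gamma> / (2 * A)) powr (1 / \<kappa>)) powr \<kappa>"
      using \<kappa> \<epsilon> by (intro powr_mono2) (linarith | simp add: \<epsilon>_def)+
    also have "\<dots> = c' powr \<gamma> / (2 * A)" using \<kappa> c' A by (simp add: powr_powr)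
    finally have "A * \<epsilon> powr \<kappa> \<le> A * (c' powr \<gamma> / (2 * A))" using A by (intro mult_left_mono) auto
    also have "\<dots> < c' powr \<gamma>" using A c' by simp
    finally show ?thesis .
  qed
  define M where "M = R + 1"
  \<comment> \<open>A hard clamp suffices here because the fixed point argument needs only Lipschitz
    continuity.\<close>
  let ?c = "\<lambda>y. max \<epsilon> (min M y)"
  have \<epsilon>M: "\<epsilon> \<le> M" "1 \<le> M" using \<epsilon> R by (auto simp: M_def)
  obtain L1 where L1: "0 < L1" "\<And>y y'. \<bar>u (?c y) - u (?c y')\<bar> \<le> L1 * \<bar>y - y'\<bar>"
    using clipped_lipschitz[OF du cont_u' \<epsilon>(1) \<epsilon>M(1)] by blast
  obtain L2 where L2: "0 < L2" "\<And>y y'. \<bar>v (?c y) - v (?c y')\<bar> \<le> L2 * \<bar>y - y'\<bar>"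
    using clipped_lipschitz[OF dv cont_v' \<epsilon>(1) \<epsilon>M(1)] by blast
  have "\<bar>u (?c y) - u (?c y')\<bar> \<le> (L1 + L2) * \<bar>y - y'\<bar>" "\<bar>v (?c y) - v (?c y')\<bar> \<le> (L1 + L2) * \<bar>y - y'\<bar>" for y y'
    using L1 L2 by (auto intro!: order_trans[OF L1(2)] order_trans[OF L2(2)] mult_right_mono)
  moreover have "0 < L1 + L2" using L1 L2 by simp
  moreover have "continuous_on {0..1} (\<lambda>t. x0 - \<sigma> * \<beta> t)" by (intro continuous_intros \<beta>)
  ultimately obtain x where xc: "continuous_on {0..1} x"
    and xi: "\<And>t. t \<in> {0..1} \<Longrightarrow> set_integrable lborel {0..t} (\<lambda>s. u (?c (x s)) + s powr (2 * H - 1) * v (?c (x s)))"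
    and xe: "\<And>t. t \<in> {0..1} \<Longrightarrow> x t = x0 - \<sigma> * \<beta> t + (LBINT s:{0..t}. u (?c (x s)) + s powr (2 * H - 1) * v (?c (x s)))"
    using Picard[of "L1 + L2" "\<lambda>y. u (?c y)" "\<lambda>y. v (?c y)" "\<lambda>t. x0 - \<sigma> * \<beta> t"] by blast
  let ?F = "\<lambda>s. u (?c (x s)) + s powr (2 * H - 1) * v (?c (x s))"
  have inc: "set_integrable lborel {a<..t} ?F" "x t - x a = (LBINT s:{a<..t}. ?F s) - (\<sigma> * \<beta> t - \<sigma> * \<beta> a)"
    if "0 \<le> a" "a \<le> t" "t \<le> 1" for a t
    using set_integral_Icc_diff[OF xi[of t], of a] xe[of t] xe[of a] that by auto
  have x0': "x 0 = x0"
  proof -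
    have "(LBINT s:{0..0}. ?F s) = 0"
      unfolding set_lebesgue_integral_def
      by (rule integral_eq_zero_AE, rule AE_mp[OF AE_lborel_singleton[of 0]]) (auto simp: indicator_def)
    then show ?thesis using xe[of 0] \<beta> by simp
  qed
  have xct: "continuous_on {0..t} x" if "t \<in> {0..1}" for t
    by (rule continuous_on_subset[OF xc]) (use that in auto)
  have up: "x t \<le> R" if t: "t \<in> {0..1}" for t
  proof -
    obtain \<tau> where \<tau>: "\<tau> \<in> {0..t}" "x \<tau> \<le> 1 + x0" "\<And>s. \<tau> < s \<Longrightarrow> s \<le> t \<Longrightarrow> 1 + x0 < x s"
      by (rule last_exit[OF xct[OF t], of "1 + x0"]) (use t x0' in auto)
    have i: "0 \<le> \<tau>" "\<tau> \<le> t" "t \<le> 1" using \<tau> t by auto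
    have "(LBINT s:{\<tau><..t}. ?F s) \<le> (LBINT s:{\<tau><..t}. C + s powr (2 * H - 1) * C)"
    proof (rule set_integral_mono[OF inc(1)[OF i] const_integral(1)[OF i(1,2)]])
      fix s assume "s \<in> {\<tau><..t}"
      then have "1 \<le> ?c (x s)" using \<tau>(3)[of s] \<epsilon>M x0 by auto
      then show "?F s \<le> C + s powr (2 * H - 1) * C"
        by (intro add_mono mult_left_mono upper) auto
    qed
    also have "\<dots> = C * (V t - V \<tau>)"
      unfolding const_integral(2)[OF i(1,2)] by (simp add: V_def algebra_simps)
    also have "\<dots> \<le> C * V 1" using C V_mono[of t 1] V_nonneg[of \<tau>] i by (intro mult_left_mono) auto
    finally have "(LBINT s:{\<tau><..t}. ?F s) \<le> C * V 1" .
    moreover have "(t - \<tau>) powr \<gamma> \<le> 1 powr \<gamma>" using i \<gamma> by (intro powr_mono2) auto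
    then have "A * (t - \<tau>) powr \<gamma> \<le> A * 1" using A by (intro mult_left_mono) auto
    ultimately show ?thesis using inc(2)[OF i] \<sigma>\<beta>[OF i] \<tau>(2) unfolding R_def by (auto simp: abs_le_iff)
  qed
  have lo: "\<epsilon> < x t" if t: "t \<in> {0..1}" for t
  proof (rule ccontr)
    assume "\<not> \<epsilon> < x t"
    then have xt: "x t \<le> \<epsilon>" by simp
    \<comment> \<open>For the negated path this is the last time at which \<open>x\<close> is at
      least \<open>2 * \<epsilon>\<close>.\<close>
    obtain \<tau> where \<tau>: "\<tau> \<in> {0..t}" "- x \<tau> \<le> - 2 * \<epsilon>" "\<And>s. \<tau> < s \<Longrightarrow> s \<le> t \<Longrightarrow> - 2 * \<epsilon> < - x s"
      by (rule last_exit[OF continuous_on_minus[OF xct[OF t]], of "- 2 * \<epsilon>"]) (use t x0' \<epsilon> in auto)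
    have i: "0 \<le> \<tau>" "\<tau> \<le> t" "t \<le> 1" using \<tau> t by auto
    define \<Delta> where "\<Delta> = t - \<tau>"
    have \<Delta>: "\<Delta> > 0"
    proof -
      have "\<tau> \<noteq> t" using \<tau>(2) xt \<epsilon> by auto
      then show ?thesis using i by (simp add: \<Delta>_def)
    qed
    have "(LBINT s:{\<tau><..t}. c' * \<epsilon> powr (- p) + s powr (2 * H - 1) * 0) \<le> (LBINT s:{\<tau><..t}. ?F s)"
    proof (rule set_integral_mono[OF const_integral(1)[OF i(1,2)] inc(1)[OF i]])
      fix s assume s: "s \<in> {\<tau><..t}"
      \<comment> \<open>The path itself may already be below \<open>\<epsilon>\<close>, but its
        clamped value still lies between \<open>\<epsilon>\<close> and
        \<open>2 * \<epsilon>\<close>, so the repulsion keeps its strength.\<close>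
      have le: "0 < ?c (x s)" "?c (x s) \<le> 2 * \<epsilon>" using \<tau>(3)[of s] s \<epsilon> by auto
      have "c' * \<epsilon> powr (- p) = c * (2 * \<epsilon>) powr (- p)" using \<epsilon> by (simp add: c'_def powr_mult)
      also have "\<dots> \<le> c * ?c (x s) powr (- p)"
        using pcy le by (intro mult_left_mono powr_mono2') auto
      also have "\<dots> \<le> ?F s" by (rule lower) (use le \<epsilon> s i in auto)
      finally show "c' * \<epsilon> powr (- p) + s powr (2 * H - 1) * 0 \<le> ?F s" by simp
    qed
    then have "c' * \<epsilon> powr (- p) * \<Delta> \<le> (LBINT s:{\<tau><..t}. ?F s)"
      unfolding const_integral(2)[OF i(1,2)] by (simp add: \<Delta>_def mult.commute)
    then have main: "\<epsilon> + c' * \<epsilon> powr (- p) * \<Delta> \<le> A * \<Delta> powr \<gamma>"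
      using inc(2)[OF i] \<sigma>\<beta>[OF i] \<tau>(2) xt by (auto simp: abs_le_iff \<Delta>_def)
    define Q where "Q = A * \<Delta> powr \<gamma>"
    have pos: "0 < c' * \<epsilon> powr (- p) * \<Delta>" using c' \<epsilon> \<Delta> by simp
    have Q: "\<epsilon> \<le> Q" "c' * \<epsilon> powr (- p) * \<Delta> \<le> Q" using main pos \<epsilon> by (auto simp: Q_def)
    \<comment> \<open>Both summands on the left of \<open>main\<close> are at most \<open>Q\<close>;
      taking their geometric mean with weights 1 - \<gamma> and \<gamma> produces the factor
      \<open>\<Delta> powr \<gamma>\<close> on both sides, so \<open>\<Delta>\<close>
      cancels.\<close>
    have "\<epsilon> powr (1 - \<gamma>) * (c' * \<epsilon> powr (- p) * \<Delta>) powr \<gamma> \<le> Q powr (1 - \<gamma>) * Q powr \<gamma>"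
      using Q \<epsilon> pos \<gamma> by (intro mult_mono powr_mono2) auto
    also have "\<dots> = Q" using Q \<epsilon> by (simp add: powr_add[symmetric])
    finally have "\<epsilon> powr (1 - \<gamma>) * (c' powr \<gamma> * \<epsilon> powr (- p * \<gamma>)) * \<Delta> powr \<gamma> \<le> A * \<Delta> powr \<gamma>"
      using c' \<epsilon> \<Delta> by (simp add: Q_def powr_mult powr_powr mult_ac)
    then have "\<epsilon> powr (1 - \<gamma>) * (c' powr \<gamma> * \<epsilon> powr (- p * \<gamma>)) \<le> A"
      using \<Delta> by (simp add: mult_le_cancel_right)
    then have "\<epsilon> powr \<kappa> * (\<epsilon> powr (1 - \<gamma>) * (c' powr \<gamma> * \<epsilon> powr (- p * \<gamma>))) \<le> \<epsilon> powr \<kappa> * A"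
      by (intro mult_left_mono) auto
    also have "\<epsilon> powr \<kappa> * (\<epsilon> powr (1 - \<gamma>) * (c' powr \<gamma> * \<epsilon> powr (- p * \<gamma>)))
        = c' powr \<gamma> * (\<epsilon> powr \<kappa> * \<epsilon> powr (1 - \<gamma>) * \<epsilon> powr (- p * \<gamma>))" by (simp add: mult_ac)
    also have "\<epsilon> powr \<kappa> * \<epsilon> powr (1 - \<gamma>) * \<epsilon> powr (- p * \<gamma>) = \<epsilon> powr 0"
      unfolding powr_add[symmetric] by (simp add: \<kappa>_def algebra_simps)
    finally show False using A\<epsilon> \<epsilon> by (simp add: mult.commute)
  qed
  have cx: "?c (x s) = x s" if "s \<in> {0..1}" for s
    using up[OF that] lo[OF that] by (simp add: M_def)
  have "path_solution b \<sigma> x0 \<beta> x"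
    unfolding path_solution_def
  proof (intro conjI ballI xc)
    fix t :: real assume t: "t \<in> {0..1}"
    show "0 < x t" using lo[OF t] \<epsilon> by simp
    have eq: "b s (x s) = ?F s" if "s \<in> {0..t}" for s
      using cx[of s] that t by (simp add: b_def)
    have "set_integrable lborel {0..t} (\<lambda>s. b s (x s)) = set_integrable lborel {0..t} ?F"
      by (rule set_integrable_cong) (use eq in auto)
    then show "set_integrable lborel {0..t} (\<lambda>s. b s (x s))" using xi[OF t] by simp
    have "(LBINT s:{0..t}. b s (x s)) = (LBINT s:{0..t}. ?F s)"
      by (rule set_lebesgue_integral_cong) (use eq in auto)
    then show "x t = x0 + (LBINT s:{0..t}. b s (x s)) - \<sigma> * \<beta> t" using xe[OF t] by simp
  qed
  then show ?thesis by (rule that)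
qed

end

text \<open>H < 1/2 and \<open>1 < H * (p + 1)\<close> force p > 1. Hence y^(-p) dominates 1/y near
  0, which makes \<open>v'\<close> bounded above although the 1/y term enters the drift with the
  wrong sign, and which yields the repulsion in \<open>lower\<close>.\<close>

lemma drift_singular_drift:
  fixes H \<theta> \<rho> \<sigma> am1 a0 a1 a2 :: real
  assumes H: "0 < H" "H < 1/2" and \<theta>: "\<theta> > 0" and \<rho>: "\<rho> > 1 + 1 / (H * \<theta>)" and \<sigma>: "\<sigma> > 0"
    and pos: "am1 > 0" "a0 > 0" "a1 > 0" "a2 > 0"
  shows "\<exists>u v u' v' C p c y0. singular_drift u v u' v' H C p c y0 \<and> 1 < H * (p + 1) \<and>
    drift H \<theta> \<rho> \<sigma> am1 a0 a1 a2 = singular_drift.b u v H"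
proof -
  define A B D where "A = am1 * \<theta>" and "B = a0" and "D = a1 / \<theta>"
  define k2 k3 where "k2 = a2 / \<theta> powr \<rho>" and "k3 = \<sigma> * H * (\<theta> + 1)"
  define p where "p = \<theta> * \<rho> - \<theta> - 1"
  have ABD: "A > 0" "B > 0" "D > 0" using pos \<theta> by (auto simp: A_def B_def D_def)
  have k: "k2 > 0" "k3 > 0" using pos \<theta> \<sigma> H by (auto simp: k2_def k3_def)
  have Hp: "1 < H * (p + 1)"
  proof -
    have "1 / (H * \<theta>) < \<rho> - 1" using \<rho> by simp
    then have "1 < (\<rho> - 1) * (H * \<theta>)" using H \<theta> by (simp add: pos_divide_less_eq)
    then show ?thesis by (simp add: p_def algebra_simps)
  qed
  have p: "p > 1"
  proof -
    have "1 < H * (p + 1)" by (rule Hp)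
    moreover have "H * (p + 1) \<le> 1/2 * (p + 1)" if "p + 1 \<ge> 0" using H that by (intro mult_right_mono) auto
    moreover have "H * (p + 1) \<le> 0" if "p + 1 \<le> 0" using H that by (simp add: mult_nonneg_nonpos)
    ultimately show ?thesis by (cases "p + 1 \<ge> 0") auto
  qed
  define u where "u y = - A * y powr (2 * \<theta> + 1) + B * y powr (\<theta> + 1) - D * y" for y :: real
  define v where "v y = k2 * y powr (- p) - k3 * (1 / y)" for y :: real
  define u' where "u' y = - A * (2 * \<theta> + 1) * y powr (2 * \<theta>) + B * (\<theta> + 1) * y powr \<theta> - D" for y :: real
  define v' where "v' y = k2 * (- p) * y powr (- p - 1) + k3 * y powr (-2)" for y :: real
  \<comment> \<open>Maximum of the concave quadratic - A (2 \<theta> + 1) z^2 + B (\<theta> + 1) z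
    in z = y^\<theta>.\<close>
  define Cu' where "Cu' = (B * (\<theta> + 1))\<^sup>2 / (4 * (A * (2 * \<theta> + 1)))"
  \<comment> \<open>The point where the two terms of \<open>v'\<close> cancel: below it
    \<open>v'\<close> is nonpositive, above it the positive term is at most
    \<open>Cv'\<close>.\<close>
  define y1 where "y1 = (p * k2 / k3) powr (1 / (p - 1))"
  define Cv' where "Cv' = k3 * y1 powr (-2)"
  \<comment> \<open>For y >= 1 the function \<open>u\<close> can be positive only while y^\<theta>
    is below B / A; there y^(\<theta> + 1) is at most (B / A)^(1/\<theta> + 1).\<close>
  define Cu where "Cu = B * (B / A) powr (1 / \<theta> + 1)"
  define C where "C = Cu' + Cv' + Cu + k2 + 1"
  have C: "0 \<le> Cu'" "0 \<le> Cv'" "0 \<le> Cu" using ABD k \<theta> by (auto simp: Cu'_def Cv'_def Cu_def)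
  \<comment> \<open>Of the coefficient \<open>k2\<close> half is spent on the term k3 / y and a
    quarter on the bounded part \<open>A + D\<close> of \<open>u\<close>; the remaining quarter is
    the constant \<open>c\<close> of the locale.\<close>
  define y0 where "y0 = min 1 (min ((k2 / (2 * k3)) powr (1 / (p - 1))) ((k2 / (4 * (A + D))) powr (1 / p)))"
  have "singular_drift u v u' v' H C p (k2 / 4) y0"
  proof
    show "0 < H" "H < 1/2" by (rule H)+
    show "0 < C" using C k by (simp add: C_def)
    show "0 < k2 / 4" using k by simp
    show "0 < p" using p by simp
    show "0 < y0" using k p ABD by (auto simp: y0_def)
    fix y :: real
    show "(u has_real_derivative u' y) (at y)" if "0 < y"
    proof -
      have "(u has_real_derivative - A * ((2 * \<theta> + 1) * y powr (2 * \<theta> + 1 - 1))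
          + B * ((\<theta> + 1) * y powr (\<theta> + 1 - 1)) - D * 1) (at y)"
        unfolding u_def[abs_def] using that
        by (intro DERIV_diff DERIV_add DERIV_cmult DERIV_ident has_real_derivative_powr) auto
      then show ?thesis by (rule DERIV_cong) (simp add: u'_def)
    qed
    show "(v has_real_derivative v' y) (at y)" if y: "0 < y"
    proof -
      have "(v has_real_derivative k2 * (- p * y powr (- p - 1)) - k3 * (- 1 / y\<^sup>2)) (at y)"
        unfolding v_def[abs_def] using y
        by (intro DERIV_diff DERIV_cmult) (auto intro!: derivative_eq_intros simp: powr_diff power2_eq_square)
      moreover have "y powr (-2) = 1 / y\<^sup>2" using y by (simp add: powr_minus powr_numeral divide_inverse)
      ultimately show ?thesis unfolding v'_def by (simp add: algebra_simps)
    qed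
    show "continuous_on {0<..} u'" "continuous_on {0<..} v'"
      unfolding u'_def v'_def by (auto intro!: continuous_intros)
    show "u' y \<le> C" if "0 < y"
    proof -
      define z where "z = y powr \<theta>"
      have zz: "y powr (2 * \<theta>) = z * z" by (simp add: z_def powr_add[symmetric])
      have "- \<alpha> * (z * z) + \<beta> * z \<le> \<beta>\<^sup>2 / (4 * \<alpha>)" if "\<alpha> > 0" for \<alpha> \<beta> :: real
      proof -
        have "0 \<le> (2 * \<alpha> * z - \<beta>)\<^sup>2 / (4 * \<alpha>)" using that by simp
        also have "(2 * \<alpha> * z - \<beta>)\<^sup>2 / (4 * \<alpha>) = \<alpha> * (z * z) - \<beta> * z + \<beta>\<^sup>2 / (4 * \<alpha>)"
          using that by (simp add: power2_eq_square field_simps)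
        finally show ?thesis by simp
      qed
      from this[of "A * (2 * \<theta> + 1)" "B * (\<theta> + 1)"] have "u' y \<le> Cu' - D"
        using ABD \<theta> unfolding u'_def zz z_def[symmetric] by (simp add: Cu'_def)
      then show ?thesis using C k ABD by (simp add: C_def)
    qed
    show "v' y \<le> C" if y: "0 < y"
    proof -
      have y1: "y1 > 0" using k p by (simp add: y1_def)
      have pw: "y powr (- p - 1) * y powr (p - 1) = y powr (-2)" by (simp add: powr_add[symmetric])
      have "v' y \<le> Cv'"
      proof (cases "y \<le> y1")
        case True
        have "y powr (p - 1) \<le> y1 powr (p - 1)" using True y p by (intro powr_mono2) auto
        also have "\<dots> = p * k2 / k3" using p k by (simp add: y1_def powr_powr)
        finally have "k3 * y powr (p - 1) \<le> p * k2" using k by (simp add: field_simps)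
        then have "y powr (- p - 1) * (k3 * y powr (p - 1)) \<le> y powr (- p - 1) * (p * k2)"
          by (intro mult_left_mono) auto
        moreover have "y powr (- p - 1) * (k3 * y powr (p - 1)) = k3 * y powr (-2)"
          using pw by (simp add: mult_ac)
        ultimately have "k3 * y powr (-2) \<le> y powr (- p - 1) * (p * k2)" by linarith
        then show ?thesis using C by (simp add: v'_def mult_ac)
      next
        case False
        have "y powr (-2) \<le> y1 powr (-2)" using False y1 by (intro powr_mono2') auto
        then have "k3 * y powr (-2) \<le> Cv'" unfolding Cv'_def using k by (intro mult_left_mono) auto
        moreover have "0 \<le> k2 * p * y powr (- p - 1)" using k p by simp
        ultimately show ?thesis by (simp add: v'_def)
      qed
      then show ?thesis using C k by (simp add: C_def)
    qed
    show "u y \<le> C" if y: "1 \<le> y"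
    proof -
      define z where "z = y powr \<theta>"
      have z: "z > 0" using y by (simp add: z_def)
      have e: "y powr (2 * \<theta> + 1) = y * (z * z)" "y powr (\<theta> + 1) = y * z"
      proof -
        have "y powr (2 * \<theta>) = z * z" by (simp add: z_def powr_add[symmetric])
        then show "y powr (2 * \<theta> + 1) = y * (z * z)" using y by (simp add: powr_add)
        show "y powr (\<theta> + 1) = y * z" using y by (simp add: z_def powr_add)
      qed
      have "u y \<le> Cu"
      proof (cases "B \<le> A * z")
        case True
        have "u y = - ((y * z) * (A * z - B)) - D * y" unfolding u_def e by (simp add: algebra_simps)
        moreover have "0 \<le> (y * z) * (A * z - B)" using True y z by simp
        moreover have "0 \<le> D * y" using ABD y by simp
        ultimately show ?thesis using C by linarith
      next
        case False
        then have zB: "z \<le> B / A" using ABD by (simp add: field_simps)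
        have "y = z powr (1 / \<theta>)" using y \<theta> by (simp add: z_def powr_powr)
        then have yz: "y * z = z powr (1 / \<theta> + 1)" using z by (simp add: powr_add)
        have "z powr (1 / \<theta> + 1) \<le> (B / A) powr (1 / \<theta> + 1)"
          using zB z \<theta> by (intro powr_mono2) auto
        then have "B * (y * z) \<le> Cu" unfolding yz Cu_def using ABD by (intro mult_left_mono) auto
        moreover have "0 \<le> A * (y * (z * z))" "0 \<le> D * y" using ABD y z by auto
        ultimately show ?thesis unfolding u_def e by linarith
      qed
      then show ?thesis using C k by (simp add: C_def)
    qed
    show "v y \<le> C" if y: "1 \<le> y"
    proof -
      have "y powr (- p) \<le> 1 powr (- p)" using y p by (intro powr_mono2') auto
      then have "k2 * y powr (- p) \<le> k2 * 1" using k by (intro mult_left_mono) auto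
      moreover have "0 \<le> k3 * (1 / y)" using k y by simp
      ultimately show ?thesis using C unfolding v_def C_def by linarith
    qed
    show "k2 / 4 * y powr (- p) \<le> u y + s powr (2 * H - 1) * v y"
      if y: "0 < y" "y \<le> y0" and s: "0 < s" "s \<le> 1" for s
    proof -
      have y1: "y \<le> 1" using y by (simp add: y0_def)
      have "y powr (p - 1) \<le> ((k2 / (2 * k3)) powr (1 / (p - 1))) powr (p - 1)"
        using y p by (intro powr_mono2) (auto simp: y0_def)
      also have "\<dots> = k2 / (2 * k3)" using p k by (simp add: powr_powr)
      finally have "k3 * y powr (p - 1) \<le> k2 / 2" using k by (simp add: field_simps)
      then have "y powr (- p) * (k3 * y powr (p - 1)) \<le> y powr (- p) * (k2 / 2)"
        by (intro mult_left_mono) auto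
      moreover have "y powr (- p) * y powr (p - 1) = y powr (-1)" by (simp add: powr_add[symmetric])
      then have "y powr (- p) * y powr (p - 1) = 1 / y" using y by (simp add: powr_minus divide_inverse)
      then have "y powr (- p) * (k3 * y powr (p - 1)) = k3 * (1 / y)" by (simp add: mult_ac)
      ultimately have "k3 * (1 / y) \<le> y powr (- p) * (k2 / 2)" by linarith
      then have v: "k2 / 2 * y powr (- p) \<le> v y" by (simp add: v_def mult_ac)
      \<comment> \<open>The exponent is negative and s <= 1, so the weight can only strengthen the
        nonnegative \<open>v y\<close>; this makes the repulsion uniform in time.\<close>
      have "1 \<le> s powr (2 * H - 1)"
        using powr_mono2'[of "2 * H - 1" s 1] s H by simp
      moreover have "0 \<le> v y" using v k by (intro order_trans[OF _ v]) auto
      ultimately have sv: "v y \<le> s powr (2 * H - 1) * v y"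
        using mult_right_mono[of 1 "s powr (2 * H - 1)" "v y"] by simp
      have "y powr p \<le> ((k2 / (4 * (A + D))) powr (1 / p)) powr p"
        using y p by (intro powr_mono2) (auto simp: y0_def)
      also have "\<dots> = k2 / (4 * (A + D))" using p k ABD by (simp add: powr_powr)
      finally have "(A + D) * y powr p \<le> k2 / 4" using ABD by (simp add: field_simps)
      then have "y powr (- p) * ((A + D) * y powr p) \<le> y powr (- p) * (k2 / 4)"
        by (intro mult_left_mono) auto
      moreover have "y powr (- p) * y powr p = 1" using y by (simp add: powr_add[symmetric])
      then have "y powr (- p) * ((A + D) * y powr p) = A + D" by (simp add: mult_ac)
      ultimately have "A + D \<le> y powr (- p) * (k2 / 4)" by linarith
      then have AD: "A + D \<le> k2 / 4 * y powr (- p)" by (simp add: mult_ac)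
      have "y powr (2 * \<theta> + 1) \<le> 1 powr (2 * \<theta> + 1)" using y y1 \<theta> by (intro powr_mono2) auto
      then have "A * y powr (2 * \<theta> + 1) \<le> A * 1" using ABD by (intro mult_left_mono) auto
      moreover have "D * y \<le> D * 1" using ABD y1 by (intro mult_left_mono) auto
      moreover have "0 \<le> B * y powr (\<theta> + 1)" using ABD by simp
      ultimately have "- (A + D) \<le> u y" unfolding u_def by linarith
      then show ?thesis using v sv AD by linarith
    qed
    fix n f and a :: real
    assume f: "elem_fun n f" and a: "0 < a" "\<And>w. a \<le> f w"
    show "elem_fun n (\<lambda>w. u (f w))"
      unfolding u_def by (intro elem_diff elem_add elem_mult elem_const elem_powr[OF f a] f)
    have "1 / f w = f w powr (-1)" for w
      using a(1) a(2)[of w] by (simp add: powr_minus divide_inverse)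
    then show "elem_fun n (\<lambda>w. v (f w))"
      unfolding v_def by (simp only:) (intro elem_diff elem_add elem_mult elem_const elem_powr[OF f a] f)
  qed
  moreover from this have "drift H \<theta> \<rho> \<sigma> am1 a0 a1 a2 = singular_drift.b u v H"
    by (intro ext) (simp add: singular_drift.b_def drift_def u_def v_def A_def B_def D_def k2_def k3_def p_def algebra_simps)
  ultimately show ?thesis using Hp by blast
qed

section \<open>Hoelder continuity of fractional Brownian motion\<close>

text \<open>Deterministic half of the Kolmogorov continuity argument: each point is reached along
  its lower dyadic approximations, and the increments met on the way form a geometric series with
  ratio \<open>2 powr (- \<gamma>)\<close>.\<close>

lemma dyadic_holder:
  fixes \<beta> :: "real \<Rightarrow> real"
  assumes c: "continuous_on {0..1} \<beta>" and A: "0 \<le> A" and \<gamma>: "0 < \<gamma>"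
    and inc: "\<And>n k. k < 2 ^ n \<Longrightarrow> \<bar>\<beta> (real (Suc k) / 2 ^ n) - \<beta> (real k / 2 ^ n)\<bar> \<le> A * (2 powr (- \<gamma>)) ^ n"
    and st: "s \<in> {0..1}" "t \<in> {0..1}"
  shows "\<bar>\<beta> t - \<beta> s\<bar> \<le> 2 powr \<gamma> * (1 + 2 / (1 - 2 powr (- \<gamma>))) * A * \<bar>t - s\<bar> powr \<gamma>"
proof -
  define q where "q = 2 powr (- \<gamma>)"
  have q: "0 < q" "q < 1" using \<gamma> powr_less_mono[of "- \<gamma>" 0 2] by (auto simp: q_def)
  define f where "f j s = nat \<lfloor>2 ^ j * s\<rfloor>" for j :: nat and s :: real
  define d where "d j s = real (f j s) / 2 ^ j" for j s
  have fr: "real (f j s) \<le> 2 ^ j * s" "2 ^ j * s < real (f j s) + 1" if "0 \<le> s" for j s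
    using that unfolding f_def by (auto simp: of_nat_nat)
  have ds: "d j s \<le> s" "s < d j s + 1 / 2 ^ j" "0 \<le> d j s" if "0 \<le> s" for j s
    using fr[OF that, of j] by (auto simp: d_def field_simps)
  have f2: "f (Suc j) s = 2 * f j s \<or> f (Suc j) s = Suc (2 * f j s)" if "0 \<le> s" for j s
  proof -
    have "real (f (Suc j) s) < 2 * (real (f j s) + 1)" "2 * real (f j s) < real (f (Suc j) s) + 1"
      using fr[OF that, of j] fr[OF that, of "Suc j"] by auto
    then have "real (f (Suc j) s) < real (2 * f j s + 2)" "real (2 * f j s) < real (f (Suc j) s + 1)"
      by simp_all
    then have "f (Suc j) s < 2 * f j s + 2" "2 * f j s < f (Suc j) s + 1"
      by (simp_all only: of_nat_less_iff)
    then show ?thesis by linarith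
  qed
  have adj: "\<bar>\<beta> (d (Suc j) s) - \<beta> (d j s)\<bar> \<le> A * q ^ Suc j" if s: "s \<in> {0..1}" for j s
  proof -
    have s0: "0 \<le> s" using s by simp
    have dj: "d j s = real (2 * f j s) / 2 ^ Suc j" by (simp add: d_def)
    from f2[OF s0, of j] show ?thesis
    proof
      assume "f (Suc j) s = 2 * f j s"
      then have "d (Suc j) s = d j s" unfolding dj by (simp add: d_def)
      then show ?thesis using A q by simp
    next
      assume e: "f (Suc j) s = Suc (2 * f j s)"
      have "real (f (Suc j) s) \<le> 2 ^ Suc j * 1"
        using fr(1)[OF s0, of "Suc j"] s by (meson atLeastAtMost_iff mult_left_mono order_trans zero_le_numeral zero_le_power)
      then have "f (Suc j) s \<le> 2 ^ Suc j" by (metis mult.right_neutral of_nat_le_iff of_nat_numeral of_nat_power)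
      then have "2 * f j s < 2 ^ Suc j" using e by simp
      from inc[OF this] show ?thesis unfolding dj by (simp add: d_def e q_def)
    qed
  qed
  have appr: "\<bar>\<beta> s - \<beta> (d n s)\<bar> \<le> A * q ^ n / (1 - q)" if s: "s \<in> {0..1}" for n s
  proof -
    have s0: "0 \<le> s" using s by simp
    have 1: "\<bar>\<beta> (d (n + m) s) - \<beta> (d n s)\<bar> \<le> A * q ^ n * (\<Sum>i<m. q ^ Suc i)" for m
    proof (induction m)
      case (Suc m)
      have "\<bar>\<beta> (d (n + Suc m) s) - \<beta> (d n s)\<bar> \<le> A * q ^ Suc (n + m) + \<bar>\<beta> (d (n + m) s) - \<beta> (d n s)\<bar>"
        using adj[OF s, of "n + m"] by simp
      then show ?case using Suc by (simp add: algebra_simps power_add)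
    qed simp
    have "(\<Sum>i<m. q ^ Suc i) \<le> 1 / (1 - q)" for m
    proof -
      have "(\<Sum>i<m. q ^ Suc i) \<le> (\<Sum>i<m. q ^ i)"
        using q by (intro sum_mono) (simp add: mult_left_le_one_le)
      also have "\<dots> \<le> 1 / (1 - q)"
        using q by (simp add: sum_gp_strict divide_right_mono)
      finally show ?thesis .
    qed
    then have 2: "A * q ^ n * (\<Sum>i<m. q ^ Suc i) \<le> A * q ^ n * (1 / (1 - q))" for m
      using A q by (intro mult_left_mono) auto
    have b: "\<bar>\<beta> (d (n + m) s) - \<beta> (d n s)\<bar> \<le> A * q ^ n / (1 - q)" for m
      using order_trans[OF 1 2, of m] by simp
    have "(\<lambda>m. d (n + m) s) \<longlonglongrightarrow> s"
    proof (rule real_tendsto_sandwich)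
      show "\<forall>\<^sub>F m in sequentially. s - (1 / 2) ^ m \<le> d (n + m) s"
      proof (rule always_eventually, rule allI)
        fix m
        have "1 / 2 ^ (n + m) \<le> (1 / 2 :: real) ^ m"
          by (simp add: power_one_over power_add field_simps)
        then show "s - (1 / 2) ^ m \<le> d (n + m) s" using ds(2)[OF s0, of "n + m"] by linarith
      qed
      show "\<forall>\<^sub>F m in sequentially. d (n + m) s \<le> s" using ds(1)[OF s0] by simp
      have "(\<lambda>m. s - (1 / 2) ^ m) \<longlonglongrightarrow> s - 0" by (intro tendsto_intros LIMSEQ_power_zero) simp
      then show "(\<lambda>m. s - (1 / 2) ^ m) \<longlonglongrightarrow> s" by simp
    qed simp
    then have "(\<lambda>m. \<beta> (d (n + m) s)) \<longlonglongrightarrow> \<beta> s"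
    proof (rule continuous_on_tendsto_compose[OF c _ s])
      have "d (n + m) s \<in> {0..1}" for m using s ds(1)[OF s0, of "n + m"] ds(3)[OF s0] by auto
      then show "\<forall>\<^sub>F m in sequentially. d (n + m) s \<in> {0..1}" by simp
    qed
    then have "(\<lambda>m. \<bar>\<beta> (d (n + m) s) - \<beta> (d n s)\<bar>) \<longlonglongrightarrow> \<bar>\<beta> s - \<beta> (d n s)\<bar>"
      by (intro tendsto_intros)
    then show ?thesis by (rule Lim_bounded[of _ _ 0]) (use b in auto)
  qed
  have main: "\<bar>\<beta> t - \<beta> s\<bar> \<le> 2 powr \<gamma> * (1 + 2 / (1 - q)) * A * (t - s) powr \<gamma>"
    if st: "0 \<le> s" "s < t" "t \<le> 1" for s t
  proof -
    \<comment> \<open>The first level finer than twice the gap. Its mesh is still at least the gap,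
      so the approximations of \<open>s\<close> and \<open>t\<close> coincide or are neighbours; the
      factor 2 becomes \<open>2 powr \<gamma>\<close> in the constant.\<close>
    define n where "n = (LEAST n. (1 / 2) ^ n < 2 * (t - s))"
    have ex: "\<exists>n. (1 / 2 :: real) ^ n < 2 * (t - s)"
      using real_arch_pow_inv[of "2 * (t - s)" "1/2"] st by auto
    have n1: "(1 / 2) ^ n < 2 * (t - s)" unfolding n_def by (rule LeastI_ex[OF ex])
    have n2: "t - s \<le> (1 / 2) ^ n"
    proof (cases n)
      case 0
      then show ?thesis using st by simp
    next
      case (Suc k)
      then have "k < n" by simp
      then have "\<not> (1 / 2) ^ k < 2 * (t - s)" unfolding n_def by (rule not_less_Least)
      then show ?thesis using Suc by simp
    qed
    have "2 ^ n * t \<le> 2 ^ n * s + 1"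
    proof -
      have "2 ^ n * (t - s) \<le> 2 ^ n * (1 / 2) ^ n" using n2 by (intro mult_left_mono) auto
      then show ?thesis by (simp add: power_mult_distrib[symmetric] algebra_simps)
    qed
    then have "real (f n t) < real (f n s) + 2" using fr[of s n] fr[of t n] st by linarith
    moreover have "2 ^ n * s < 2 ^ n * t" using st by simp
    then have "real (f n s) < real (f n t) + 1" using fr[of s n] fr[of t n] st by linarith
    ultimately have "f n t = f n s \<or> f n t = Suc (f n s)" by linarith
    then have mid: "\<bar>\<beta> (d n t) - \<beta> (d n s)\<bar> \<le> A * q ^ n"
    proof
      assume "f n t = f n s"
      then show ?thesis using A q by (simp add: d_def)
    next
      assume e: "f n t = Suc (f n s)"
      have "real (f n t) \<le> 2 ^ n * 1"
      proof -
        have "2 ^ n * t \<le> 2 ^ n * 1" using st by (intro mult_left_mono) auto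
        then show ?thesis using fr(1)[of t n] st by linarith
      qed
      then have "f n t \<le> 2 ^ n" by (metis mult.right_neutral of_nat_le_iff of_nat_numeral of_nat_power)
      then have "f n s < 2 ^ n" using e by simp
      from inc[OF this] show ?thesis by (simp add: d_def e q_def)
    qed
    have "\<bar>\<beta> t - \<beta> s\<bar> \<le> \<bar>\<beta> t - \<beta> (d n t)\<bar> + \<bar>\<beta> (d n t) - \<beta> (d n s)\<bar> + \<bar>\<beta> s - \<beta> (d n s)\<bar>" by linarith
    also have "\<dots> \<le> A * q ^ n / (1 - q) + A * q ^ n + A * q ^ n / (1 - q)"
      using st by (intro add_mono appr mid) auto
    also have "\<dots> = q ^ n * ((1 + 2 / (1 - q)) * A)" by (simp add: algebra_simps)
    also have "\<dots> \<le> (2 powr \<gamma> * (t - s) powr \<gamma>) * ((1 + 2 / (1 - q)) * A)"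
    proof (rule mult_right_mono)
      have "q ^ n = ((1 / 2) ^ n) powr \<gamma>"
        by (simp add: q_def powr_minus powr_power powr_powr power_one_over powr_divide
            powr_realpow[symmetric] inverse_eq_divide mult.commute)
      also have "\<dots> \<le> (2 * (t - s)) powr \<gamma>" using n1 \<gamma> by (intro powr_mono2) auto
      also have "\<dots> = 2 powr \<gamma> * (t - s) powr \<gamma>" by (rule powr_mult)
      finally show "q ^ n \<le> 2 powr \<gamma> * (t - s) powr \<gamma>" .
      show "0 \<le> (1 + 2 / (1 - q)) * A" using A q by auto
    qed
    finally show ?thesis by (simp add: mult_ac)
  qed
  show ?thesis
    using main[of s t] main[of t s] st unfolding q_def
    by (cases s t rule: linorder_cases) (auto simp: abs_minus_commute)
qed

text \<open>The product of the odd numbers below 2m, which is the moment of order 2m of a standard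
  normal variable.\<close>

definition gauss_const :: "nat \<Rightarrow> real" where
  "gauss_const m = fact (2 * m) / (2 ^ m * fact m)"

text \<open>Gives content to the expectations in \<open>fractional_BM\<close>, since the value of an
  integral says nothing without integrability; degenerate variables form a separate case.\<close>

lemma (in prob_space) gaussian_rv_integrable:
  assumes "gaussian_rv M Y"
  shows "integrable M Y" "integrable M (\<lambda>\<omega>. (Y \<omega>)\<^sup>2)"
proof -
  have [measurable]: "Y \<in> borel_measurable M" using assms by (simp add: gaussian_rv_def)
  have "integrable M Y \<and> integrable M (\<lambda>\<omega>. (Y \<omega>)\<^sup>2)"
  proof (cases "\<exists>c. AE \<omega> in M. Y \<omega> = c")
    case True
    then obtain c where c: "AE \<omega> in M. Y \<omega> = c" by blast
    have "integrable M Y"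
      by (rule integrable_cong_AE_imp[of _ "\<lambda>_. c"]) (use c in auto)
    moreover have "integrable M (\<lambda>\<omega>. (Y \<omega>)\<^sup>2)"
      by (rule integrable_cong_AE_imp[of _ "\<lambda>_. c\<^sup>2"]) (use c in auto)
    ultimately show ?thesis by blast
  next
    case False
    then obtain \<mu> s where s: "s > 0" and d: "distributed M lborel Y (\<lambda>y. ennreal (normal_density \<mu> s y))"
      using assms unfolding gaussian_rv_def by blast
    have i: "integrable M (\<lambda>\<omega>. (Y \<omega> - \<mu>) ^ k)" for k
      using distributed_integrable[OF d, of "\<lambda>y. (y - \<mu>) ^ k"] integrable_normal_moment[OF s, of \<mu> k] by simp
    have "integrable M (\<lambda>\<omega>. (Y \<omega> - \<mu>) ^ 1 + \<mu>)" by (intro Bochner_Integration.integrable_add i) simp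
    then have 1: "integrable M Y" by simp
    have "integrable M (\<lambda>\<omega>. (Y \<omega> - \<mu>) ^ 2 + (2 * \<mu> * Y \<omega> - \<mu>\<^sup>2))"
      using i 1 by (intro Bochner_Integration.integrable_add Bochner_Integration.integrable_diff) auto
    then have "integrable M (\<lambda>\<omega>. (Y \<omega>)\<^sup>2)" by (simp add: power2_eq_square algebra_simps)
    with 1 show ?thesis by blast
  qed
  then show "integrable M Y" "integrable M (\<lambda>\<omega>. (Y \<omega>)\<^sup>2)" by auto
qed

lemma (in prob_space) gaussian_rv_moment:
  assumes Y: "gaussian_rv M Y" and E0: "(\<integral>\<omega>. Y \<omega> \<partial>M) = 0"
    and E2: "(\<integral>\<omega>. (Y \<omega>)\<^sup>2 \<partial>M) = v" and m: "0 < m"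
  shows "(\<integral>\<^sup>+\<omega>. ennreal ((Y \<omega>) ^ (2 * m)) \<partial>M) \<le> ennreal (gauss_const m * v ^ m)"
proof -
  have [measurable]: "Y \<in> borel_measurable M" using Y by (simp add: gaussian_rv_def)
  show ?thesis
  proof (cases "\<exists>c. AE \<omega> in M. Y \<omega> = c")
    case True
    then obtain c where c: "AE \<omega> in M. Y \<omega> = c" by blast
    have "(\<integral>\<omega>. Y \<omega> \<partial>M) = (\<integral>\<omega>. c \<partial>M)" by (rule integral_cong_AE) (use c in auto)
    then have "c = 0" using E0 by (simp add: prob_space)
    \<comment> \<open>Here \<open>m\<close> must be positive, as a power with exponent 0 would be
      1.\<close>
    then have "AE \<omega> in M. ennreal ((Y \<omega>) ^ (2 * m)) = 0" using c m by auto
    then have "(\<integral>\<^sup>+\<omega>. ennreal ((Y \<omega>) ^ (2 * m)) \<partial>M) = 0"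
      by (subst nn_integral_0_iff_AE) auto
    then show ?thesis by simp
  next
    case False
    then obtain \<mu> s where s: "s > 0" and d: "distributed M lborel Y (\<lambda>y. ennreal (normal_density \<mu> s y))"
      using Y unfolding gaussian_rv_def by blast
    have \<mu>: "\<mu> = 0" using normal_distributed_expectation[OF s d] E0 by simp
    have v: "v = s\<^sup>2" using normal_distributed_variance[OF s d] E0 E2 by simp
    have b: "has_bochner_integral lborel (\<lambda>x. normal_density 0 s x * x ^ (2 * m)) (fact (2 * m) / ((2 / s\<^sup>2) ^ m * fact m))"
      using normal_moment_even[OF s, of 0 m] by simp
    have "(\<integral>\<^sup>+\<omega>. ennreal ((Y \<omega>) ^ (2 * m)) \<partial>M) = (\<integral>\<^sup>+x. ennreal (normal_density 0 s x) * ennreal (x ^ (2 * m)) \<partial>lborel)"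
      using distributed_nn_integral[OF d, of "\<lambda>y. ennreal (y ^ (2 * m))"] \<mu> by simp
    also have "\<dots> = (\<integral>\<^sup>+x. ennreal (normal_density 0 s x * x ^ (2 * m)) \<partial>lborel)"
      by (intro nn_integral_cong) (simp add: ennreal_mult)
    also have "\<dots> = ennreal (fact (2 * m) / ((2 / s\<^sup>2) ^ m * fact m))"
      using b by (subst nn_integral_eq_integral) (auto simp: has_bochner_integral_iff)
    also have "fact (2 * m) / ((2 / s\<^sup>2) ^ m * fact m) = gauss_const m * v ^ m"
      using s by (simp add: gauss_const_def v power_divide field_simps)
    finally show ?thesis by simp
  qed
qed

section \<open>Increments and Hoelder constant of fractional Brownian motion\<close>

lemma (in prob_space) fractional_BM_rv:
  assumes B: "fractional_BM M H B" and t: "t \<in> {0..1}"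
  shows "gaussian_rv M (B t)"
proof -
  have "gaussian_rv M (\<lambda>\<omega>. \<Sum>r\<in>{t}. 1 * B r \<omega>)"
    using B t unfolding fractional_BM_def gaussian_process_def by (elim conjE allE[of _ "{t}"] allE[of _ "\<lambda>_. 1"]) auto
  then show ?thesis by simp
qed

lemma (in prob_space) fractional_BM_increment:
  assumes B: "fractional_BM M H B" and H: "0 < H" and st: "s \<in> {0..1}" "t \<in> {0..1}"
  shows "gaussian_rv M (\<lambda>\<omega>. B t \<omega> - B s \<omega>)" "(\<integral>\<omega>. B t \<omega> - B s \<omega> \<partial>M) = 0"
    "(\<integral>\<omega>. (B t \<omega> - B s \<omega>)\<^sup>2 \<partial>M) = \<bar>t - s\<bar> powr (2 * H)"
proof -
  note rv = fractional_BM_rv[OF B]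
  note i = gaussian_rv_integrable[OF rv]
  have [measurable]: "B r \<in> borel_measurable M" if "r \<in> {0..1}" for r
    using rv[OF that] by (simp add: gaussian_rv_def)
  have cov: "(\<integral>\<omega>. B t \<omega> * B s \<omega> \<partial>M) = fbm_cov H t s" if "s \<in> {0..1}" "t \<in> {0..1}" for s t
    using B that by (simp add: fractional_BM_def)
  have E0: "(\<integral>\<omega>. B t \<omega> \<partial>M) = 0" if "t \<in> {0..1}" for t using B that by (simp add: fractional_BM_def)
  show "gaussian_rv M (\<lambda>\<omega>. B t \<omega> - B s \<omega>)"
  \<comment> \<open>For equal times the index set collapses to a singleton and the coefficients 1
    and -1 could not both be used.\<close>
  proof (cases "s = t")
    case False
    define c where "c r = (if r = t then 1 else - 1 :: real)" for r
    have "gaussian_rv M (\<lambda>\<omega>. \<Sum>r\<in>{s, t}. c r * B r \<omega>)"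
      using B st unfolding fractional_BM_def gaussian_process_def by (elim conjE allE[of _ "{s, t}"] allE[of _ c]) auto
    then show ?thesis using False by (simp add: c_def)
  qed (auto simp: gaussian_rv_def)
  show "(\<integral>\<omega>. B t \<omega> - B s \<omega> \<partial>M) = 0" using i(1) E0 st by simp
  have ip: "integrable M (\<lambda>\<omega>. B t \<omega> * B s \<omega>)"
  proof (rule Bochner_Integration.integrable_bound)
    show "integrable M (\<lambda>\<omega>. (B t \<omega>)\<^sup>2 + (B s \<omega>)\<^sup>2)" using i(2) st by simp
    show "(\<lambda>\<omega>. B t \<omega> * B s \<omega>) \<in> borel_measurable M" using st by measurable
    have "\<bar>a * b\<bar> \<le> a\<^sup>2 + b\<^sup>2" for a b :: real
    proof -
      have "0 \<le> (\<bar>a\<bar> - \<bar>b\<bar>)\<^sup>2" "0 \<le> \<bar>a\<bar> * \<bar>b\<bar>" by simp_all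
      then show ?thesis unfolding abs_mult power2_diff power2_abs by argo
    qed
    then show "AE \<omega> in M. norm (B t \<omega> * B s \<omega>) \<le> norm ((B t \<omega>)\<^sup>2 + (B s \<omega>)\<^sup>2)" by simp
  qed
  have "(\<integral>\<omega>. (B t \<omega> - B s \<omega>)\<^sup>2 \<partial>M) = (\<integral>\<omega>. (B t \<omega>)\<^sup>2 + (B s \<omega>)\<^sup>2 - 2 * (B t \<omega> * B s \<omega>) \<partial>M)"
    by (simp add: power2_diff mult.assoc)
  also have "\<dots> = (\<integral>\<omega>. (B t \<omega>)\<^sup>2 \<partial>M) + (\<integral>\<omega>. (B s \<omega>)\<^sup>2 \<partial>M) - 2 * (\<integral>\<omega>. B t \<omega> * B s \<omega> \<partial>M)"
    using i(2) ip st by simp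
  also have "\<dots> = \<bar>t - s\<bar> powr (2 * H)"
    using cov[OF st] cov[OF st(1,1)] cov[OF st(2,2)] by (simp add: fbm_cov_def power2_eq_square)
  finally show "(\<integral>\<omega>. (B t \<omega> - B s \<omega>)\<^sup>2 \<partial>M) = \<bar>t - s\<bar> powr (2 * H)" .
qed

lemma (in prob_space) fractional_BM_0:
  assumes B: "fractional_BM M H B" and H: "0 < H"
  shows "AE \<omega> in M. B 0 \<omega> = 0"
proof -
  note i = gaussian_rv_integrable(2)[OF fractional_BM_rv[OF B, of 0]]
  have "(\<integral>\<omega>. B 0 \<omega> * B 0 \<omega> \<partial>M) = fbm_cov H 0 0" using B by (simp add: fractional_BM_def)
  then have "(\<integral>\<omega>. (B 0 \<omega>)\<^sup>2 \<partial>M) = 0" by (simp add: fbm_cov_def power2_eq_square)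
  then have "AE \<omega> in M. (B 0 \<omega>)\<^sup>2 = 0"
    using i by (subst (asm) integral_nonneg_eq_0_iff_AE) auto
  then show ?thesis by simp
qed

text \<open>Probabilistic half of the Kolmogorov argument, with moments high enough for any exponent
  below H. Besides finiteness, the Hoelder constant must be square integrable, since it will
  dominate the Euler schemes.\<close>

lemma (in prob_space) fractional_BM_holder:
  assumes B: "fractional_BM M H B" and \<gamma>: "0 < \<gamma>" "\<gamma> < H"
  obtains A where "A \<in> borel_measurable M" "\<And>\<omega>. 0 \<le> A \<omega>" "integrable M (\<lambda>\<omega>. (A \<omega>)\<^sup>2)"
    "AE \<omega> in M. \<forall>s\<in>{0..1}. \<forall>t\<in>{0..1}. \<bar>B t \<omega> - B s \<omega>\<bar> \<le> A \<omega> * \<bar>t - s\<bar> powr \<gamma>"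
proof -
  have H: "0 < H" using \<gamma> by simp
  \<comment> \<open>There are 2^n increments at level n, each contributing a constant times 2^(- 2 m
    n (H - \<gamma>)); this choice makes the product geometric with ratio \<open>r\<close> below
    1.\<close>
  obtain m :: nat where m: "1 / (2 * (H - \<gamma>)) < real m" using reals_Archimedean2 by blast
  have m0: "0 < m" using m \<gamma> by (cases m) (auto simp: field_simps)
  have mH: "1 < 2 * real m * (H - \<gamma>)" using m \<gamma> by (simp add: field_simps)
  define pt where "pt n k = real k / 2 ^ n" for n k :: nat
  have pt: "pt n k \<in> {0..1}" if "k \<le> 2 ^ n" for n k
    using that by (auto simp: pt_def divide_le_eq)
  define \<Delta> where "\<Delta> n k \<omega> = B (pt n (Suc k)) \<omega> - B (pt n k) \<omega>" for n k \<omega>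
  have g: "gaussian_rv M (\<Delta> n k)" "(\<integral>\<omega>. \<Delta> n k \<omega> \<partial>M) = 0" "(\<integral>\<omega>. (\<Delta> n k \<omega>)\<^sup>2 \<partial>M) = (1 / 2 ^ n) powr (2 * H)"
    if "k < 2 ^ n" for n k
  proof -
    have "pt n (Suc k) - pt n k = 1 / 2 ^ n" by (simp add: pt_def diff_divide_distrib[symmetric])
    then show "gaussian_rv M (\<Delta> n k)" "(\<integral>\<omega>. \<Delta> n k \<omega> \<partial>M) = 0" "(\<integral>\<omega>. (\<Delta> n k \<omega>)\<^sup>2 \<partial>M) = (1 / 2 ^ n) powr (2 * H)"
      using fractional_BM_increment[OF B H, of "pt n k" "pt n (Suc k)"] pt[of k n] pt[of "Suc k" n] that
      unfolding \<Delta>_def by auto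
  qed
  have \<Delta>m [measurable]: "\<Delta> n k \<in> borel_measurable M" if "k < 2 ^ n" for n k
    using g(1)[OF that] by (simp add: gaussian_rv_def)
  \<comment> \<open>Increments rescaled by the expected rate, so that finiteness of the sum over all
    levels bounds every single one by a multiple of
    \<open>(2 powr (- \<gamma>)) ^ n\<close>.\<close>
  define S where "S n \<omega> = (\<Sum>k<2 ^ n. ((2 powr \<gamma>) ^ n * \<Delta> n k \<omega>) ^ (2 * m))" for n \<omega>
  have S0: "0 \<le> S n \<omega>" for n \<omega> unfolding S_def by (intro sum_nonneg) simp
  have Sm [measurable]: "S n \<in> borel_measurable M" for n unfolding S_def by measurable
  define Z where "Z \<omega> = (\<Sum>n. ennreal (S n \<omega>))" for \<omega>
  have Zm [measurable]: "Z \<in> borel_measurable M" unfolding Z_def by measurable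
  define r where "r = 2 powr (1 - 2 * real m * (H - \<gamma>))"
  have r: "0 < r" "r < 1" using mH powr_less_mono[of "1 - 2 * real m * (H - \<gamma>)" 0 2] by (auto simp: r_def)
  have gc: "0 \<le> gauss_const m" by (simp add: gauss_const_def)
  have ES: "(\<integral>\<^sup>+\<omega>. ennreal (S n \<omega>) \<partial>M) \<le> ennreal (gauss_const m * r ^ n)" for n
  proof -
    define w where "w = ((2 powr \<gamma>) ^ n) ^ (2 * m)"
    have w: "0 \<le> w" by (simp add: w_def)
    have "(\<integral>\<^sup>+\<omega>. ennreal (S n \<omega>) \<partial>M) = (\<integral>\<^sup>+\<omega>. (\<Sum>k<2 ^ n. ennreal w * ennreal (\<Delta> n k \<omega> ^ (2 * m))) \<partial>M)"
      by (intro nn_integral_cong)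
        (simp add: S_def w_def power_mult_distrib ennreal_mult[symmetric] del: ennreal_mult)
    also have "\<dots> = (\<Sum>k<2 ^ n. ennreal w * (\<integral>\<^sup>+\<omega>. ennreal (\<Delta> n k \<omega> ^ (2 * m)) \<partial>M))"
      by (subst nn_integral_sum) (auto intro!: sum.cong nn_integral_cmult)
    also have "\<dots> \<le> (\<Sum>k<(2::nat) ^ n. ennreal w * ennreal (gauss_const m * ((1 / 2 ^ n) powr (2 * H)) ^ m))"
      by (intro sum_mono mult_left_mono gaussian_rv_moment g m0) auto
    also have "\<dots> = ennreal (2 ^ n * (w * (gauss_const m * ((1 / 2 ^ n) powr (2 * H)) ^ m)))"
      using w gc by (simp add: ennreal_mult[symmetric] ennreal_of_nat_eq_real_of_nat del: ennreal_mult)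
    also have "2 ^ n * (w * (gauss_const m * ((1 / 2 ^ n) powr (2 * H)) ^ m)) = gauss_const m * r ^ n"
    proof -
      have 1: "w = 2 powr (\<gamma> * n * (2 * m))" unfolding w_def by (simp add: powr_power mult_ac)
      have "1 / 2 ^ n = 2 powr (- real n)" by (simp add: powr_minus powr_realpow divide_inverse)
      then have 2: "((1 / 2 ^ n) powr (2 * H)) ^ m = 2 powr (- real n * (2 * H) * m)"
        by (simp add: powr_powr powr_power mult_ac)
      have 3: "(2::real) ^ n = 2 powr n" by (simp add: powr_realpow)
      have 4: "r ^ n = 2 powr ((1 - 2 * real m * (H - \<gamma>)) * n)" by (simp add: r_def powr_power mult_ac)
      have "2 ^ n * (w * ((1 / 2 ^ n) powr (2 * H)) ^ m) = r ^ n"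
        unfolding 2 unfolding 1 3 4 powr_add[symmetric] by (simp add: algebra_simps)
      then show ?thesis by (simp add: mult_ac)
    qed
    finally show ?thesis .
  qed
  have "(\<integral>\<^sup>+\<omega>. Z \<omega> \<partial>M) = (\<Sum>n. \<integral>\<^sup>+\<omega>. ennreal (S n \<omega>) \<partial>M)"
    unfolding Z_def by (rule nn_integral_suminf) measurable
  also have "\<dots> \<le> (\<Sum>n. ennreal (gauss_const m * r ^ n))"
    by (intro suminf_le ES) auto
  also have "\<dots> = ennreal (\<Sum>n. gauss_const m * r ^ n)"
    by (rule suminf_ennreal2) (use gc r in \<open>auto intro!: summable_mult summable_geometric\<close>)
  also have "\<dots> < \<infinity>" by simp
  finally have EZ: "(\<integral>\<^sup>+\<omega>. Z \<omega> \<partial>M) < \<infinity>" .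
  then have Zfin: "AE \<omega> in M. Z \<omega> \<noteq> \<infinity>" by (intro nn_integral_PInf_AE) auto
  define Y where "Y \<omega> = enn2real (Z \<omega>)" for \<omega>
  have Ym [measurable]: "Y \<in> borel_measurable M" unfolding Y_def by measurable
  have Y0: "0 \<le> Y \<omega>" for \<omega> by (simp add: Y_def)
  have Yi: "integrable M Y"
  proof (rule integrableI_nonneg)
    have "(\<integral>\<^sup>+\<omega>. ennreal (Y \<omega>) \<partial>M) \<le> (\<integral>\<^sup>+\<omega>. Z \<omega> \<partial>M)"
      unfolding Y_def by (intro nn_integral_mono) (simp add: ennreal_enn2real_if)
    then show "(\<integral>\<^sup>+\<omega>. ennreal (Y \<omega>) \<partial>M) < \<infinity>" using EZ by (rule le_less_trans)
  qed (use Y0 in auto)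
  define K where "K = 2 powr \<gamma> * (1 + 2 / (1 - 2 powr (- \<gamma>)))"
  have K: "0 \<le> K"
  proof -
    have "2 powr (- \<gamma>) < 1" using \<gamma> powr_less_mono[of "- \<gamma>" 0 2] by simp
    then show ?thesis by (simp add: K_def)
  qed
  define a where "a \<omega> = Y \<omega> powr (1 / (2 * m))" for \<omega>
  have am [measurable]: "a \<in> borel_measurable M" unfolding a_def by measurable
  have a0: "0 \<le> a \<omega>" for \<omega> by (simp add: a_def)
  \<comment> \<open>Square integrability of \<open>a\<close> follows from integrability of
    \<open>Y\<close> alone, since the exponent 1/m is at most 1.\<close>
  have a2: "(a \<omega>)\<^sup>2 \<le> 1 + Y \<omega>" for \<omega>
  proof -
    have "(a \<omega>)\<^sup>2 = Y \<omega> powr (1 / m)"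
      unfolding a_def power2_eq_square powr_add[symmetric] using m0 by (simp add: field_simps)
    also have "\<dots> \<le> (1 + Y \<omega>) powr (1 / m)" using Y0[of \<omega>] by (intro powr_mono2) auto
    also have "\<dots> \<le> (1 + Y \<omega>) powr 1" using Y0[of \<omega>] m0 by (intro powr_mono) auto
    finally show ?thesis using Y0[of \<omega>] by simp
  qed
  show ?thesis
  proof (rule that[of "\<lambda>\<omega>. K * a \<omega>"])
    show "(\<lambda>\<omega>. K * a \<omega>) \<in> borel_measurable M" by measurable
    show "0 \<le> K * a \<omega>" for \<omega> using K a0 by simp
    show "integrable M (\<lambda>\<omega>. (K * a \<omega>)\<^sup>2)"
    proof (rule Bochner_Integration.integrable_bound)
      show "integrable M (\<lambda>\<omega>. K\<^sup>2 * (1 + Y \<omega>))" using Yi by simp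
      show "AE \<omega> in M. norm ((K * a \<omega>)\<^sup>2) \<le> norm (K\<^sup>2 * (1 + Y \<omega>))"
        using a2 Y0 by (auto simp: power_mult_distrib abs_mult intro!: mult_left_mono)
    qed measurable
    have "AE \<omega> in M. continuous_on {0..1} (\<lambda>t. B t \<omega>)"
      using B by (simp add: fractional_BM_def continuous_process_def)
    then show "AE \<omega> in M. \<forall>s\<in>{0..1}. \<forall>t\<in>{0..1}. \<bar>B t \<omega> - B s \<omega>\<bar> \<le> K * a \<omega> * \<bar>t - s\<bar> powr \<gamma>"
      using Zfin
    proof eventually_elim
      fix \<omega> assume c: "continuous_on {0..1} (\<lambda>t. B t \<omega>)" and Z: "Z \<omega> \<noteq> \<infinity>"
      have bd: "\<bar>\<Delta> n k \<omega>\<bar> \<le> a \<omega> * (2 powr (- \<gamma>)) ^ n" if k: "k < 2 ^ n" for n k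
      proof -
        let ?x = "(2 powr \<gamma>) ^ n * \<Delta> n k \<omega>"
        have "?x ^ (2 * m) \<le> S n \<omega>"
          unfolding S_def using k by (intro member_le_sum) auto
        moreover have "ennreal (S n \<omega>) \<le> Z \<omega>"
          unfolding Z_def using sum_le_suminf[of "\<lambda>n. ennreal (S n \<omega>)" "{n}"] by simp
        then have "S n \<omega> \<le> Y \<omega>"
          using Z S0[of n \<omega>] unfolding Y_def by (metis enn2real_ennreal enn2real_mono infinity_ennreal_def top.not_eq_extremum)
        ultimately have "\<bar>?x\<bar> ^ (2 * m) \<le> Y \<omega>" by (simp add: power_even_abs)
        then have "(\<bar>?x\<bar> ^ (2 * m)) powr (1 / (2 * m)) \<le> a \<omega>"
          unfolding a_def by (intro powr_mono2) auto
        moreover have "(\<bar>?x\<bar> ^ (2 * m)) powr (1 / (2 * m)) = \<bar>?x\<bar>"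
        proof (cases "?x = 0")
          case True then show ?thesis using m0 by simp
        next
          case False
          then have "\<bar>?x\<bar> ^ (2 * m) = \<bar>?x\<bar> powr (real (2 * m))" by (subst powr_realpow) auto
          then show ?thesis using m0 by (simp add: powr_powr)
        qed
        ultimately have "(2 powr \<gamma>) ^ n * \<bar>\<Delta> n k \<omega>\<bar> \<le> a \<omega>" by (simp add: abs_mult)
        then have "(2 powr (- \<gamma>)) ^ n * ((2 powr \<gamma>) ^ n * \<bar>\<Delta> n k \<omega>\<bar>) \<le> (2 powr (- \<gamma>)) ^ n * a \<omega>"
          by (intro mult_left_mono) auto
        moreover have "(2 powr (- \<gamma>)) ^ n * (2 powr \<gamma>) ^ n = 1"
          by (simp add: power_mult_distrib[symmetric] powr_add[symmetric])
        then have "(2 powr (- \<gamma>)) ^ n * ((2 powr \<gamma>) ^ n * \<bar>\<Delta> n k \<omega>\<bar>) = \<bar>\<Delta> n k \<omega>\<bar>"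
          by (simp add: mult.assoc[symmetric])
        ultimately have "\<bar>\<Delta> n k \<omega>\<bar> \<le> (2 powr (- \<gamma>)) ^ n * a \<omega>" by linarith
        then show ?thesis by (simp only: mult.commute)
      qed
      show "\<forall>s\<in>{0..1}. \<forall>t\<in>{0..1}. \<bar>B t \<omega> - B s \<omega>\<bar> \<le> K * a \<omega> * \<bar>t - s\<bar> powr \<gamma>"
        using dyadic_holder[OF c a0 \<gamma>(1), of \<omega>] bd unfolding \<Delta>_def pt_def K_def by blast
    qed
  qed
qed

section \<open>Closedness of the Malliavin derivative\<close>

text \<open>Sums of Borel maps into a nonseparable space may fail to be measurable. With one fixed
  sequence \<open>h\<close> of directions, a combination factors through its real coefficients and a
  continuous map, and linear combinations stay in this form.\<close>

definition fin_comb :: "'a measure \<Rightarrow> (nat \<Rightarrow> 'h::real_normed_vector) \<Rightarrow> ('a \<Rightarrow> 'h) \<Rightarrow> bool" where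
  "fin_comb M h D \<longleftrightarrow> (\<exists>n a. (\<forall>i. a i \<in> borel_measurable M) \<and>
     (\<forall>\<omega>\<in>space M. D \<omega> = (\<Sum>i<n. a i \<omega> *\<^sub>R h i)))"

lemma fin_comb_measurable:
  assumes "fin_comb M h D"
  shows "D \<in> borel_measurable M"
proof -
  obtain n a where a: "\<And>i. a i \<in> borel_measurable M"
    and D: "\<And>\<omega>. \<omega> \<in> space M \<Longrightarrow> D \<omega> = (\<Sum>i<n. a i \<omega> *\<^sub>R h i)"
    using assms unfolding fin_comb_def by blast
  have "(\<lambda>\<omega> i. a i \<omega>) \<in> borel_measurable M"
    by (rule measurable_coordinatewise_then_product) (rule a)
  moreover have "continuous_on UNIV (\<lambda>v :: nat \<Rightarrow> real. \<Sum>i<n. v i *\<^sub>R h i)"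
    by (intro continuous_intros continuous_on_product_coordinates)
  then have "(\<lambda>v :: nat \<Rightarrow> real. \<Sum>i<n. v i *\<^sub>R h i) \<in> borel_measurable borel"
    by (rule borel_measurable_continuous_onI)
  ultimately have "(\<lambda>\<omega>. \<Sum>i<n. a i \<omega> *\<^sub>R h i) \<in> borel_measurable M"
    by (rule measurable_compose)
  then show ?thesis using D by (subst measurable_cong) auto
qed

lemma fin_comb_lincomb:
  assumes "fin_comb M h D" "fin_comb M h D'"
  shows "fin_comb M h (\<lambda>\<omega>. c *\<^sub>R D \<omega> + c' *\<^sub>R D' \<omega>)"
proof -
  obtain n a where a: "\<And>i. a i \<in> borel_measurable M"
    and D: "\<And>\<omega>. \<omega> \<in> space M \<Longrightarrow> D \<omega> = (\<Sum>i<n. a i \<omega> *\<^sub>R h i)"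
    using assms unfolding fin_comb_def by blast
  obtain n' a' where a': "\<And>i. a' i \<in> borel_measurable M"
    and D': "\<And>\<omega>. \<omega> \<in> space M \<Longrightarrow> D' \<omega> = (\<Sum>i<n'. a' i \<omega> *\<^sub>R h i)"
    using assms unfolding fin_comb_def by blast
  define N where "N = max n n'"
  define p where "p m i = (if i < m then 1 else 0 :: real)" for m i :: nat
  have ext: "(\<Sum>i<m. x i *\<^sub>R h i) = (\<Sum>i<N. (p m i * x i) *\<^sub>R h i)" if "m \<le> N" for m and x :: "nat \<Rightarrow> real"
    using that by (intro sum.mono_neutral_cong_left) (auto simp: p_def)
  have "c *\<^sub>R D \<omega> + c' *\<^sub>R D' \<omega> =
      (\<Sum>i<N. (c * (p n i * a i \<omega>) + c' * (p n' i * a' i \<omega>)) *\<^sub>R h i)" if "\<omega> \<in> space M" for \<omega>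
    unfolding D[OF that] D'[OF that] using ext[of n] ext[of n']
    by (simp add: N_def scaleR_sum_right sum.distrib[symmetric] scaleR_add_left)
  moreover have "(\<lambda>\<omega>. c * (p n i * a i \<omega>) + c' * (p n' i * a' i \<omega>)) \<in> borel_measurable M" for i
    using a a' by (intro borel_measurable_add borel_measurable_times borel_measurable_const)
  ultimately show ?thesis
    unfolding fin_comb_def
    by (intro exI[of _ N] exI[of _ "\<lambda>i \<omega>. c * (p n i * a i \<omega>) + c' * (p n' i * a' i \<omega>)"]) blast
qed

text \<open>Midpoint-convex hulls of the tails: near-minimizers of the norm of the derivative over them
  form a Cauchy sequence by the parallelogram law, which replaces weak compactness.\<close>

inductive mid_hull :: "(nat \<Rightarrow> 'a \<Rightarrow> real) \<Rightarrow> (nat \<Rightarrow> 'a \<Rightarrow> 'h::real_vector) \<Rightarrow> nat \<Rightarrow>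
    ('a \<Rightarrow> real) \<Rightarrow> ('a \<Rightarrow> 'h) \<Rightarrow> bool" for Fs Ds n where
  mid_hull_base: "n \<le> k \<Longrightarrow> mid_hull Fs Ds n (Fs k) (Ds k)"
| mid_hull_mid: "mid_hull Fs Ds n F D \<Longrightarrow> mid_hull Fs Ds n F' D' \<Longrightarrow>
    mid_hull Fs Ds n (\<lambda>\<omega>. (F \<omega> + F' \<omega>) / 2) (\<lambda>\<omega>. (1/2) *\<^sub>R D \<omega> + (1/2) *\<^sub>R D' \<omega>)"

lemma mid_hull_mono: "mid_hull Fs Ds m F D \<Longrightarrow> n \<le> m \<Longrightarrow> mid_hull Fs Ds n F D"
  by (induction rule: mid_hull.induct) (auto intro: mid_hull.intros)

text \<open>The square is convex, so midpoints are no farther from \<open>F\<close> than the worse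
  of the two points. Passing to hulls of tails therefore preserves the convergence to
  \<open>F\<close>.\<close>

lemma (in prob_space) mid_hull_approx:
  assumes "mid_hull Fs Ds n G E" and [measurable]: "\<And>k. Fs k \<in> borel_measurable M" "F \<in> borel_measurable M"
    and "\<And>k. n \<le> k \<Longrightarrow> (\<integral>\<^sup>+\<omega>. ennreal ((Fs k \<omega> - F \<omega>)\<^sup>2) \<partial>M) \<le> c"
  shows "G \<in> borel_measurable M \<and> (\<integral>\<^sup>+\<omega>. ennreal ((G \<omega> - F \<omega>)\<^sup>2) \<partial>M) \<le> c"
  using assms(1)
proof induction
  case (mid_hull_base k)
  then show ?case using assms by blast
next
  case (mid_hull_mid G E G' E')
  then have [measurable]: "G \<in> borel_measurable M" "G' \<in> borel_measurable M" by auto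
  have "(\<integral>\<^sup>+\<omega>. ennreal (((G \<omega> + G' \<omega>) / 2 - F \<omega>)\<^sup>2) \<partial>M)
      \<le> (\<integral>\<^sup>+\<omega>. ennreal (1/2) * ennreal ((G \<omega> - F \<omega>)\<^sup>2) + ennreal (1/2) * ennreal ((G' \<omega> - F \<omega>)\<^sup>2) \<partial>M)"
  proof (rule nn_integral_mono)
    fix \<omega>
    have "((a + b) / 2 - f)\<^sup>2 \<le> 1/2 * (a - f)\<^sup>2 + 1/2 * (b - f)\<^sup>2" for a b f :: real
      using zero_le_power2[of "a - b"] by (simp add: power2_eq_square field_simps)
    then have "ennreal (((G \<omega> + G' \<omega>) / 2 - F \<omega>)\<^sup>2)
        \<le> ennreal (1/2 * (G \<omega> - F \<omega>)\<^sup>2 + 1/2 * (G' \<omega> - F \<omega>)\<^sup>2)"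
      by (rule ennreal_leI)
    also have "\<dots> = ennreal (1/2) * ennreal ((G \<omega> - F \<omega>)\<^sup>2) + ennreal (1/2) * ennreal ((G' \<omega> - F \<omega>)\<^sup>2)"
      by (simp only: ennreal_plus ennreal_mult zero_le_power2 mult_nonneg_nonneg zero_le_divide_1_iff zero_le_numeral)
    finally show "ennreal (((G \<omega> + G' \<omega>) / 2 - F \<omega>)\<^sup>2)
        \<le> ennreal (1/2) * ennreal ((G \<omega> - F \<omega>)\<^sup>2) + ennreal (1/2) * ennreal ((G' \<omega> - F \<omega>)\<^sup>2)" .
  qed
  also have "\<dots> = ennreal (1/2) * (\<integral>\<^sup>+\<omega>. ennreal ((G \<omega> - F \<omega>)\<^sup>2) \<partial>M)
      + ennreal (1/2) * (\<integral>\<^sup>+\<omega>. ennreal ((G' \<omega> - F \<omega>)\<^sup>2) \<partial>M)"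
    by (simp add: nn_integral_add nn_integral_cmult)
  also have "\<dots> \<le> ennreal (1/2) * c + ennreal (1/2) * c"
    using mid_hull_mid by (intro add_mono mult_left_mono) auto
  also have "\<dots> = (ennreal (1/2) + ennreal (1/2)) * c" by (rule distrib_right[symmetric])
  also have "ennreal (1/2) + ennreal (1/2) = 1"
    by (subst ennreal_plus[symmetric]) auto
  finally show ?case by simp
qed

text \<open>Bochner square-integrable limits are taken by hand: the type \<open>'h\<close> is neither
  second countable nor in the class \<open>banach\<close>.\<close>

lemma (in prob_space) L2_Cauchy_bounded_limit:
  fixes E :: "nat \<Rightarrow> 'a \<Rightarrow> 'h::{real_inner,complete_space}"
  assumes fc: "\<And>n. fin_comb M h (E n)" and bd: "\<And>n \<omega>. \<omega> \<in> space M \<Longrightarrow> norm (E n \<omega>) \<le> C"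
    and cau: "\<And>\<epsilon>. \<epsilon> > 0 \<Longrightarrow> \<exists>N. \<forall>n\<ge>N. \<forall>m\<ge>n. (\<integral>\<omega>. (norm (E n \<omega> - E m \<omega>))\<^sup>2 \<partial>M) < \<epsilon>"
  obtains r D where "strict_mono r" "D \<in> borel_measurable M"
    "integrable M (\<lambda>\<omega>. (norm (D \<omega>))\<^sup>2)"
    "\<And>k. (\<lambda>\<omega>. norm (E (r k) \<omega> - D \<omega>)) \<in> borel_measurable M"
    "(\<lambda>k. \<integral>\<^sup>+\<omega>. ennreal ((norm (E (r k) \<omega> - D \<omega>))\<^sup>2) \<partial>M) \<longlonglongrightarrow> 0"
proof -
  have C0: "0 \<le> C"
    using bd[of _ 0] not_empty by (metis all_not_in_conv norm_ge_zero order_trans)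
  have diffm: "(\<lambda>\<omega>. E n \<omega> - E m \<omega>) \<in> borel_measurable M" for n m
    using fin_comb_measurable[OF fin_comb_lincomb[OF fc[of n] fc[of m], of 1 "-1"]] by simp
  have norm_meas [measurable]: "(\<lambda>\<omega>. norm (E n \<omega> - E m \<omega>)) \<in> borel_measurable M" for n m
    by (rule measurable_compose[OF diffm borel_measurable_continuous_onI]) (intro continuous_intros)
  define C2 where "C2 = 2 * C"
  have bd2: "norm (E n \<omega> - E m \<omega>) \<le> C2" if "\<omega> \<in> space M" for n m \<omega>
    using norm_triangle_ineq4[of "E n \<omega>" "E m \<omega>"] bd[OF that, of n] bd[OF that, of m] unfolding C2_def by linarith
  have int2: "integrable M (\<lambda>\<omega>. (norm (E n \<omega> - E m \<omega>))\<^sup>2)" for n m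
    by (rule integrable_const_bound[where B = "C2\<^sup>2"])
       (auto intro!: AE_I2 power_mono bd2)
  have int1: "integrable M (\<lambda>\<omega>. norm (E n \<omega> - E m \<omega>))" for n m
    by (rule integrable_const_bound[where B = C2]) (auto intro!: AE_I2 bd2)
  have "\<exists>N. \<forall>n\<ge>N. \<forall>m\<ge>n. (\<integral>\<omega>. (norm (E n \<omega> - E m \<omega>))\<^sup>2 \<partial>M) < (1/4)^k" for k :: nat
    by (rule cau) simp
  then obtain N where N: "\<And>k n m. N k \<le> n \<Longrightarrow> n \<le> m \<Longrightarrow>
      (\<integral>\<omega>. (norm (E n \<omega> - E m \<omega>))\<^sup>2 \<partial>M) < (1/4)^k" by metis
  \<comment> \<open>The sum dominates every threshold up to \<open>k\<close>, and the added
    \<open>k\<close> makes the sequence strictly increasing.\<close>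
  define r where "r k = (\<Sum>i\<le>k. N i) + k" for k
  have r: "strict_mono r" unfolding strict_mono_Suc_iff r_def by simp
  have rN: "N k \<le> r k" for k
  proof -
    have "N k \<le> (\<Sum>i\<le>k. N i)" by (rule member_le_sum) auto
    then show ?thesis by (simp add: r_def)
  qed
  define d where "d k \<omega> = norm (E (r k) \<omega> - E (r (Suc k)) \<omega>)" for k \<omega>
  have d_meas [measurable]: "d k \<in> borel_measurable M" for k unfolding d_def by measurable
  have d_int: "(\<integral>\<^sup>+\<omega>. ennreal (d k \<omega>) \<partial>M) \<le> ennreal ((1/2)^k)" for k
  proof -
    have i: "(\<integral>\<omega>. (d k \<omega>)\<^sup>2 \<partial>M) < (1/4)^k"
      unfolding d_def using r by (intro N rN) (simp add: strict_mono_less_eq)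
    have "(\<integral>\<omega>. d k \<omega> \<partial>M) \<le> (\<integral>\<omega>. (2^k * (d k \<omega>)\<^sup>2 + (1/2)^k) / 2 \<partial>M)"
    proof (rule integral_mono)
      show "integrable M (d k)" unfolding d_def by (rule int1)
      show "integrable M (\<lambda>\<omega>. (2^k * (d k \<omega>)\<^sup>2 + (1/2)^k) / 2)"
        unfolding d_def using int2 by simp
      fix \<omega>
      \<comment> \<open>With \<open>a = 2^k\<close> this converts the bound 4^(-k) on mean squares
        into the bound 2^(-k) on means, so the distances \<open>d k\<close> are summable almost
        surely.\<close>
      have "x \<le> (a * x\<^sup>2 + 1 / a) / 2" if "a > 0" for a x :: real
        using zero_le_power2[of "a * x - 1"] that by (simp add: power2_eq_square field_simps)
      from this[of "2^k" "d k \<omega>"] show "d k \<omega> \<le> (2^k * (d k \<omega>)\<^sup>2 + (1/2)^k) / 2"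
        by (simp add: power_one_over)
    qed
    also have "\<dots> = (2^k * (\<integral>\<omega>. (d k \<omega>)\<^sup>2 \<partial>M) + (1/2)^k) / 2"
      using int2 by (simp add: d_def prob_space)
    also have "\<dots> \<le> (2^k * (1/4)^k + (1/2)^k) / 2"
      using i by (intro divide_right_mono add_right_mono mult_left_mono) auto
    also have "\<dots> = (1/2)^k" by (simp add: power_mult_distrib[symmetric])
    finally show ?thesis
      using int1 by (simp add: nn_integral_eq_integral d_def)
  qed
  have "(\<integral>\<^sup>+\<omega>. (\<Sum>k. ennreal (d k \<omega>)) \<partial>M) = (\<Sum>k. \<integral>\<^sup>+\<omega>. ennreal (d k \<omega>) \<partial>M)"
    by (rule nn_integral_suminf) measurable
  also have "\<dots> \<le> (\<Sum>k. ennreal ((1/2)^k))"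
    by (intro suminf_le d_int) auto
  also have "\<dots> = ennreal (\<Sum>k. (1/2)^k)"
    by (rule suminf_ennreal2) auto
  also have "\<dots> < \<infinity>" by simp
  finally have "AE \<omega> in M. (\<Sum>k. ennreal (d k \<omega>)) \<noteq> \<infinity>"
    by (intro nn_integral_PInf_AE) auto
  then have AEC: "AE \<omega> in M. Cauchy (\<lambda>k. E (r k) \<omega>)"
  proof eventually_elim
    fix \<omega> assume "(\<Sum>k. ennreal (d k \<omega>)) \<noteq> \<infinity>"
    then have sm: "summable (\<lambda>k. d k \<omega>)"
      by (intro summable_suminf_not_top) (auto simp: d_def)
    define s where "s k = (\<Sum>i<k. d i \<omega>)" for k
    have "Cauchy s" unfolding s_def using summable_LIMSEQ[OF sm] by (rule LIMSEQ_imp_Cauchy)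
    have le: "dist (E (r k) \<omega>) (E (r j) \<omega>) \<le> s j - s k" if "k \<le> j" for k j
      using that
    proof (induction j rule: dec_induct)
      case base show ?case by simp
    next
      case (step j)
      have "dist (E (r k) \<omega>) (E (r (Suc j)) \<omega>) \<le> dist (E (r k) \<omega>) (E (r j) \<omega>) + d j \<omega>"
        unfolding d_def dist_norm[symmetric] by (rule dist_triangle)
      then show ?case using step by (simp add: s_def)
    qed
    show "Cauchy (\<lambda>k. E (r k) \<omega>)"
    proof (rule metric_CauchyI)
      fix e :: real assume "e > 0"
      then obtain K where K: "\<And>i j. K \<le> i \<Longrightarrow> K \<le> j \<Longrightarrow> dist (s i) (s j) < e"
        using metric_CauchyD[OF \<open>Cauchy s\<close>] by blast
      have "dist (E (r i) \<omega>) (E (r j) \<omega>) < e" if ij: "K \<le> i" "K \<le> j" for i j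
      proof (cases "i \<le> j")
        case True
        then show ?thesis using le[of i j] K[OF ij] by (auto simp: dist_real_def)
      next
        case False
        then show ?thesis using le[of j i] K[OF ij] by (auto simp: dist_real_def dist_commute)
      qed
      then show "\<exists>K. \<forall>i\<ge>K. \<forall>j\<ge>K. dist (E (r i) \<omega>) (E (r j) \<omega>) < e" by blast
    qed
  qed
  then obtain Z where Z: "Z \<in> null_sets M" "{\<omega>\<in>space M. \<not> Cauchy (\<lambda>k. E (r k) \<omega>)} \<subseteq> Z"
    unfolding eventually_ae_filter by blast
  have Zm [measurable]: "Z \<in> sets M" using Z by blast
  \<comment> \<open>The default 0 on the null set \<open>Z\<close> gives convergence everywhere for
    the modified sequence, hence measurability of \<open>D\<close>.\<close>
  define D where "D \<omega> = (if \<omega> \<in> Z then 0 else lim (\<lambda>k. E (r k) \<omega>))" for \<omega>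
  have conv: "(\<lambda>k. E (r k) \<omega>) \<longlonglongrightarrow> D \<omega>" if "\<omega> \<in> space M" "\<omega> \<notin> Z" for \<omega>
  proof -
    have "Cauchy (\<lambda>k. E (r k) \<omega>)" using that Z by blast
    then have "convergent (\<lambda>k. E (r k) \<omega>)" by (rule Cauchy_convergent)
    then show ?thesis using that by (simp add: D_def convergent_LIMSEQ_iff)
  qed
  have D_meas: "D \<in> borel_measurable M"
  proof (rule borel_measurable_LIMSEQ_metric)
    show "(\<lambda>\<omega>. if \<omega> \<in> Z then 0 else E (r k) \<omega>) \<in> borel_measurable M" for k
      by (rule measurable_If_set) (auto intro: fin_comb_measurable fc)
    show "(\<lambda>k. if \<omega> \<in> Z then 0 else E (r k) \<omega>) \<longlonglongrightarrow> D \<omega>" if "\<omega> \<in> space M" for \<omega>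
      using conv[OF that] by (cases "\<omega> \<in> Z") (auto simp: D_def)
  qed
  have DC: "norm (D \<omega>) \<le> C" if "\<omega> \<in> space M" for \<omega>
  proof (cases "\<omega> \<in> Z")
    case False
    show ?thesis
      by (rule Lim_bounded[OF tendsto_norm[OF conv[OF that False]], of 0 C]) (auto intro: bd that)
  qed (simp add: D_def C0)
  \<comment> \<open>\<open>D\<close> is only a limit and need not be a finite combination, so its
    difference from \<open>E (r k)\<close> is not known to be measurable; the norm is obtained as a
    limit of norms of admissible differences instead.\<close>
  have nD [measurable]: "(\<lambda>\<omega>. norm (E (r k) \<omega> - D \<omega>)) \<in> borel_measurable M" for k
  proof (rule borel_measurable_LIMSEQ_metric)
    have n1 [measurable]: "(\<lambda>\<omega>. norm (E (r k) \<omega>)) \<in> borel_measurable M"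
      by (rule measurable_compose[OF fin_comb_measurable[OF fc] borel_measurable_continuous_onI])
        (intro continuous_intros)
    show "(\<lambda>\<omega>. if \<omega> \<in> Z then norm (E (r k) \<omega>) else norm (E (r k) \<omega> - E (r j) \<omega>)) \<in> borel_measurable M" for j
      by measurable
    show "(\<lambda>j. if \<omega> \<in> Z then norm (E (r k) \<omega>) else norm (E (r k) \<omega> - E (r j) \<omega>)) \<longlonglongrightarrow>
        norm (E (r k) \<omega> - D \<omega>)" if "\<omega> \<in> space M" for \<omega>
      using conv[OF that] by (cases "\<omega> \<in> Z") (auto simp: D_def intro!: tendsto_intros)
  qed
  have n2 [measurable]: "(\<lambda>\<omega>. norm (D \<omega>)) \<in> borel_measurable M"
    by (rule measurable_compose[OF D_meas borel_measurable_continuous_onI]) (intro continuous_intros)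
  have iD: "integrable M (\<lambda>\<omega>. (norm (D \<omega>))\<^sup>2)"
    by (rule integrable_const_bound[where B = "C\<^sup>2"]) (auto intro!: AE_I2 power_mono DC)
  have bd3: "norm (E (r k) \<omega> - D \<omega>) \<le> C2" if "\<omega> \<in> space M" for k \<omega>
    using norm_triangle_ineq4[of "E (r k) \<omega>" "D \<omega>"] bd[OF that, of "r k"] DC[OF that] unfolding C2_def by linarith
  have i3: "integrable M (\<lambda>\<omega>. (norm (E (r k) \<omega> - D \<omega>))\<^sup>2)" for k
    by (rule integrable_const_bound[where B = "C2\<^sup>2"]) (auto intro!: AE_I2 power_mono bd3)
  have "(\<lambda>k. \<integral>\<omega>. (norm (E (r k) \<omega> - D \<omega>))\<^sup>2 \<partial>M) \<longlonglongrightarrow> (\<integral>\<omega>. 0 \<partial>M)"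
  proof (rule integral_dominated_convergence[where w = "\<lambda>_. C2\<^sup>2"])
    show "AE \<omega> in M. (\<lambda>k. (norm (E (r k) \<omega> - D \<omega>))\<^sup>2) \<longlonglongrightarrow> 0"
      using AE_not_in[OF Z(1)] AE_space
    proof eventually_elim
      fix \<omega> assume "\<omega> \<notin> Z" "\<omega> \<in> space M"
      then have "(\<lambda>k. (norm (E (r k) \<omega> - D \<omega>))\<^sup>2) \<longlonglongrightarrow> (norm (D \<omega> - D \<omega>))\<^sup>2"
        by (intro tendsto_intros conv)
      then show "(\<lambda>k. (norm (E (r k) \<omega> - D \<omega>))\<^sup>2) \<longlonglongrightarrow> 0" by simp
    qed
    show "AE \<omega> in M. norm ((norm (E (r k) \<omega> - D \<omega>))\<^sup>2) \<le> C2\<^sup>2" for k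
      by (auto intro!: AE_I2 power_mono bd3)
  qed auto
  then have "(\<lambda>k. ennreal (\<integral>\<omega>. (norm (E (r k) \<omega> - D \<omega>))\<^sup>2 \<partial>M)) \<longlonglongrightarrow> ennreal 0"
    by (intro tendsto_ennrealI) simp
  then have "(\<lambda>k. \<integral>\<^sup>+\<omega>. ennreal ((norm (E (r k) \<omega> - D \<omega>))\<^sup>2) \<partial>M) \<longlonglongrightarrow> 0"
    by (simp add: nn_integral_eq_integral i3)
  then show ?thesis using that r D_meas iD nD by blast
qed

text \<open>The infima \<open>d\<close> of the mean squared derivative over the hulls of the tails
  increase and stay below \<open>C\<^sup>2\<close>, so they converge, and near-minimizers are then
  forced to be Cauchy. The predicate \<open>P\<close> carries along what must survive midpoints:
  being a cylindrical variable paired with its own derivative, with all directions taken from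
  \<open>h\<close>.\<close>

lemma (in prob_space) malliavin_domain_bounded_deriv:
  fixes X :: "'h::{real_inner,complete_space} \<Rightarrow> 'a \<Rightarrow> real"
  assumes P: "\<And>k. P (Fs k) (Ds k)"
    and Pmid: "\<And>F D F' D'. P F D \<Longrightarrow> P F' D' \<Longrightarrow>
      P (\<lambda>\<omega>. (F \<omega> + F' \<omega>) / 2) (\<lambda>\<omega>. (1/2) *\<^sub>R D \<omega> + (1/2) *\<^sub>R D' \<omega>)"
    and Pcyl: "\<And>F D. P F D \<Longrightarrow> cylindrical_deriv M X F D"
    and Pfc: "\<And>F D. P F D \<Longrightarrow> fin_comb M h D"
    and bd: "\<And>k \<omega>. \<omega> \<in> space M \<Longrightarrow> norm (Ds k \<omega>) \<le> C"
    and Fsm: "\<And>k. Fs k \<in> borel_measurable M"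
    and Fm: "F \<in> borel_measurable M" and Fi: "integrable M (\<lambda>\<omega>. (F \<omega>)\<^sup>2)"
    and lim: "(\<lambda>k. \<integral>\<^sup>+\<omega>. ennreal ((Fs k \<omega> - F \<omega>)\<^sup>2) \<partial>M) \<longlonglongrightarrow> 0"
  shows "F \<in> malliavin_domain M X"
proof -
  have hullP: "P G E" if "mid_hull Fs Ds n G E" for n G E
    using that by induction (auto intro: P Pmid)
  have hullbd: "norm (E \<omega>) \<le> C" if "mid_hull Fs Ds n G E" "\<omega> \<in> space M" for n G E \<omega>
    using that
  proof induction
    case (mid_hull_mid G E G' E')
    have "norm ((1/2) *\<^sub>R E \<omega> + (1/2) *\<^sub>R E' \<omega>) \<le> norm ((1/2) *\<^sub>R E \<omega>) + norm ((1/2) *\<^sub>R E' \<omega>)"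
      by (rule norm_triangle_ineq)
    then show ?case using mid_hull_mid by simp
  qed (rule bd)
  define I where "I E = (\<integral>\<omega>. (norm (E \<omega>))\<^sup>2 \<partial>M)" for E :: "'a \<Rightarrow> 'h"
  define S where "S n = {I E | G E. mid_hull Fs Ds n G E}" for n
  define d where "d n = Inf (S n)" for n
  have S_ne: "S n \<noteq> {}" for n unfolding S_def using mid_hull_base[of n n] by blast
  have S_bdd: "bdd_below (S n)" for n
    by (rule bdd_belowI[of _ 0]) (auto simp: S_def I_def)
  have S_mono: "S m \<subseteq> S n" if "n \<le> m" for n m
    unfolding S_def using mid_hull_mono[OF _ that] by blast
  have d_mono: "d n \<le> d m" if "n \<le> m" for n m
    unfolding d_def by (rule cInf_superset_mono) (use S_ne S_bdd S_mono that in auto)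
  have norm_m: "(\<lambda>\<omega>. norm (E \<omega>)) \<in> borel_measurable M" if "fin_comb M h E" for E
    by (rule measurable_compose[OF fin_comb_measurable[OF that] borel_measurable_continuous_onI])
      (intro continuous_intros)
  have norm_i: "integrable M (\<lambda>\<omega>. (norm (E \<omega>))\<^sup>2)"
    if "fin_comb M h E" and "\<And>\<omega>. \<omega> \<in> space M \<Longrightarrow> norm (E \<omega>) \<le> c" for E c
    by (rule integrable_const_bound[where B = "c\<^sup>2"])
      (use norm_m[OF that(1)] that(2) in \<open>auto intro!: AE_I2 power_mono\<close>)
  have d_le: "d n \<le> C\<^sup>2" for n
  proof -
    have "d n \<le> I (Ds n)" unfolding d_def
      by (rule cInf_lower[OF _ S_bdd]) (use mid_hull_base[of n n] in \<open>auto simp: S_def\<close>)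
    also have "\<dots> \<le> (\<integral>\<omega>. C\<^sup>2 \<partial>M)" unfolding I_def
      using norm_i[OF Pfc[OF P] bd] by (intro integral_mono) (auto intro!: power_mono bd)
    finally show ?thesis by (simp add: prob_space)
  qed
  have "\<exists>G E. mid_hull Fs Ds n G E \<and> I E < d n + 1 / real (Suc n)" for n
  proof -
    have "Inf (S n) < d n + 1 / real (Suc n)" by (simp add: d_def)
    then obtain x where "x \<in> S n" "x < d n + 1 / real (Suc n)"
      using cInf_less_iff[OF S_ne S_bdd] by blast
    then show ?thesis by (auto simp: S_def)
  qed
  then obtain G E where GE: "\<And>n. mid_hull Fs Ds n (G n) (E n)"
    and IE: "\<And>n. I (E n) < d n + 1 / real (Suc n)" by metis
  have fcE: "fin_comb M h (E n)" for n using Pfc hullP GE by blast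
  have bdE: "norm (E n \<omega>) \<le> C" if "\<omega> \<in> space M" for n \<omega> using hullbd GE that by blast
  have est: "I (\<lambda>\<omega>. E n \<omega> - E m \<omega>) \<le> 2 * (d m - d n) + 4 / real (Suc n)" if "n \<le> m" for n m
  proof -
    define A where "A \<omega> = (1/2) *\<^sub>R E n \<omega> + (1/2) *\<^sub>R E m \<omega>" for \<omega>
    \<comment> \<open>Both near-minimizers lie in the hull of the tail from the smaller index
      \<open>n\<close>, so their midpoint has mean square at least \<open>d n\<close>; the
      parallelogram law turns this into closeness.\<close>
    have hA: "mid_hull Fs Ds n (\<lambda>\<omega>. (G n \<omega> + G m \<omega>) / 2) A"
      unfolding A_def by (intro mid_hull_mid GE mid_hull_mono[OF GE that])
    then have "d n \<le> I A"
      unfolding d_def by (intro cInf_lower S_bdd) (auto simp: S_def)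
    have pt: "(norm (E n \<omega> - E m \<omega>))\<^sup>2 = 2 * (norm (E n \<omega>))\<^sup>2 + 2 * (norm (E m \<omega>))\<^sup>2 - 4 * (norm (A \<omega>))\<^sup>2" for \<omega>
      unfolding power2_norm_eq_inner A_def
      by (simp add: inner_add inner_diff inner_commute algebra_simps)
    have "I (\<lambda>\<omega>. E n \<omega> - E m \<omega>) = 2 * I (E n) + 2 * I (E m) - 4 * I A"
      unfolding I_def pt using norm_i[OF fcE bdE] norm_i[OF Pfc[OF hullP[OF hA]] hullbd[OF hA]]
      by simp
    moreover have "1 / real (Suc m) \<le> 1 / real (Suc n)" using that by (intro divide_left_mono) auto
    ultimately show ?thesis using \<open>d n \<le> I A\<close> IE[of n] IE[of m] by (simp add: add_divide_distrib)
  qed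
  obtain L where "d \<longlonglongrightarrow> L"
    by (rule incseq_convergent[of d "C\<^sup>2"]) (use d_mono d_le in \<open>auto simp: incseq_def\<close>)
  then have d_cau: "Cauchy d" by (rule LIMSEQ_imp_Cauchy)
  obtain r D where r: "strict_mono r" and Dm: "D \<in> borel_measurable M"
    and Di: "integrable M (\<lambda>\<omega>. (norm (D \<omega>))\<^sup>2)"
    and nm [measurable]: "\<And>k. (\<lambda>\<omega>. norm (E (r k) \<omega> - D \<omega>)) \<in> borel_measurable M"
    and Dlim: "(\<lambda>k. \<integral>\<^sup>+\<omega>. ennreal ((norm (E (r k) \<omega> - D \<omega>))\<^sup>2) \<partial>M) \<longlonglongrightarrow> 0"
  proof (rule L2_Cauchy_bounded_limit[of h E C])
    fix \<epsilon> :: real assume e: "\<epsilon> > 0"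
    obtain N1 where N1: "\<And>n m. N1 \<le> n \<Longrightarrow> N1 \<le> m \<Longrightarrow> dist (d n) (d m) < \<epsilon> / 4"
      using metric_CauchyD[OF d_cau, of "\<epsilon>/4"] e by auto
    obtain N2 :: nat where N2: "8 / \<epsilon> < real N2" using reals_Archimedean2 by blast
    have "I (\<lambda>\<omega>. E n \<omega> - E m \<omega>) < \<epsilon>" if "max N1 N2 \<le> n" "n \<le> m" for n m
    proof -
      have "4 / real (Suc n) < \<epsilon> / 2"
      proof -
        have "8 / \<epsilon> < real (Suc n)" using N2 that by simp
        then show ?thesis using e by (simp add: field_simps)
      qed
      moreover have "d m - d n < \<epsilon> / 4" using N1[of m n] that
        by (metis abs_ge_self dist_real_def le_less_trans le_trans max.bounded_iff)
      ultimately show ?thesis using est[OF that(2)] by argo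
    qed
    then show "\<exists>N. \<forall>n\<ge>N. \<forall>m\<ge>n. (\<integral>\<omega>. (norm (E n \<omega> - E m \<omega>))\<^sup>2 \<partial>M) < \<epsilon>"
      unfolding I_def by blast
  qed (use fcE bdE in auto)
  have Gm [measurable]: "G n \<in> borel_measurable M" for n
    using mid_hull_approx[OF GE Fsm Fm, where c = top] by simp
  have Glim: "(\<lambda>k. \<integral>\<^sup>+\<omega>. ennreal ((G (r k) \<omega> - F \<omega>)\<^sup>2) \<partial>M) \<longlonglongrightarrow> 0"
  proof (rule order_tendstoI)
    fix a :: ennreal assume "0 < a"
    then obtain b where b: "0 < b" "b < a" using dense by blast
    obtain K where K: "\<And>k. K \<le> k \<Longrightarrow> (\<integral>\<^sup>+\<omega>. ennreal ((Fs k \<omega> - F \<omega>)\<^sup>2) \<partial>M) < b"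
      using order_tendstoD(2)[OF lim b(1)] unfolding eventually_sequentially by blast
    have "(\<integral>\<^sup>+\<omega>. ennreal ((G (r k) \<omega> - F \<omega>)\<^sup>2) \<partial>M) < a" if "K \<le> k" for k
    proof -
      have "K \<le> r k" using seq_suble[OF r, of k] that by simp
      then have "(\<integral>\<^sup>+\<omega>. ennreal ((G (r k) \<omega> - F \<omega>)\<^sup>2) \<partial>M) \<le> b"
        by (intro conjunct2[OF mid_hull_approx[OF GE Fsm Fm]]) (simp add: K less_imp_le)
      then show ?thesis using b(2) by simp
    qed
    then show "\<forall>\<^sub>F k in sequentially. (\<integral>\<^sup>+\<omega>. ennreal ((G (r k) \<omega> - F \<omega>)\<^sup>2) \<partial>M) < a"
      unfolding eventually_sequentially by blast
  qed simp
  have "(\<lambda>k. \<integral>\<^sup>+\<omega>. ennreal ((G (r k) \<omega> - F \<omega>)\<^sup>2 + (norm (E (r k) \<omega> - D \<omega>))\<^sup>2) \<partial>M) \<longlonglongrightarrow> 0"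
  proof -
    have "(\<integral>\<^sup>+\<omega>. ennreal ((G (r k) \<omega> - F \<omega>)\<^sup>2 + (norm (E (r k) \<omega> - D \<omega>))\<^sup>2) \<partial>M)
       = (\<integral>\<^sup>+\<omega>. ennreal ((G (r k) \<omega> - F \<omega>)\<^sup>2) \<partial>M)
         + (\<integral>\<^sup>+\<omega>. ennreal ((norm (E (r k) \<omega> - D \<omega>))\<^sup>2) \<partial>M)" for k
      using Fm by (simp add: ennreal_plus nn_integral_add)
    then show ?thesis using tendsto_add[OF Glim Dlim] by simp
  qed
  then have "malliavin_deriv M X F D"
    unfolding malliavin_deriv_def using Fm Fi Dm Di Pcyl[OF hullP[OF GE]]
    by (intro conjI exI[of _ "\<lambda>k. G (r k)"] exI[of _ "\<lambda>k. E (r k)"]) auto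
  then show ?thesis unfolding malliavin_domain_def by blast
qed

section \<open>The isonormal process of the Wiener process\<close>

lemma to_L2_lincomb:
  assumes "f \<in> sq_int01" "g \<in> sq_int01"
  shows "to_L2 (\<lambda>s. a * f s + b * g s) = a *\<^sub>R to_L2 f + b *\<^sub>R to_L2 g"
proof -
  have r: "L2_rel f f" "L2_rel g g" using assms by (auto simp: L2_rel_def)
  have r': "L2_rel (\<lambda>s. a * f s) (\<lambda>s. a * f s)" "L2_rel (\<lambda>s. b * g s) (\<lambda>s. b * g s)"
    using sq_int01_scale assms by (auto simp: L2_rel_def)
  have "(\<lambda>s. a * f s + b * g s) \<in> sq_int01"
    by (intro sq_int01_add sq_int01_scale assms)
  then have "to_L2 (\<lambda>s. a * f s + b * g s) = abs_L2 (\<lambda>s. a * f s + b * g s)"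
    unfolding to_L2_def by (simp only: if_True)
  also have "\<dots> = abs_L2 (\<lambda>s. a * f s) + abs_L2 (\<lambda>s. b * g s)"
    by (rule plus_L2.abs_eq[symmetric]) (rule r')+
  also have "\<dots> = a *\<^sub>R abs_L2 f + b *\<^sub>R abs_L2 g"
    by (simp only: scaleR_L2.abs_eq[OF r(1)] scaleR_L2.abs_eq[OF r(2)])
  finally show ?thesis using assms unfolding to_L2_def by (simp only: if_True)
qed

lemma sq_int01_bounded:
  assumes "f \<in> borel_measurable leb01" "\<And>s. \<bar>f s\<bar> \<le> c"
  shows "f \<in> sq_int01"
proof -
  have "(f s)\<^sup>2 \<le> c\<^sup>2" for s using assms(2)[of s] by (rule abs_le_square_iff[THEN iffD1, OF order_trans[OF _ abs_ge_self]])
  then have "integrable leb01 (\<lambda>s. (f s)\<^sup>2)"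
    by (intro finite_measure.integrable_const_bound[OF finite_measure_leb01, where B = "c\<^sup>2"])
      (use assms in auto)
  then show ?thesis using assms by (simp add: sq_int01_def)
qed

lemma to_L2_tendsto:
  assumes f: "\<And>n. f n \<in> sq_int01" and g: "g \<in> sq_int01" and w: "w \<in> sq_int01"
    and lim: "\<And>s. s \<in> {0..1} \<Longrightarrow> (\<lambda>n. f n s) \<longlonglongrightarrow> g s"
    and bd: "\<And>n s. s \<in> {0..1} \<Longrightarrow> \<bar>f n s - g s\<bar> \<le> w s"
  shows "(\<lambda>n. to_L2 (f n)) \<longlonglongrightarrow> to_L2 g"
proof -
  have [measurable]: "f n \<in> borel_measurable leb01" "g \<in> borel_measurable leb01" for n
    using f g by (auto intro: sq_int01_measurable)
  have sp: "space leb01 = {0..1}" by (simp add: space_restrict_space)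
  have "(\<lambda>n. \<integral>s. (f n s - g s)\<^sup>2 \<partial>leb01) \<longlonglongrightarrow> (\<integral>s. 0 \<partial>leb01)"
  proof (rule integral_dominated_convergence[where w = "\<lambda>s. (w s)\<^sup>2"])
    show "AE s in leb01. (\<lambda>n. (f n s - g s)\<^sup>2) \<longlonglongrightarrow> 0"
    proof (rule AE_I2)
      fix s assume "s \<in> space leb01"
      then have "(\<lambda>n. (f n s - g s)\<^sup>2) \<longlonglongrightarrow> (g s - g s)\<^sup>2"
        using sp by (intro tendsto_intros lim) auto
      then show "(\<lambda>n. (f n s - g s)\<^sup>2) \<longlonglongrightarrow> 0" by simp
    qed
    show "AE s in leb01. norm ((f n s - g s)\<^sup>2) \<le> (w s)\<^sup>2" for n
    proof (rule AE_I2)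
      fix s assume "s \<in> space leb01"
      then have "\<bar>f n s - g s\<bar> \<le> w s" using bd sp by auto
      then have "\<bar>f n s - g s\<bar>\<^sup>2 \<le> (w s)\<^sup>2" by (rule power_mono) simp
      then show "norm ((f n s - g s)\<^sup>2) \<le> (w s)\<^sup>2" by simp
    qed
    show "integrable leb01 (\<lambda>s. (w s)\<^sup>2)" using w by (rule sq_int01_sq)
  qed auto
  then have "(\<lambda>n. (norm (to_L2 (f n) - to_L2 g))\<^sup>2) \<longlonglongrightarrow> 0"
    using norm_to_L2_diff[OF f g] by simp
  then have "(\<lambda>n. sqrt ((norm (to_L2 (f n) - to_L2 g))\<^sup>2)) \<longlonglongrightarrow> sqrt 0"
    by (rule tendsto_real_sqrt)
  then have "(\<lambda>n. norm (to_L2 (f n) - to_L2 g)) \<longlonglongrightarrow> 0" by simp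
  then show ?thesis by (rule LIM_zero_cancel[OF tendsto_norm_zero_cancel])
qed

section \<open>Density of the step functions in the square-integrable functions\<close>

lemma sq_int01_indicator: "A \<in> sets borel \<Longrightarrow> indicator A \<in> sq_int01"
proof (rule sq_int01_bounded[where c = 1])
  assume "A \<in> sets borel"
  then show "indicator A \<in> borel_measurable leb01"
    by (intro measurable_restrict_space1) simp
qed (auto simp: indicator_def)

lemma closure_span_lincomb:
  fixes S :: "'a::real_normed_vector set"
  assumes "x \<in> closure (span S)" "y \<in> closure (span S)"
  shows "a *\<^sub>R x + b *\<^sub>R y \<in> closure (span S)"
proof -
  obtain f g where f: "\<And>n. f n \<in> span S" "f \<longlonglongrightarrow> x" and g: "\<And>n. g n \<in> span S" "g \<longlonglongrightarrow> y"
    using assms unfolding closure_sequential by blast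
  have "(\<lambda>n. a *\<^sub>R f n + b *\<^sub>R g n) \<longlonglongrightarrow> a *\<^sub>R x + b *\<^sub>R y" by (intro tendsto_intros f g)
  moreover have "a *\<^sub>R f n + b *\<^sub>R g n \<in> span S" for n by (intro span_add span_scale f g)
  ultimately show ?thesis unfolding closure_sequential
    by (intro exI[of _ "\<lambda>n. a *\<^sub>R f n + b *\<^sub>R g n"]) auto
qed

text \<open>Half-lines form an intersection-stable generator of the Borel sets. The sets whose
  indicator belongs to the closed span contain the half-lines, and are stable under complements by
  linearity and under countable disjoint unions by dominated convergence.\<close>

lemma to_L2_indicator_in_closure:
  assumes "A \<in> sets borel"
  shows "to_L2 (indicator A) \<in> closure (span (L2_ind ` {0..1}))"
proof -
  let ?V = "closure (span (L2_ind ` {0..1}))"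
  have eq: "to_L2 f = to_L2 g" if "f \<in> sq_int01" "g \<in> sq_int01" "\<And>s. s \<in> {0..1} \<Longrightarrow> f s = g s" for f g
  proof -
    have "L2_rel f g" using that by (auto simp: L2_rel_def space_restrict_space intro!: AE_I2)
    then have "abs_L2 f = abs_L2 g"
      using Quotient3_rel[OF Quotient3_L2, of f g] by simp
    then show ?thesis using that unfolding to_L2_def by simp
  qed
  have Vin: "L2_ind t \<in> ?V" if "t \<in> {0..1}" for t
    using that span_base[of "L2_ind t" "L2_ind ` {0..1}"] closure_subset by blast
  have one: "to_L2 (indicator UNIV) \<in> ?V"
  proof -
    have "to_L2 (indicator UNIV) = L2_ind 1"
      unfolding L2_ind_def by (rule eq) (rule sq_int01_indicator; simp | simp add: indicator_def)+
    then show ?thesis using Vin by simp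
  qed
  have zero: "0 \<in> ?V" using span_zero closure_subset by blast
  have "A \<in> sigma_sets UNIV (range (\<lambda>t. {..t}))"
    using assms by (metis borel_eq_atMost sets_measure_of_conv subset_UNIV top_greatest Pow_UNIV)
  then show ?thesis
  proof (rule sigma_sets_induct_disjoint[where P = "\<lambda>A. to_L2 (indicator A) \<in> ?V", rotated 2])
    show "Int_stable (range (\<lambda>t::real. {..t}))"
      by (auto simp: Int_stable_def)
    show "range (\<lambda>t::real. {..t}) \<subseteq> Pow UNIV" by simp
  next
    fix A :: "real set" assume "A \<in> range (\<lambda>t. {..t})"
    then obtain t where A: "A = {..t}" by auto
    consider "t < 0" | "0 \<le> t" "t \<le> 1" | "1 < t" by linarith
    then show "to_L2 (indicator A) \<in> ?V"
    proof cases
      case 1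
      have "to_L2 (indicator A) = to_L2 (\<lambda>s. 0 * 0 + 0 * 0)"
        by (rule eq) (use 1 A in \<open>auto intro!: sq_int01_indicator sq_int01_zero simp: indicator_def\<close>)
      also have "\<dots> = 0" using to_L2_lincomb[OF sq_int01_zero sq_int01_zero, of 0 0] by simp
      finally show ?thesis using zero by simp
    next
      case 2
      have "to_L2 (indicator A) = L2_ind t" unfolding L2_ind_def
        by (rule eq) (use 2 A in \<open>auto intro!: sq_int01_indicator simp: indicator_def\<close>)
      then show ?thesis using Vin 2 by simp
    next
      case 3
      have "to_L2 (indicator A) = to_L2 (indicator UNIV)"
        by (rule eq) ((rule sq_int01_indicator; use A in simp) | use 3 A in \<open>simp add: indicator_def\<close>)+
      then show ?thesis using one by simp
    qed
  next
    have "to_L2 (indicator {}) = to_L2 (\<lambda>s. 0 * 0 + 0 * 0)"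
      by (rule eq) (auto intro!: sq_int01_indicator sq_int01_zero)
    also have "\<dots> = 0" using to_L2_lincomb[OF sq_int01_zero sq_int01_zero, of 0 0] by simp
    finally show "to_L2 (indicator {}) \<in> ?V" using zero by simp
  next
    fix A assume A: "A \<in> sigma_sets UNIV (range (\<lambda>t::real. {..t}))" and V: "to_L2 (indicator A) \<in> ?V"
    have Ab: "A \<in> sets borel"
      using A by (metis borel_eq_atMost sets_measure_of_conv subset_UNIV top_greatest Pow_UNIV)
    have "to_L2 (indicator (UNIV - A)) = to_L2 (\<lambda>s. 1 * indicator UNIV s + (-1) * indicator A s)"
    proof (rule eq)
      show "(\<lambda>s. 1 * indicator UNIV s + (-1) * indicator A s) \<in> sq_int01"
        by (rule sq_int01_add[OF sq_int01_scale[OF sq_int01_indicator] sq_int01_scale[OF sq_int01_indicator[OF Ab]]]) simp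
      show "indicator (UNIV - A) \<in> sq_int01" by (rule sq_int01_indicator) (use Ab in auto)
    qed (simp add: indicator_def)
    also have "\<dots> = 1 *\<^sub>R to_L2 (indicator UNIV) + (-1) *\<^sub>R to_L2 (indicator A)"
      by (rule to_L2_lincomb[OF sq_int01_indicator sq_int01_indicator]) (use Ab in auto)
    finally show "to_L2 (indicator (UNIV - A)) \<in> ?V"
      using closure_span_lincomb[OF one V, of 1 "-1"] by simp
  next
    fix A :: "nat \<Rightarrow> real set"
    assume d: "disjoint_family A" and rA: "range A \<subseteq> sigma_sets UNIV (range (\<lambda>t::real. {..t}))"
      and V: "\<And>i. to_L2 (indicator (A i)) \<in> ?V"
    have Ab: "A i \<in> sets borel" for i
      using rA by (metis borel_eq_atMost sets_measure_of_conv subset_UNIV top_greatest Pow_UNIV range_subsetD)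
    have fin: "to_L2 (indicator (\<Union>i<n. A i)) \<in> ?V" for n :: nat
    proof (induction n)
      case 0
      have "to_L2 (indicator {}) = to_L2 (\<lambda>s. 0 * 0 + 0 * 0)"
        by (rule eq) (auto intro!: sq_int01_indicator sq_int01_zero)
      also have "\<dots> = 0" using to_L2_lincomb[OF sq_int01_zero sq_int01_zero, of 0 0] by simp
      finally have "to_L2 (indicator {}) \<in> ?V" using zero by simp
      then show ?case by (simp only: lessThan_0 UN_empty)
    next
      case (Suc n)
      define B where "B = (\<Union>i<n. A i)"
      have Bb: "B \<in> sets borel" unfolding B_def using Ab by auto
      have "A n \<inter> A i = {}" if "i < n" for i
        using disjoint_family_onD[OF d, of n i] that by auto
      then have disj: "A n \<inter> B = {}" unfolding B_def by blast
      have "to_L2 (indicator (A n \<union> B)) = to_L2 (\<lambda>s. 1 * indicator B s + 1 * indicator (A n) s)"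
      proof (rule eq)
        show "(\<lambda>s. 1 * indicator B s + 1 * indicator (A n) s) \<in> sq_int01"
          by (rule sq_int01_add[OF sq_int01_scale[OF sq_int01_indicator[OF Bb]]
                sq_int01_scale[OF sq_int01_indicator[OF Ab]]])
        show "indicator (A n \<union> B) \<in> sq_int01" by (rule sq_int01_indicator) (use Ab Bb in auto)
        show "indicator (A n \<union> B) s = 1 * indicator B s + 1 * (indicator (A n) s :: real)" for s
          using disj by (auto simp: indicator_def)
      qed
      also have "\<dots> = 1 *\<^sub>R to_L2 (indicator B) + 1 *\<^sub>R to_L2 (indicator (A n))"
        by (rule to_L2_lincomb[OF sq_int01_indicator[OF Bb] sq_int01_indicator[OF Ab]])
      finally have "to_L2 (indicator (A n \<union> B)) \<in> ?V"
        using closure_span_lincomb[OF Suc V, of 1 1 n] by (simp add: B_def)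
      moreover have "(\<Union>i<Suc n. A i) = A n \<union> B" by (auto simp: B_def less_Suc_eq)
      ultimately show ?case by simp
    qed
    have lim: "(\<lambda>n. to_L2 (indicator (\<Union>i<n. A i))) \<longlonglongrightarrow> to_L2 (indicator (\<Union>i. A i))"
    proof (rule to_L2_tendsto[where w = "\<lambda>_. 1"])
      show "(\<lambda>n. indicator (\<Union>i<n. A i) s :: real) \<longlonglongrightarrow> indicator (\<Union>i. A i) s" for s
        by (rule LIMSEQ_indicator_UN)
      show "(\<lambda>_. 1) \<in> sq_int01" by (rule sq_int01_bounded[where c = 1]) auto
      show "indicator (\<Union>i<n. A i) \<in> sq_int01" for n
        by (rule sq_int01_indicator) (use Ab in auto)
      show "indicator (\<Union>i. A i) \<in> sq_int01"
        by (rule sq_int01_indicator) (use Ab in auto)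
    qed (simp add: indicator_def)
    show "to_L2 (indicator (\<Union>(range A))) \<in> ?V"
      by (rule closed_sequentially[OF closed_closure _ lim]) (rule fin)
  qed
qed

text \<open>Reduction to indicators through simple functions that converge pointwise with a
  square-integrable majorant.\<close>

lemma span_L2_ind_dense: "closure (span (L2_ind ` {0..1})) = UNIV"
proof -
  let ?V = "closure (span (L2_ind ` {0..1}))"
  have "to_L2 f \<in> ?V" if f: "f \<in> sq_int01" for f
  proof -
    \<comment> \<open>Extension by 0 to the whole line, where the approximating simple functions
      live.\<close>
    define f' where "f' s = indicator {0..1} s * f s" for s
    have f': "f' \<in> borel_measurable borel"
      using sq_int01_measurable[OF f] unfolding f'_def
      by (subst (asm) borel_measurable_restrict_space_iff) auto
    obtain F where F: "\<And>i. simple_function borel (F i)"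
      "\<And>x. (\<lambda>i. F i x) \<longlonglongrightarrow> f' x" "\<And>i x. norm (F i x) \<le> 2 * norm (f' x)"
      using borel_measurable_implies_sequence_metric[OF f', of 0] by (auto simp: dist_norm)
    have Fs: "F i \<in> sq_int01 \<and> to_L2 (F i) \<in> ?V" for i
    proof -
      have "finite T \<Longrightarrow> (\<lambda>x. \<Sum>y\<in>T. y * indicator (F i -` {y}) x) \<in> sq_int01 \<and>
          to_L2 (\<lambda>x. \<Sum>y\<in>T. y * indicator (F i -` {y}) x) \<in> ?V" for T
      proof (induction rule: finite_induct)
        case empty
        have "to_L2 (\<lambda>_. 0) = 0"
          using to_L2_lincomb[OF sq_int01_zero sq_int01_zero, of 0 0] by simp
        then show ?case using sq_int01_zero span_zero closure_subset by auto
      next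
        case (insert y T)
        have m: "F i -` {y} \<in> sets borel"
          by (rule measurable_sets_borel[OF borel_measurable_simple_function[OF F(1)]]) simp
        note I = sq_int01_indicator[OF m]
        have "to_L2 (\<lambda>x. y * indicator (F i -` {y}) x + 1 * (\<Sum>y\<in>T. y * indicator (F i -` {y}) x)) =
            y *\<^sub>R to_L2 (indicator (F i -` {y})) + 1 *\<^sub>R to_L2 (\<lambda>x. \<Sum>y\<in>T. y * indicator (F i -` {y}) x)"
          by (rule to_L2_lincomb) (use I insert in auto)
        moreover have "(\<lambda>x. \<Sum>y\<in>insert y T. y * indicator (F i -` {y}) x) =
            (\<lambda>x. y * indicator (F i -` {y}) x + 1 * (\<Sum>y\<in>T. y * indicator (F i -` {y}) x))"
          by (simp only: sum.insert[OF insert.hyps] mult_1)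
        ultimately show ?case
          using insert.IH closure_span_lincomb[OF to_L2_indicator_in_closure[OF m], of _ y 1]
            sq_int01_add[OF sq_int01_scale[OF I, of y]] by (simp only: mult_1 simp_thms)
      qed
      moreover have "finite (F i ` UNIV)" using simple_functionD(1)[OF F(1)] by simp
      moreover have "F i = (\<lambda>x. \<Sum>y\<in>F i ` UNIV. y * indicator (F i -` {y}) x)"
      proof
        fix x
        show "F i x = (\<Sum>y\<in>F i ` UNIV. y * indicator (F i -` {y}) x)"
          using simple_function_indicator_representation_banach[OF F(1)[of i], of x]
          by (simp only: space_borel UNIV_I Int_UNIV_right real_scaleR_def mult.commute)
      qed
      ultimately show ?thesis by metis
    qed
    have fL: "(\<lambda>i. to_L2 (F i)) \<longlonglongrightarrow> to_L2 f"
    \<comment> \<open>The approximants are bounded by twice \<open>\<bar>f s\<bar>\<close>, so the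
      distance from \<open>f\<close> is at most three times it.\<close>
    proof (rule to_L2_tendsto[where w = "\<lambda>s. 3 * \<bar>f s\<bar>"])
      have "(\<lambda>s. \<bar>f s\<bar>) \<in> sq_int01" using f by (auto simp: sq_int01_def)
      then show "(\<lambda>s. 3 * \<bar>f s\<bar>) \<in> sq_int01" by (rule sq_int01_scale)
      show "(\<lambda>n. F n s) \<longlonglongrightarrow> f s" if "s \<in> {0..1}" for s using F(2)[of s] that by (simp add: f'_def)
      show "\<bar>F n s - f s\<bar> \<le> 3 * \<bar>f s\<bar>" if "s \<in> {0..1}" for n s
        using F(3)[of n s] that by (simp add: f'_def)
    qed (use Fs f in auto)
    show ?thesis
      by (rule closed_sequentially[OF closed_closure _ fL]) (use Fs in auto)
  qed
  then show ?thesis using to_L2_surj by (metis UNIV_eq_I)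
qed

section \<open>Coincidence of the isonormal processes of the fractional Brownian motion and of the
  Wiener process\<close>

lemma isometric_extension_dist:
  assumes "isometric_extension M e B X"
  shows "integrable M (\<lambda>\<omega>. (X h \<omega> - X k \<omega>)\<^sup>2)"
    and "(\<integral>\<omega>. (X h \<omega> - X k \<omega>)\<^sup>2 \<partial>M) = (norm (h - k))\<^sup>2"
proof -
  note X = assms[unfolded isometric_extension_def]
  have [measurable]: "X h \<in> borel_measurable M" for h using X by blast
  have "AE \<omega> in M. X (1 *\<^sub>R h + (-1) *\<^sub>R k) \<omega> = 1 * X h \<omega> + (-1) * X k \<omega>" using X by blast
  then have ae: "AE \<omega> in M. (X (h - k) \<omega>)\<^sup>2 = (X h \<omega> - X k \<omega>)\<^sup>2"
    by (rule AE_mp) simp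
  have i: "integrable M (\<lambda>\<omega>. (X (h - k) \<omega>)\<^sup>2)" using X by blast
  show "integrable M (\<lambda>\<omega>. (X h \<omega> - X k \<omega>)\<^sup>2)"
    by (rule integrable_cong_AE_imp[OF i]) (use ae in auto)
  have "(\<integral>\<omega>. (X h \<omega> - X k \<omega>)\<^sup>2 \<partial>M) = (\<integral>\<omega>. (X (h - k) \<omega>)\<^sup>2 \<partial>M)"
    by (rule integral_cong_AE) (use ae in auto)
  also have "\<dots> = (h - k) \<bullet> (h - k)" using X by (simp add: power2_eq_square)
  finally show "(\<integral>\<omega>. (X h \<omega> - X k \<omega>)\<^sup>2 \<partial>M) = (norm (h - k))\<^sup>2" by (simp add: power2_norm_eq_inner)
qed

text \<open>The identity is the definition of \<open>W\<close> on the preimages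
  \<open>\<phi> t\<close> of the indicators, and extends to their span. Their images span a dense
  subspace, so \<open>K h\<close> is close to some \<open>K k\<close> with \<open>k\<close> in that
  span; as \<open>K\<close>, \<open>BH\<close> and \<open>WL\<close> are isometric, all errors are
  then controlled by this one distance.\<close>

lemma Wiener_isonormal_eq:
  assumes BH: "isometric_extension M e B BH" and K: "K_star H e K"
    and W: "associated_Wiener M BH K W" and WL: "isometric_extension M L2_ind W WL"
  shows "AE \<omega> in M. WL (K h) \<omega> = BH h \<omega>"
proof -
  note BH' = BH[unfolded isometric_extension_def] and WL' = WL[unfolded isometric_extension_def]
  have lin: "linear K" and iso: "\<And>h k. K h \<bullet> K k = h \<bullet> k" using K by (auto simp: K_star_def)
  have [measurable]: "BH h \<in> borel_measurable M" for h using BH' by blast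
  have [measurable]: "WL h \<in> borel_measurable M" for h using WL' by blast
  have "\<exists>\<phi>. K \<phi> = L2_ind t \<and> (AE \<omega> in M. W t \<omega> = BH \<phi> \<omega>)" if "t \<in> {0..1}" for t
    using W that unfolding associated_Wiener_def by blast
  then obtain \<phi> where \<phi>: "\<And>t. t \<in> {0..1} \<Longrightarrow> K (\<phi> t) = L2_ind t"
    "\<And>t. t \<in> {0..1} \<Longrightarrow> AE \<omega> in M. W t \<omega> = BH (\<phi> t) \<omega>" by metis
  define S where "S = {h. AE \<omega> in M. WL (K h) \<omega> = BH h \<omega>}"
  have comb: "a *\<^sub>R h + b *\<^sub>R k \<in> S" if "h \<in> S" "k \<in> S" for a b h k
  proof -
    have "AE \<omega> in M. WL (a *\<^sub>R K h + b *\<^sub>R K k) \<omega> = a * WL (K h) \<omega> + b * WL (K k) \<omega>" using WL' by blast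
    moreover have "AE \<omega> in M. BH (a *\<^sub>R h + b *\<^sub>R k) \<omega> = a * BH h \<omega> + b * BH k \<omega>" using BH' by blast
    moreover have "K (a *\<^sub>R h + b *\<^sub>R k) = a *\<^sub>R K h + b *\<^sub>R K k"
      by (simp add: linear_add[OF lin] linear_scale[OF lin])
    ultimately show ?thesis using that unfolding S_def by auto
  qed
  have \<phi>S: "\<phi> t \<in> S" if "t \<in> {0..1}" for t
  proof -
    have "AE \<omega> in M. WL (L2_ind t) \<omega> = W t \<omega>" using WL' that by blast
    with \<phi>(2)[OF that] show ?thesis by (auto simp: S_def \<phi>(1)[OF that])
  qed
  have "subspace S"
    using comb[of _ _ 0 0] comb[of _ _ 1 1] comb[of _ _ _ 0] \<phi>S[of 0]
    by (intro subspaceI) auto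
  then have spS: "span (\<phi> ` {0..1}) \<subseteq> S" using \<phi>S by (intro span_minimal) auto
  define J where "J = (\<integral>\<omega>. (WL (K h) \<omega> - BH h \<omega>)\<^sup>2 \<partial>M)"
  have Ji: "integrable M (\<lambda>\<omega>. (WL (K h) \<omega> - BH h \<omega>)\<^sup>2)"
  proof (rule Bochner_Integration.integrable_bound)
    show "integrable M (\<lambda>\<omega>. 2 * (WL (K h) \<omega>)\<^sup>2 + 2 * (BH h \<omega>)\<^sup>2)"
      using BH' WL' by (intro Bochner_Integration.integrable_add integrable_mult_right) blast+
    have "(a - b)\<^sup>2 \<le> 2 * a\<^sup>2 + 2 * b\<^sup>2" for a b :: real
      using zero_le_power2[of "a + b"] by (simp add: power2_eq_square algebra_simps)
    then show "AE \<omega> in M. norm ((WL (K h) \<omega> - BH h \<omega>)\<^sup>2) \<le> norm (2 * (WL (K h) \<omega>)\<^sup>2 + 2 * (BH h \<omega>)\<^sup>2)"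
      by simp
  qed measurable
  have "J \<le> 4 * \<epsilon>" if \<epsilon>: "\<epsilon> > 0" for \<epsilon>
  proof -
    have "K h \<in> closure (span (L2_ind ` {0..1}))" by (simp add: span_L2_ind_dense)
    then obtain y where y: "y \<in> span (L2_ind ` {0..1})" "dist y (K h) < sqrt \<epsilon>"
      unfolding closure_approachable using real_sqrt_gt_zero[OF \<epsilon>] by blast
    have "L2_ind ` {0..1} = K ` (\<phi> ` {0..1})" using \<phi>(1) by (auto simp: image_image)
    then have "y \<in> K ` span (\<phi> ` {0..1})" using y by (simp add: linear_span_image[OF lin])
    then obtain k where k: "y = K k" "k \<in> S" using spS by blast
    have "(norm (h - k))\<^sup>2 = (norm (K h - K k))\<^sup>2"
      using iso[of "h - k" "h - k"] by (simp add: power2_norm_eq_inner linear_diff[OF lin])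
    moreover have "(norm (K h - K k))\<^sup>2 \<le> (sqrt \<epsilon>)\<^sup>2"
      using y(2) k by (intro power_mono) (auto simp: dist_norm norm_minus_commute)
    ultimately have n: "(norm (K h - K k))\<^sup>2 \<le> \<epsilon>" "(norm (h - k))\<^sup>2 \<le> \<epsilon>" using that by auto
    have "J \<le> (\<integral>\<omega>. 2 * (WL (K h) \<omega> - WL (K k) \<omega>)\<^sup>2 + 2 * (BH h \<omega> - BH k \<omega>)\<^sup>2 \<partial>M)"
      unfolding J_def
    proof (rule integral_mono_AE[OF Ji])
      show "integrable M (\<lambda>\<omega>. 2 * (WL (K h) \<omega> - WL (K k) \<omega>)\<^sup>2 + 2 * (BH h \<omega> - BH k \<omega>)\<^sup>2)"
        by (intro Bochner_Integration.integrable_add integrable_mult_right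
            isometric_extension_dist(1)[OF BH] isometric_extension_dist(1)[OF WL])
      have "AE \<omega> in M. WL (K k) \<omega> = BH k \<omega>" using k by (simp add: S_def)
      then show "AE \<omega> in M. (WL (K h) \<omega> - BH h \<omega>)\<^sup>2
          \<le> 2 * (WL (K h) \<omega> - WL (K k) \<omega>)\<^sup>2 + 2 * (BH h \<omega> - BH k \<omega>)\<^sup>2"
      proof eventually_elim
        fix \<omega> assume "WL (K k) \<omega> = BH k \<omega>"
        moreover have "(a - b)\<^sup>2 \<le> 2 * (a - c)\<^sup>2 + 2 * (b - c)\<^sup>2" for a b c :: real
          using zero_le_power2[of "a + b - 2 * c"] by (simp add: power2_eq_square algebra_simps)
        ultimately show "(WL (K h) \<omega> - BH h \<omega>)\<^sup>2
          \<le> 2 * (WL (K h) \<omega> - WL (K k) \<omega>)\<^sup>2 + 2 * (BH h \<omega> - BH k \<omega>)\<^sup>2" by simp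
      qed
    qed
    also have "\<dots> = 2 * (norm (K h - K k))\<^sup>2 + 2 * (norm (h - k))\<^sup>2"
      using isometric_extension_dist[OF BH, of h k] isometric_extension_dist[OF WL, of "K h" "K k"] by simp
    finally show ?thesis using n by simp
  qed
  \<comment> \<open>The estimate then reads \<open>J \<le> J / 2\<close>, which excludes a positive
    \<open>J\<close>.\<close>
  from this[of "J / 8"] have "J \<le> 0" by (cases "J > 0") auto
  moreover have "0 \<le> J" by (simp add: J_def)
  ultimately have "J = 0" by simp
  then have "AE \<omega> in M. (WL (K h) \<omega> - BH h \<omega>)\<^sup>2 = 0"
    unfolding J_def using Ji by (subst (asm) integral_nonneg_eq_0_iff_AE) auto
  then show ?thesis by simp
qed

section \<open>The equation\<close>

lemma elem_fun_measurable:
  assumes "elem_fun n f" and "\<And>i. i < n \<Longrightarrow> V i \<in> borel_measurable M"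
  shows "(\<lambda>\<omega>. f (\<lambda>i. V i \<omega>)) \<in> borel_measurable M"
proof -
  define V' where "V' i = (if i < n then V i else (\<lambda>_. 0))" for i
  have "(\<lambda>\<omega> i. V' i \<omega>) \<in> borel_measurable M"
    by (rule measurable_coordinatewise_then_product) (use assms(2) in \<open>auto simp: V'_def\<close>)
  then have "(\<lambda>\<omega>. f (\<lambda>i. V' i \<omega>)) \<in> borel_measurable M"
    by (rule measurable_compose[OF _ borel_measurable_continuous_onI[OF elem_fun_continuous[OF assms(1)]]])
  moreover have "f (\<lambda>i. V' i \<omega>) = f (\<lambda>i. V i \<omega>)" for \<omega>
    by (rule elem_fun_cong[OF assms(1)]) (simp add: V'_def)
  ultimately show ?thesis by simp
qed

text \<open>\<open>enc\<close> relocates the noise variables. Schemes on different meshes can thus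
  occupy different entries of one common sequence, as \<open>fin_comb\<close> and the midpoints
  require.\<close>

lemma elem_fun_scheme:
  assumes g: "\<And>k f. elem_fun m f \<Longrightarrow> elem_fun m (\<lambda>w. g k (f w))"
    and enc: "\<And>k. k \<le> n \<Longrightarrow> enc k < m" and "j \<le> n"
  shows "elem_fun m (\<lambda>v. scheme g \<sigma> x0 j (\<lambda>k. v (enc k)))"
  using \<open>j \<le> n\<close>
proof (induction j)
  case (Suc j)
  then show ?case
    by (auto intro!: elem_diff elem_mult elem_const g elem_coord enc)
qed (auto intro: elem_const)

section \<open>Gradients of cylindrical functions over a fixed sequence of directions\<close>

lemma partial_d_outside:
  assumes "elem_fun n f" "n \<le> i"
  shows "partial_d i f v = 0"
proof -
  have "f (v(i := y)) = f v" for y by (rule elem_fun_cong[OF assms(1)]) (use assms(2) in auto)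
  then show ?thesis by (simp add: partial_d_def)
qed

text \<open>The derivative in \<open>cylindrical_deriv\<close> with the directions held fixed, so
  that derivatives of different functionals can be averaged once both are viewed as functions of the
  same number of variables.\<close>

definition gradient :: "(nat \<Rightarrow> 'h::real_vector) \<Rightarrow> nat \<Rightarrow> ((nat \<Rightarrow> real) \<Rightarrow> real) \<Rightarrow> (nat \<Rightarrow> real) \<Rightarrow> 'h" where
  "gradient h n f v = (\<Sum>i<n. partial_d i f v *\<^sub>R h i)"

lemma gradient_extend:
  assumes "elem_fun n f" "n \<le> m"
  shows "gradient h m f v = gradient h n f v"
  unfolding gradient_def
  by (rule sum.mono_neutral_right) (use assms partial_d_outside[OF assms(1)] in auto)

lemma gradient_midpoint:
  assumes "elem_fun n f" "elem_fun n g"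
  shows "gradient h n (\<lambda>v. (f v + g v) / 2) v = (1/2) *\<^sub>R gradient h n f v + (1/2) *\<^sub>R gradient h n g v"
proof -
  have "partial_d i (\<lambda>v. (f v + g v) / 2) v = (partial_d i f v + partial_d i g v) / 2" for i
    unfolding partial_d_def[of i "\<lambda>v. (f v + g v) / 2"]
    by (rule DERIV_imp_deriv)
      (intro DERIV_cdivide DERIV_add elem_fun_partial_d(2)[OF assms(1)] elem_fun_partial_d(2)[OF assms(2)])
  then show ?thesis
    by (simp add: gradient_def scaleR_sum_right sum.distrib[symmetric] add_divide_distrib scaleR_add_left)
qed

text \<open>Differentiating one step gives for the gradient the same recursion as for the error of
  two runs, now with vectors \<open>h (enc j)\<close> in place of noise values. Only their norms
  enter, which is why one bound serves both isonormal processes.\<close>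

lemma gradient_scheme_bound:
  fixes h :: "nat \<Rightarrow> 'h::real_normed_vector"
  assumes g: "\<And>k f. elem_fun m f \<Longrightarrow> elem_fun m (\<lambda>w. g k (f w))"
    and g': "\<And>k y. k < n \<Longrightarrow> (g k has_real_derivative g' k y) (at y)"
    and q: "\<And>k y. k < n \<Longrightarrow> 0 \<le> g' k y" "\<And>k y. k < n \<Longrightarrow> g' k y \<le> 1 + l k"
    and l: "\<And>k. k < n \<Longrightarrow> 0 \<le> l k" and \<sigma>: "0 \<le> \<sigma>"
    and enc: "\<And>k. k \<le> n \<Longrightarrow> enc k < m" and h: "\<And>i. norm (h i) \<le> 1"
  shows "norm (gradient h m (\<lambda>v. scheme g \<sigma> x0 n (\<lambda>k. v (enc k))) v) \<le> \<sigma> * (1 + exp (2 * (\<Sum>k<n. l k)))"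
proof -
  define s where "s j v = scheme g \<sigma> x0 j (\<lambda>k. v (enc k))" for j and v :: "nat \<Rightarrow> real"
  have el: "elem_fun m (s j)" if "j \<le> n" for j
    unfolding s_def by (rule elem_fun_scheme[OF g enc that])
  define \<delta> where "\<delta> i a = (if i = a then 1 else 0 :: real)" for i a :: nat
  have pd: "partial_d i (s (Suc j)) v = g' j (s j v) * partial_d i (s j) v - \<sigma> * (\<delta> i (enc (Suc j)) - \<delta> i (enc j))"
    if j: "j < n" for i j v
    unfolding partial_d_def[of i "s (Suc j)"]
  proof (rule DERIV_imp_deriv)
    have c: "((\<lambda>y. (v(i := y)) a) has_real_derivative \<delta> i a) (at (v i))" for a
      by (auto simp: \<delta>_def intro!: derivative_eq_intros)
    have "((\<lambda>y. g j (s j (v(i := y)))) has_real_derivative g' j (s j v) * partial_d i (s j) v) (at (v i))"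
      using DERIV_chain2[OF g'[OF j] elem_fun_partial_d(2)[OF el, of j v i]] j by simp
    then have "((\<lambda>y. g j (s j (v(i := y))) - \<sigma> * ((v(i := y)) (enc (Suc j)) - (v(i := y)) (enc j))) has_real_derivative
        g' j (s j v) * partial_d i (s j) v - \<sigma> * (\<delta> i (enc (Suc j)) - \<delta> i (enc j))) (at (v i))"
      by (intro DERIV_diff DERIV_cmult c)
    then show "((\<lambda>y. s (Suc j) (v(i := y))) has_real_derivative
        g' j (s j v) * partial_d i (s j) v - \<sigma> * (\<delta> i (enc (Suc j)) - \<delta> i (enc j))) (at (v i))"
      by (simp add: s_def)
  qed
  have dsum: "(\<Sum>i<m. \<delta> i a *\<^sub>R h i) = h a" if "a < m" for a
  proof -
    have "(\<Sum>i<m. \<delta> i a *\<^sub>R h i) = (\<Sum>i<m. if i = a then h i else 0)"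
      by (intro sum.cong) (auto simp: \<delta>_def)
    then show ?thesis using that by simp
  qed
  have "norm (gradient h m (s n) v) \<le> \<sigma> * 1 * (1 + exp (2 * (\<Sum>k<n. l k)))"
  proof (rule recursion_bound[where e = "\<lambda>j. gradient h m (s j) v" and q = "\<lambda>j. g' j (s j v)" and d = "\<lambda>j. h (enc j)"])
    fix j assume j: "j < n"
    have "gradient h m (s (Suc j)) v = (\<Sum>i<m. g' j (s j v) *\<^sub>R (partial_d i (s j) v *\<^sub>R h i)
        - \<sigma> *\<^sub>R (\<delta> i (enc (Suc j)) *\<^sub>R h i - \<delta> i (enc j) *\<^sub>R h i))"
      unfolding gradient_def pd[OF j] by (intro sum.cong) (auto simp: algebra_simps)
    also have "\<dots> = g' j (s j v) *\<^sub>R gradient h m (s j) v - \<sigma> *\<^sub>R (h (enc (Suc j)) - h (enc j))"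
      unfolding gradient_def sum_subtractf scaleR_sum_right[symmetric]
      using dsum[OF enc[of "Suc j"]] dsum[OF enc[of j]] j by simp
    finally show "gradient h m (s (Suc j)) v = g' j (s j v) *\<^sub>R gradient h m (s j) v - \<sigma> *\<^sub>R (h (enc (Suc j)) - h (enc j))" .
  next
    have "s 0 = (\<lambda>_. x0)" by (simp add: s_def fun_eq_iff)
    then show "gradient h m (s 0) v = 0" by (simp add: gradient_def partial_d_def)
  qed (use q l h \<sigma> in auto)
  then show ?thesis by (simp add: s_def[abs_def])
qed

section \<open>Measurability with respect to the completed filtration\<close>

lemma scheme_cong:
  "(\<And>k. k \<le> n \<Longrightarrow> v k = w k) \<Longrightarrow> scheme g \<sigma> x0 n v = scheme g \<sigma> x0 n w"
  by (induction n) auto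

lemma completed_filtration_measurable:
  "s \<in> {0..t} \<Longrightarrow> B s \<in> borel_measurable (completed_filtration M B t)"
  and completed_filtration_null_sets: "Z \<in> null_sets M \<Longrightarrow> Z \<in> sets (completed_filtration M B t)"
  and space_completed_filtration: "space (completed_filtration M B t) = space M"
proof -
  let ?G = "{B s -` A \<inter> space M | s A. s \<in> {0..t} \<and> A \<in> sets borel} \<union> null_sets M"
  have G: "?G \<subseteq> Pow (space M)" using sets.sets_into_space by (fastforce simp: null_sets_def)
  show sp: "space (completed_filtration M B t) = space M"
    unfolding completed_filtration_def by (rule space_measure_of[OF G])
  have st: "sets (completed_filtration M B t) = sigma_sets (space M) ?G"
    unfolding completed_filtration_def by (rule sets_measure_of[OF G])
  show "Z \<in> null_sets M \<Longrightarrow> Z \<in> sets (completed_filtration M B t)"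
    unfolding st by (intro sigma_sets.Basic) simp
  assume s: "s \<in> {0..t}"
  show "B s \<in> borel_measurable (completed_filtration M B t)"
  proof (rule measurableI)
    show "B s -` A \<inter> space (completed_filtration M B t) \<in> sets (completed_filtration M B t)"
      if "A \<in> sets borel" for A
      unfolding st sp using s that by (intro sigma_sets.Basic) blast
  qed simp
qed

lemma measurable_completed_filtration_imp:
  assumes f: "f \<in> borel_measurable (completed_filtration M B t)"
    and B: "\<And>s. s \<in> {0..t} \<Longrightarrow> B s \<in> borel_measurable M"
  shows "f \<in> borel_measurable M"
proof -
  let ?G = "{B s -` A \<inter> space M | s A. s \<in> {0..t} \<and> A \<in> sets borel} \<union> null_sets M"
  have G: "?G \<subseteq> sets M" using measurable_sets[OF B] by auto
  then have "?G \<subseteq> Pow (space M)" using sets.space_closed by blast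
  then have "sets (completed_filtration M B t) = sigma_sets (space M) ?G"
    unfolding completed_filtration_def by (rule sets_measure_of)
  also have "\<dots> \<subseteq> sets M" by (rule sets.sigma_sets_subset[OF G])
  finally show ?thesis
    using f measurable_sets[OF f] space_completed_filtration[of M B t] by (intro measurableI) auto
qed

section \<open>Strong solutions and their Malliavin differentiability\<close>

locale fbm_equation = prob_space M + singular_drift u v u' v' H C p c y0
  for M :: "'a measure" and u v u' v' :: "real \<Rightarrow> real" and H C p c y0 :: real +
  fixes B :: "real \<Rightarrow> 'a \<Rightarrow> real" and \<sigma> x0 :: real
  assumes Hp: "1 < H * (p + 1)" and fbm: "fractional_BM M H B" and \<sigma>: "0 < \<sigma>" and x0: "0 < x0"
begin

lemma B_measurable: "t \<in> {0..1} \<Longrightarrow> B t \<in> borel_measurable M"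
  using fractional_BM_rv[OF fbm] by (simp add: gaussian_rv_def)

text \<open>\<open>Hp\<close> opens the window between 1/(p + 1), needed for the lower barrier, and
  H, the limit of the path regularity.\<close>

lemma holder_exponent: obtains \<gamma> where "0 < \<gamma>" "\<gamma> < 1" "\<gamma> < H" "1 < \<gamma> * (p + 1)"
proof -
  have p1: "0 < p + 1" using pcy by simp
  then have "1 / (p + 1) < H" using Hp by (simp add: divide_less_eq)
  then obtain \<gamma> where \<gamma>: "1 / (p + 1) < \<gamma>" "\<gamma> < H" using dense by blast
  have "0 < 1 / (p + 1)" using p1 by simp
  then have "0 < \<gamma>" using \<gamma>(1) by linarith
  then show ?thesis using that[of \<gamma>] \<gamma> H p1 by (simp add: divide_less_eq)
qed

text \<open>Both solutions are the limit of the same sequence of schemes.\<close>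

lemma path_solution_unique:
  assumes "path_solution b \<sigma> x0 \<beta> x" "path_solution b \<sigma> x0 \<beta> y" "\<beta> 0 = 0" "t \<in> {0..1}"
  shows "x t = y t"
proof -
  have t: "0 \<le> t" "t \<le> 1" using assms(4) by auto
  show ?thesis
  proof (rule scheme_exists[OF t])
    fix g g' :: "nat \<Rightarrow> nat \<Rightarrow> real \<Rightarrow> real" and l :: "nat \<Rightarrow> nat \<Rightarrow> real" and nn :: "nat \<Rightarrow> nat" and \<Lambda> :: real
    assume lim: "\<And>\<sigma> x0 \<beta> x. path_solution b \<sigma> x0 \<beta> x \<Longrightarrow> \<beta> 0 = 0 \<Longrightarrow>
      (\<lambda>N. scheme (g N) \<sigma> x0 (nn N) (\<lambda>k. \<beta> (t * k / nn N))) \<longlonglongrightarrow> x t"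
    show "x t = y t" by (rule LIMSEQ_unique[OF lim[OF assms(1,3)] lim[OF assms(2,3)]])
  qed
qed

lemma strong_solution_path:
  assumes "strong_positive_solution M B b \<sigma> x0 x"
  shows "AE \<omega> in M. path_solution b \<sigma> x0 (\<lambda>t. B t \<omega>) (\<lambda>t. x t \<omega>)"
  using assms unfolding strong_positive_solution_def continuous_process_def path_solution_def
  by auto

lemma strong_solution_unique:
  assumes "strong_positive_solution M B b \<sigma> x0 x" "strong_positive_solution M B b \<sigma> x0 y"
  shows "AE \<omega> in M. \<forall>t\<in>{0..1}. x t \<omega> = y t \<omega>"
  using strong_solution_path[OF assms(1)] strong_solution_path[OF assms(2)] fractional_BM_0[OF fbm H(1)]
proof eventually_elim
  case (elim \<omega>)
  then show ?case by (intro ballI path_solution_unique[of "\<lambda>t. B t \<omega>" "\<lambda>t. x t \<omega>" "\<lambda>t. y t \<omega>"]) auto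
qed

text \<open>Choosing a solution separately for each path gives no measurability. It is recovered
  because the chosen value at time \<open>t\<close> is the limit of schemes that read the noise at
  times up to \<open>t\<close> only.\<close>

lemma strong_solution_exists: "\<exists>x. strong_positive_solution M B b \<sigma> x0 x"
proof -
  obtain \<gamma> where \<gamma>: "0 < \<gamma>" "\<gamma> < 1" "\<gamma> < H" "1 < \<gamma> * (p + 1)" by (rule holder_exponent)
  obtain A where A: "AE \<omega> in M. \<forall>s\<in>{0..1}. \<forall>t\<in>{0..1}. \<bar>B t \<omega> - B s \<omega>\<bar> \<le> A \<omega> * \<bar>t - s\<bar> powr \<gamma>"
    by (rule fractional_BM_holder[OF fbm \<gamma>(1,3)]) blast
  have "AE \<omega> in M. continuous_on {0..1} (\<lambda>t. B t \<omega>)"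
    using fbm by (simp add: fractional_BM_def continuous_process_def)
  with A fractional_BM_0[OF fbm H(1)]
  have "AE \<omega> in M. B 0 \<omega> = 0 \<and> (\<exists>x. path_solution b \<sigma> x0 (\<lambda>t. B t \<omega>) x)"
  proof eventually_elim
    case (elim \<omega>)
    obtain x where "path_solution b \<sigma> x0 (\<lambda>t. B t \<omega>) x"
      by (rule path_solution_exists[OF \<gamma>(1,2,4) \<sigma> x0, of "\<lambda>t. B t \<omega>" "A \<omega>"]) (use elim in auto)
    then show ?case using elim by blast
  qed
  then obtain Z where Z: "Z \<in> null_sets M"
    "{\<omega> \<in> space M. \<not> (B 0 \<omega> = 0 \<and> (\<exists>x. path_solution b \<sigma> x0 (\<lambda>t. B t \<omega>) x))} \<subseteq> Z"
    unfolding eventually_ae_filter by blast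
  define X where "X \<omega> = (SOME x. path_solution b \<sigma> x0 (\<lambda>t. B t \<omega>) x)" for \<omega>
  \<comment> \<open>The value on the null set \<open>Z\<close> is arbitrary; a constant keeps
    adaptedness, since \<open>Z\<close> belongs to the completed filtration at every time.\<close>
  define x where "x t \<omega> = (if \<omega> \<in> Z then 1 else X \<omega> t)" for t \<omega>
  have B0: "B 0 \<omega> = 0" and ex: "\<exists>x. path_solution b \<sigma> x0 (\<lambda>t. B t \<omega>) x"
    if "\<omega> \<in> space M" "\<omega> \<notin> Z" for \<omega>
    using Z(2) that by blast+
  have X: "path_solution b \<sigma> x0 (\<lambda>t. B t \<omega>) (X \<omega>)" if "\<omega> \<in> space M" "\<omega> \<notin> Z" for \<omega>
    unfolding X_def by (rule someI_ex[OF ex[OF that]])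
  have ae: "AE \<omega> in M. path_solution b \<sigma> x0 (\<lambda>t. B t \<omega>) (\<lambda>t. x t \<omega>)"
    using AE_not_in[OF Z(1)] AE_space
  proof eventually_elim
    case (elim \<omega>)
    then show ?case using X[of \<omega>] by (simp add: x_def)
  qed
  have adapted: "x t \<in> borel_measurable (completed_filtration M B t)" if t: "t \<in> {0..1}" for t
  proof -
    let ?F = "completed_filtration M B t"
    have t': "0 \<le> t" "t \<le> 1" using t by auto
    show ?thesis
    proof (rule scheme_exists[OF t'])
      fix g g' :: "nat \<Rightarrow> nat \<Rightarrow> real \<Rightarrow> real" and l :: "nat \<Rightarrow> nat \<Rightarrow> real" and nn :: "nat \<Rightarrow> nat" and \<Lambda> :: real
      assume nn: "\<And>N. 0 < nn N"
        and g: "\<And>N k m f. elem_fun m f \<Longrightarrow> elem_fun m (\<lambda>w. g N k (f w))"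
        and lim: "\<And>\<sigma> x0 \<beta> x. path_solution b \<sigma> x0 \<beta> x \<Longrightarrow> \<beta> 0 = 0 \<Longrightarrow>
          (\<lambda>N. scheme (g N) \<sigma> x0 (nn N) (\<lambda>k. \<beta> (t * k / nn N))) \<longlonglongrightarrow> x t"
      define S where "S N \<omega> = scheme (g N) \<sigma> x0 (nn N) (\<lambda>k. B (t * k / nn N) \<omega>)" for N \<omega>
      have S: "S N \<in> borel_measurable ?F" for N
        unfolding S_def
      proof (rule elem_fun_measurable[where n = "Suc (nn N)"
            and f = "\<lambda>w. scheme (g N) \<sigma> x0 (nn N) (\<lambda>k. w k)" and V = "\<lambda>k. B (t * real k / nn N)"])
        show "elem_fun (Suc (nn N)) (\<lambda>w. scheme (g N) \<sigma> x0 (nn N) (\<lambda>k. w k))"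
          by (rule elem_fun_scheme[OF g, where enc = "\<lambda>k. k" and n = "nn N"]) simp_all
        fix k assume "k < Suc (nn N)"
        then have "t * k / nn N \<le> t * nn N / nn N" using t' by (intro divide_right_mono mult_left_mono) auto
        also have "\<dots> = t" using less_imp_neq[OF nn[of N]] by simp
        finally have "t * k / nn N \<le> t" .
        moreover have "0 \<le> t * k / nn N" using t' by simp
        ultimately have "t * k / nn N \<in> {0..t}" by (simp only: atLeastAtMost_iff)
        then show "B (t * real k / nn N) \<in> borel_measurable ?F"
          by (rule completed_filtration_measurable)
      qed
      show "x t \<in> borel_measurable ?F"
      proof (rule borel_measurable_LIMSEQ_metric)
        show "(\<lambda>\<omega>. if \<omega> \<in> Z then 1 else S N \<omega>) \<in> borel_measurable ?F" for N
        proof -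
          have "Z \<inter> space M = Z" by (rule sets.Int_space_eq2) (use Z(1) in auto)
          then show ?thesis
            using completed_filtration_null_sets[OF Z(1), of B t] S[of N]
            by (intro measurable_If_set) (auto simp: space_completed_filtration)
        qed
        show "(\<lambda>N. if \<omega> \<in> Z then 1 else S N \<omega>) \<longlonglongrightarrow> x t \<omega>" if "\<omega> \<in> space ?F" for \<omega>
        proof (cases "\<omega> \<in> Z")
          case False
          have "\<omega> \<in> space M" using that by (simp add: space_completed_filtration)
          then show ?thesis using lim[OF X B0] False by (simp add: S_def x_def)
        qed (simp add: x_def)
      qed
    qed
  qed
  have "strong_positive_solution M B b \<sigma> x0 x"
    unfolding strong_positive_solution_def continuous_process_def
    using ae adapted unfolding path_solution_def by auto
  then show ?thesis by blast
qed

text \<open>The isonormal process is left open: all that is used is that vectors of norm at most 1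
  represent the values of the noise. The same argument then covers \<open>BH\<close> with the
  vectors \<open>e r\<close> and \<open>WL\<close> with their images under \<open>K\<close>.\<close>

lemma strong_solution_malliavin:
  fixes X :: "'h::{real_inner,complete_space} \<Rightarrow> 'a \<Rightarrow> real"
  assumes x: "strong_positive_solution M B b \<sigma> x0 x" and t: "t \<in> {0..1}"
    and Xm: "\<And>h. X h \<in> borel_measurable M"
    and XB: "\<And>r. r \<in> {0..1} \<Longrightarrow> AE \<omega> in M. X (e r) \<omega> = B r \<omega>"
    and ne: "\<And>r. r \<in> {0..1} \<Longrightarrow> norm (e r) \<le> 1"
  shows "x t \<in> malliavin_domain M X"
proof -
  have t': "0 \<le> t" "t \<le> 1" using t by auto
  obtain \<gamma> where \<gamma>: "0 < \<gamma>" "\<gamma> < 1" "\<gamma> < H" "1 < \<gamma> * (p + 1)" by (rule holder_exponent)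
  obtain A where Am [measurable]: "A \<in> borel_measurable M" and A0: "\<And>\<omega>. 0 \<le> A \<omega>"
    and Ai: "integrable M (\<lambda>\<omega>. (A \<omega>)\<^sup>2)"
    and A: "AE \<omega> in M. \<forall>s\<in>{0..1}. \<forall>t\<in>{0..1}. \<bar>B t \<omega> - B s \<omega>\<bar> \<le> A \<omega> * \<bar>t - s\<bar> powr \<gamma>"
    by (rule fractional_BM_holder[OF fbm \<gamma>(1,3)]) blast
  have xm [measurable]: "x t \<in> borel_measurable M"
    by (rule measurable_completed_filtration_imp[of _ _ B t])
      (use x t B_measurable in \<open>auto simp: strong_positive_solution_def\<close>)
  show ?thesis
  proof (rule scheme_exists[OF t'])
    fix g g' :: "nat \<Rightarrow> nat \<Rightarrow> real \<Rightarrow> real" and l :: "nat \<Rightarrow> nat \<Rightarrow> real" and nn :: "nat \<Rightarrow> nat" and \<Lambda> :: real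
    assume nn: "\<And>N. 0 < nn N"
      and g: "\<And>N k m f. elem_fun m f \<Longrightarrow> elem_fun m (\<lambda>w. g N k (f w))"
      and g': "\<And>N k y. k < nn N \<Longrightarrow> (g N k has_real_derivative g' N k y) (at y)"
        "\<And>N k y. k < nn N \<Longrightarrow> 0 \<le> g' N k y" "\<And>N k y. k < nn N \<Longrightarrow> g' N k y \<le> 1 + l N k"
      and l: "\<And>N k. k < nn N \<Longrightarrow> 0 \<le> l N k" and \<Lambda>: "\<And>N. (\<Sum>k<nn N. l N k) \<le> \<Lambda>"
      and lim: "\<And>\<sigma> x0 \<beta> x. path_solution b \<sigma> x0 \<beta> x \<Longrightarrow> \<beta> 0 = 0 \<Longrightarrow>
        (\<lambda>N. scheme (g N) \<sigma> x0 (nn N) (\<lambda>k. \<beta> (t * k / nn N))) \<longlonglongrightarrow> x t"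
    define L where "L = \<sigma> * (1 + exp (2 * \<Lambda>))"
    have L: "\<sigma> * (1 + exp (2 * (\<Sum>k<nn N. l N k))) \<le> L" for N
      unfolding L_def using \<Lambda>[of N] \<sigma> by (intro mult_left_mono) auto
    \<comment> \<open>Indices beyond the last grid point are sent to \<open>t\<close>, so that every
      direction in the sequence \<open>h\<close>, used or not, has norm at most 1.\<close>
    define time where "time N k = t * real (min k (nn N)) / nn N" for N k
    have time: "time N k \<in> {0..1}" for N k
    proof -
      have "t * real (min k (nn N)) \<le> 1 * real (nn N)" using t' by (intro mult_mono) auto
      then show ?thesis using t' nn[of N] by (simp add: time_def divide_le_eq)
    qed
    have time_eq: "time N k = t * real k / nn N" if "k \<le> nn N" for N k
      using that by (simp add: time_def min_absorb1)
    \<comment> \<open>One sequence enumerates the grid points of all schemes through the pairing of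
      \<open>N\<close> and \<open>k\<close>.\<close>
    define h where "h i = (case prod_decode i of (N, k) \<Rightarrow> e (time N k))" for i
    have nh: "norm (h i) \<le> 1" for i using ne[OF time] by (simp add: h_def split: prod.split)
    define V where "V \<omega> i = X (h i) \<omega>" for \<omega> i
    define m where "m N = Suc (Max ((\<lambda>k. prod_encode (N, k)) ` {..nn N}))" for N
    have enc: "prod_encode (N, k) < m N" if "k \<le> nn N" for N k
      using that by (auto simp: m_def less_Suc_eq_le intro!: Max_ge)
    define f where "f N v = scheme (g N) \<sigma> x0 (nn N) (\<lambda>k. v (prod_encode (N, k)))" for N and v :: "nat \<Rightarrow> real"
    have ef: "elem_fun (m N) (f N)" for N
      unfolding f_def by (rule elem_fun_scheme[OF g enc]) auto
    \<comment> \<open>Evaluated at the versions \<open>X (h i)\<close>, because cylindrical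
      variables must have their form at every sample point; agreement with the scheme driven by
      \<open>B\<close> holds almost surely, for all the countably many grid points together.\<close>
    define Fs where "Fs N \<omega> = f N (V \<omega>)" for N \<omega>
    define Ds where "Ds N \<omega> = gradient h (m N) (f N) (V \<omega>)" for N \<omega>
    define P where "P F D \<longleftrightarrow> (\<exists>n \<phi>. elem_fun n \<phi> \<and> (\<forall>\<omega>. F \<omega> = \<phi> (V \<omega>)) \<and> (\<forall>\<omega>. D \<omega> = gradient h n \<phi> (V \<omega>)))"
      for F and D :: "'a \<Rightarrow> 'h"
    have Vm: "(\<lambda>\<omega>. \<phi> (V \<omega>)) \<in> borel_measurable M" if "elem_fun n \<phi>" for n \<phi>
      unfolding V_def by (rule elem_fun_measurable[OF that]) (rule Xm)
    have Fsm [measurable]: "Fs N \<in> borel_measurable M" for N unfolding Fs_def by (rule Vm[OF ef])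
    have AEV: "AE \<omega> in M. \<forall>N k. V \<omega> (prod_encode (N, k)) = B (time N k) \<omega>"
      unfolding AE_all_countable V_def h_def using XB[OF time] by simp
    \<comment> \<open>With zero noise the schemes converge to the deterministic solution and hence
      form a bounded sequence; the Lipschitz bound in the noise does the rest.\<close>
    obtain K0 where K0: "\<And>N. \<bar>scheme (g N) \<sigma> x0 (nn N) (\<lambda>_. 0)\<bar> \<le> K0"
    proof -
      obtain z where "path_solution b \<sigma> x0 (\<lambda>_. 0) z"
        by (rule path_solution_exists[OF \<gamma>(1,2,4) \<sigma> x0, of "\<lambda>_. 0" 0]) auto
      from lim[OF this] have "(\<lambda>N. scheme (g N) \<sigma> x0 (nn N) (\<lambda>_. 0)) \<longlonglongrightarrow> z t" by simp
      then have "Bseq (\<lambda>N. scheme (g N) \<sigma> x0 (nn N) (\<lambda>_. 0))" by (rule convergent_imp_Bseq[OF convergentI])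
      then show ?thesis using that unfolding Bseq_def by auto
    qed
    define w where "w \<omega> = K0 + L * A \<omega>" for \<omega>
    have ev: "AE \<omega> in M. (\<lambda>N. Fs N \<omega>) \<longlonglongrightarrow> x t \<omega> \<and> (\<forall>N. \<bar>Fs N \<omega>\<bar> \<le> w \<omega>)"
      using strong_solution_path[OF x] fractional_BM_0[OF fbm H(1)] A AEV
    proof eventually_elim
      case (elim \<omega>)
      have F: "Fs N \<omega> = scheme (g N) \<sigma> x0 (nn N) (\<lambda>k. B (t * k / nn N) \<omega>)" for N
        unfolding Fs_def f_def by (rule scheme_cong) (simp add: elim(4) time_eq)
      have "(\<lambda>N. Fs N \<omega>) \<longlonglongrightarrow> x t \<omega>" unfolding F by (rule lim[OF elim(1)]) (rule elim(2))
      moreover have "\<bar>Fs N \<omega>\<bar> \<le> w \<omega>" for N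
      proof -
        have "\<bar>scheme (g N) \<sigma> x0 (nn N) (\<lambda>k. B (t * k / nn N) \<omega>) - scheme (g N) \<sigma> x0 (nn N) (\<lambda>_. 0)\<bar>
            \<le> \<sigma> * A \<omega> * (1 + exp (2 * (\<Sum>k<nn N. l N k)))"
        proof (rule scheme_lipschitz[OF g' l])
          fix k assume "k \<le> nn N"
          then have r: "t * k / nn N \<in> {0..1}" using time[of N k] by (simp add: time_eq)
          then have "\<bar>B (t * k / nn N) \<omega> - B 0 \<omega>\<bar> \<le> A \<omega> * \<bar>t * k / nn N - 0\<bar> powr \<gamma>"
            using elim(3) by (meson atLeastAtMost_iff order_refl zero_le_one)
          also have "\<dots> \<le> A \<omega> * 1 powr \<gamma>"
            using r A0 \<gamma> by (intro mult_left_mono powr_mono2) auto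
          finally show "\<bar>B (t * k / nn N) \<omega> - 0\<bar> \<le> A \<omega>" using elim(2) by simp
        qed (use \<sigma> in auto)
        also have "\<dots> = \<sigma> * (1 + exp (2 * (\<Sum>k<nn N. l N k))) * A \<omega>" by simp
        also have "\<dots> \<le> L * A \<omega>" by (rule mult_right_mono[OF L A0])
        finally show ?thesis unfolding F w_def using K0[of N] by linarith
      qed
      ultimately show ?case by blast
    qed
    have xw: "AE \<omega> in M. \<bar>x t \<omega>\<bar> \<le> w \<omega>" using ev
    proof eventually_elim
      case (elim \<omega>)
      then have "(\<lambda>N. \<bar>Fs N \<omega>\<bar>) \<longlonglongrightarrow> \<bar>x t \<omega>\<bar>" by (intro tendsto_intros) auto
      then show ?case by (rule Lim_bounded[of _ _ 0]) (use elim in auto)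
    qed
    have wm [measurable]: "w \<in> borel_measurable M" unfolding w_def by measurable
    have wi: "integrable M (\<lambda>\<omega>. (w \<omega>)\<^sup>2)"
    proof (rule Bochner_Integration.integrable_bound)
      show "integrable M (\<lambda>\<omega>. 2 * K0\<^sup>2 + 2 * L\<^sup>2 * (A \<omega>)\<^sup>2)" using Ai by simp
      have "(a + d)\<^sup>2 \<le> 2 * a\<^sup>2 + 2 * d\<^sup>2" for a d :: real
        using zero_le_power2[of "a - d"] by (simp add: power2_eq_square algebra_simps)
      from this[of K0 "L * A \<omega>" for \<omega>]
      show "AE \<omega> in M. norm ((w \<omega>)\<^sup>2) \<le> norm (2 * K0\<^sup>2 + 2 * L\<^sup>2 * (A \<omega>)\<^sup>2)"
        by (simp add: w_def power_mult_distrib mult.assoc)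
    qed measurable
    have xi: "integrable M (\<lambda>\<omega>. (x t \<omega>)\<^sup>2)"
    proof (rule Bochner_Integration.integrable_bound[OF wi])
      show "AE \<omega> in M. norm ((x t \<omega>)\<^sup>2) \<le> norm ((w \<omega>)\<^sup>2)"
        using xw by eventually_elim (simp add: abs_le_square_iff[symmetric])
    qed measurable
    have "(\<lambda>N. \<integral>\<omega>. (Fs N \<omega> - x t \<omega>)\<^sup>2 \<partial>M) \<longlonglongrightarrow> (\<integral>\<omega>. 0 \<partial>M)"
    proof (rule integral_dominated_convergence[where w = "\<lambda>\<omega>. 4 * (w \<omega>)\<^sup>2"])
      show "AE \<omega> in M. (\<lambda>N. (Fs N \<omega> - x t \<omega>)\<^sup>2) \<longlonglongrightarrow> 0" using ev
      proof eventually_elim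
        case (elim \<omega>)
        then have "(\<lambda>N. (Fs N \<omega> - x t \<omega>)\<^sup>2) \<longlonglongrightarrow> (x t \<omega> - x t \<omega>)\<^sup>2" by (intro tendsto_intros) auto
        then show ?case by simp
      qed
      show bd: "AE \<omega> in M. norm ((Fs N \<omega> - x t \<omega>)\<^sup>2) \<le> 4 * (w \<omega>)\<^sup>2" for N
        using ev xw
      proof eventually_elim
        case (elim \<omega>)
        then have "\<bar>Fs N \<omega>\<bar> \<le> w \<omega>" by blast
        with elim(2) have "\<bar>Fs N \<omega> - x t \<omega>\<bar> \<le> 2 * w \<omega>" by linarith
        then have "\<bar>Fs N \<omega> - x t \<omega>\<bar>\<^sup>2 \<le> (2 * w \<omega>)\<^sup>2" by (rule power_mono) simp
        then show ?case by (simp add: power_mult_distrib)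
      qed
    qed (use wi in auto)
    moreover have "integrable M (\<lambda>\<omega>. (Fs N \<omega> - x t \<omega>)\<^sup>2)" for N
    proof (rule Bochner_Integration.integrable_bound)
      show "integrable M (\<lambda>\<omega>. 4 * (w \<omega>)\<^sup>2)" using wi by simp
      show "AE \<omega> in M. norm ((Fs N \<omega> - x t \<omega>)\<^sup>2) \<le> norm (4 * (w \<omega>)\<^sup>2)"
        using ev xw
      proof eventually_elim
        case (elim \<omega>)
        then have "\<bar>Fs N \<omega>\<bar> \<le> w \<omega>" by blast
        with elim(2) have "\<bar>Fs N \<omega> - x t \<omega>\<bar> \<le> 2 * w \<omega>" by linarith
        then have "\<bar>Fs N \<omega> - x t \<omega>\<bar>\<^sup>2 \<le> (2 * w \<omega>)\<^sup>2" by (rule power_mono) simp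
        then show ?case by (simp add: power_mult_distrib)
      qed
    qed measurable
    ultimately have L2: "(\<lambda>N. \<integral>\<^sup>+\<omega>. ennreal ((Fs N \<omega> - x t \<omega>)\<^sup>2) \<partial>M) \<longlonglongrightarrow> 0"
      using tendsto_ennrealI[of "\<lambda>N. \<integral>\<omega>. (Fs N \<omega> - x t \<omega>)\<^sup>2 \<partial>M" 0 sequentially]
      by (simp add: nn_integral_eq_integral)
    show "x t \<in> malliavin_domain M X"
    proof (rule malliavin_domain_bounded_deriv[where P = P and Fs = Fs and Ds = Ds and h = h and C = L])
      show "P (Fs N) (Ds N)" for N unfolding P_def Fs_def Ds_def using ef by blast
      show "P (\<lambda>\<omega>. (F \<omega> + F' \<omega>) / 2) (\<lambda>\<omega>. (1/2) *\<^sub>R D \<omega> + (1/2) *\<^sub>R D' \<omega>)"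
        if PF: "P F D" and PF': "P F' D'" for F D F' D'
      proof -
        obtain n \<phi> where 1: "elem_fun n \<phi>" "\<And>\<omega>. F \<omega> = \<phi> (V \<omega>)" "\<And>\<omega>. D \<omega> = gradient h n \<phi> (V \<omega>)"
          using PF unfolding P_def by blast
        obtain n' \<phi>' where 2: "elem_fun n' \<phi>'" "\<And>\<omega>. F' \<omega> = \<phi>' (V \<omega>)" "\<And>\<omega>. D' \<omega> = gradient h n' \<phi>' (V \<omega>)"
          using PF' unfolding P_def by blast
        define n2 where "n2 = max n n'"
        have e1: "elem_fun n2 \<phi>" by (rule elem_fun_mono[OF 1(1)]) (simp add: n2_def)
        have e2: "elem_fun n2 \<phi>'" by (rule elem_fun_mono[OF 2(1)]) (simp add: n2_def)
        have e3: "elem_fun n2 (\<lambda>v. (\<phi> v + \<phi>' v) / 2)"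
          using elem_mult[OF elem_const[of n2 "1/2"] elem_add[OF e1 e2]] by simp
        have "gradient h n2 \<phi> v = gradient h n \<phi> v" "gradient h n2 \<phi>' v = gradient h n' \<phi>' v" for v
          by (rule gradient_extend[OF 1(1)] gradient_extend[OF 2(1)], simp add: n2_def)+
        then show ?thesis unfolding P_def using e3 1 2 gradient_midpoint[OF e1 e2, of h]
          by (intro exI[of _ n2] exI[of _ "\<lambda>v. (\<phi> v + \<phi>' v) / 2"]) simp
      qed
      show "cylindrical_deriv M X F D" if PF: "P F D" for F D
      proof -
        obtain n \<phi> where "elem_fun n \<phi>" "\<And>\<omega>. F \<omega> = \<phi> (V \<omega>)" "\<And>\<omega>. D \<omega> = gradient h n \<phi> (V \<omega>)"
          using PF unfolding P_def by blast
        then show ?thesis unfolding cylindrical_deriv_def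
          by (intro exI[of _ n] exI[of _ \<phi>] exI[of _ h])
            (auto simp: elem_fun_smooth V_def[abs_def] gradient_def)
      qed
      show "fin_comb M h D" if PF: "P F D" for F D
      proof -
        obtain n \<phi> where \<phi>: "elem_fun n \<phi>" "\<And>\<omega>. D \<omega> = gradient h n \<phi> (V \<omega>)"
          using PF unfolding P_def by blast
        show ?thesis unfolding fin_comb_def
          by (intro exI[of _ n] exI[of _ "\<lambda>i \<omega>. partial_d i \<phi> (V \<omega>)"])
            (auto simp: \<phi>(2) gradient_def intro: Vm elem_fun_partial_d(1)[OF \<phi>(1)])
      qed
      show "norm (Ds N \<omega>) \<le> L" for N \<omega>
        unfolding Ds_def f_def
        by (rule order_trans[OF gradient_scheme_bound[OF g g' l _ enc nh] L]) (use \<sigma> in auto)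
    qed (use L2 xi xm Fsm in auto)
  qed
qed

end

theorem theorem4p2:
  fixes M :: "'a measure"
    and B W :: "real \<Rightarrow> 'a \<Rightarrow> real"
    and e :: "real \<Rightarrow> 'h::{real_inner,complete_space}"
    and BH :: "'h \<Rightarrow> 'a \<Rightarrow> real"
    and f :: "real \<Rightarrow> real \<Rightarrow> real"
    and K :: "'h \<Rightarrow> L2"
    and WL :: "L2 \<Rightarrow> 'a \<Rightarrow> real"
    and H \<theta> \<rho> \<sigma> am1 a0 a1 a2 x0 :: real
  assumes "prob_space M" and "complete_measure M"
    and "0 < H" and "H < 1/2"
    and "\<theta> > 0" and "\<rho> > 1 + 1 / (H * \<theta>)" and "\<sigma> > 0"
    and "am1 > 0" and "a0 > 0" and "a1 > 0" and "a2 > 0" and "x0 > 0"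
    and "fractional_BM M H B"
    and "fbm_hilbert_space H e" and "isometric_extension M e B BH"
    and "K_star H e K" and "associated_Wiener M BH K W"
    and "isometric_extension M L2_ind W WL"
    and "f = drift H \<theta> \<rho> \<sigma> am1 a0 a1 a2"
  shows "(\<exists>x. strong_positive_solution M B f \<sigma> x0 x) \<and>
    (\<forall>x y. strong_positive_solution M B f \<sigma> x0 x \<longrightarrow>
       strong_positive_solution M B f \<sigma> x0 y \<longrightarrow>
       (AE \<omega> in M. \<forall>t\<in>{0..1}. x t \<omega> = y t \<omega>)) \<and>
    (\<forall>x. strong_positive_solution M B f \<sigma> x0 x \<longrightarrow>
       (\<forall>t\<in>{0..1}. x t \<in> malliavin_domain M BH \<and> x t \<in> malliavin_domain M WL))"
proof -
  obtain u v u' v' C p c y0 where sd: "singular_drift u v u' v' H C p c y0"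
    and Hp: "1 < H * (p + 1)" and f: "f = singular_drift.b u v H"
    using drift_singular_drift[OF assms(3-11)] assms(19) by blast
  interpret prob_space M by fact
  interpret singular_drift u v u' v' H C p c y0 by (rule sd)
  interpret fbm_equation M u v u' v' H C p c y0 B \<sigma> x0
    by unfold_locales (use Hp assms in auto)
  note BH = assms(15)[unfolded isometric_extension_def] and WL = assms(18)[unfolded isometric_extension_def]
  have norm_e: "norm (e r) \<le> 1" if "r \<in> {0..1}" for r
  proof -
    have "e r \<bullet> e r = fbm_cov H r r" using assms(14) that by (simp add: fbm_hilbert_space_def)
    also have "\<dots> = r powr (2 * H)" by (simp add: fbm_cov_def)
    also have "\<dots> \<le> 1 powr (2 * H)" using that H by (intro powr_mono2) auto
    finally show ?thesis by (simp add: norm_eq_sqrt_inner)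
  qed
  have norm_Ke: "norm (K (e r)) \<le> 1" if "r \<in> {0..1}" for r
    using norm_e[OF that] assms(16) by (simp add: K_star_def norm_eq_sqrt_inner)
  have BHB: "AE \<omega> in M. BH (e r) \<omega> = B r \<omega>" if "r \<in> {0..1}" for r using BH that by blast
  \<comment> \<open>Turns \<open>B r\<close> into a value of the Wiener isonormal process at a
    vector of norm at most 1, so that no separate analysis of the direction of \<open>W\<close> is
    needed.\<close>
  have WLB: "AE \<omega> in M. WL (K (e r)) \<omega> = B r \<omega>" if "r \<in> {0..1}" for r
    using Wiener_isonormal_eq[OF assms(15-18), of "e r"] BHB[OF that] by eventually_elim simp
  have "x t \<in> malliavin_domain M BH \<and> x t \<in> malliavin_domain M WL"
    if "strong_positive_solution M B b \<sigma> x0 x" "t \<in> {0..1}" for x t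
  proof
    show "x t \<in> malliavin_domain M BH"
      by (rule strong_solution_malliavin[OF that, where e = e]) (use BH BHB norm_e in auto)
    show "x t \<in> malliavin_domain M WL"
      by (rule strong_solution_malliavin[OF that, where e = "\<lambda>r. K (e r)"]) (use WL WLB norm_Ke in auto)
  qed
  then show ?thesis
    unfolding f using strong_solution_exists strong_solution_unique by blast
qed

end
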